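(* Let $f$ be a meromorphic function on $\mathbb{C}$ of finite order with convergence exponent $d\ge 1$ and with divisor contained in a left half-plane $\{\Re s\le \sigma_1\}$. Fix $\sigma\in\mathbb{C}$, let $W_\sigma(f)$ be its Newton–Cramer distribution and $P_{f,\sigma}(s)=c_0(\sigma)+c_1(\sigma)s+\dots+c_{g-1}(\sigma)s^{g-1}$ its discrepancy polynomial. Then, as distributions on $\mathbb{R}$, $$W_\sigma(f)=\sum_{j=0}^{g-1} c_j(\sigma)\,\delta_0^{(j)}+\mathcal{L}^{-1}(f'/f).$$
   Context: For $\rho\in\mathbb{C}$, $n_\rho\in\mathbb{Z}$ is the multiplicity of $\rho$ as a zero of $f$ (positive for zeros, negative for poles, $0$ otherwise). The convergence exponent $d$ is the least integer $d\ge0$ with $\sum_{\rho\neq0}|n_\rho||\rho|^{-d}<\infty$. A distribution $W$ on $\mathbb{R}$ is Laplace transformable if $\operatorname{supp}W\subset\,]-M,\infty[$ for some $M\in\mathbb{R}$ and $e^{-ct}W\in\mathcal{S}'(\mathbb{R})$ for some $c\in\mathbb{R}$. Newton–Cramer distribution: for $\sigma\in\mathbb{C}$ put $K_{d,\sigma}(t)=\big(n_\sigma \tfrac{t^d}{d!}+\sum_{\rho\neq\sigma}\tfrac{n_\rho}{(\rho-\sigma)^d}e^{(\rho-\sigma)t}\big)\mathbf{1}_{\mathbb{R}_+}(t)$ and $W_\sigma(f)=e^{\sigma t}\frac{D^d}{Dt^d}\big((K_{d,\sigma}(t)-K_{d,\sigma}(0))\mathbf{1}_{\mathbb{R}_+}(t)\big)$,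 with $\frac{D}{Dt}$ the distributional derivative (formally $W_\sigma(f)=\sum_\rho n_\rho e^{\rho t}$ on $]0,\infty[$). Discrepancy polynomial: with $m=d-1$ and $E_m(z)=(1-z)\exp(z+\frac{z^2}{2}+\dots+\frac{z^m}{m})$, write the Hadamard factorization $f(s)=(s-\sigma)^{n_\sigma}e^{Q_{f,\sigma}(s)}\prod_{\rho\neq\sigma}E_m\big(\frac{s-\sigma}{\rho-\sigma}\big)^{n_\rho}$ with $Q_{f,\sigma}$ a polynomial (unique up to an additive constant in $2\pi i\mathbb{Z}$). The genus is $g=\max(\deg Q_{f,\sigma},m)$, and $P_{f,\sigma}=-Q'_{f,\sigma}$, a polynomial of degree $\le g-1$. $\mathcal{L}^{-1}(F)$ denotes the inverse (right-sided) Laplace transform: for $F$ holomorphic with polynomial growth on a right half-plane, the unique Laplace transformable distribution whose Laplace transform $\langle \mathcal{L}^{-1}(F),e^{-st}\rangle$ equals $F(s)$ for $\Re s$ large. *)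

theory Defs
  imports "HOL-Complex_Analysis.Complex_Analysis" "HOL-Complex_Analysis.Weierstrass_Factorization"
begin

section \<open>Test functions and distributions on the real line\<close>

definition vderiv :: "(real \<Rightarrow> complex) \<Rightarrow> real \<Rightarrow> complex" where
  "vderiv \<phi> t = vector_derivative \<phi> (at t)"

definition smooth :: "(real \<Rightarrow> complex) \<Rightarrow> bool" where
  "smooth \<phi> \<longleftrightarrow> (\<forall>k t. (vderiv ^^ k) \<phi> differentiable (at t))"

definition fun_support :: "(real \<Rightarrow> complex) \<Rightarrow> real set" where
  "fun_support \<phi> = closure {t. \<phi> t \<noteq> 0}"

definition test_functions :: "(real \<Rightarrow> complex) set" where
  "test_functions = {\<phi>. smooth \<phi> \<and> compact (fun_support \<phi>)}"

definition schwartz_functions :: "(real \<Rightarrow> complex) set" where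
  "schwartz_functions =
     {\<phi>. smooth \<phi> \<and> (\<forall>j k. bounded (range (\<lambda>t. of_real (t ^ j) * (vderiv ^^ k) \<phi> t)))}"

definition schwartz_seminorm :: "nat \<Rightarrow> nat \<Rightarrow> (real \<Rightarrow> complex) \<Rightarrow> real" where
  "schwartz_seminorm j k \<phi> = (SUP t. \<bar>t\<bar> ^ j * norm ((vderiv ^^ k) \<phi> t))"

text \<open>
  Functionals are total functions on \<^typ>\<open>real \<Rightarrow> complex\<close>; only their values on the relevant
  space of functions are meaningful. In particular, two distributions are equal iff they agree on
  \<^const>\<open>test_functions\<close>.
\<close>

type_synonym functional = "(real \<Rightarrow> complex) \<Rightarrow> complex"

definition linear_functional_on :: "(real \<Rightarrow> complex) set \<Rightarrow> functional \<Rightarrow> bool" where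
  "linear_functional_on V T \<longleftrightarrow>
     (\<forall>\<phi>\<in>V. \<forall>\<psi>\<in>V. T (\<lambda>t. \<phi> t + \<psi> t) = T \<phi> + T \<psi>) \<and>
     (\<forall>c. \<forall>\<phi>\<in>V. T (\<lambda>t. c * \<phi> t) = c * T \<phi>)"

definition distribution :: "functional \<Rightarrow> bool" where
  "distribution T \<longleftrightarrow> linear_functional_on test_functions T \<and>
     (\<forall>K. compact K \<longrightarrow>
        (\<exists>C N. \<forall>\<phi>\<in>test_functions. fun_support \<phi> \<subseteq> K \<longrightarrow>
           norm (T \<phi>) \<le> C * (\<Sum>k\<le>N. SUP t. norm ((vderiv ^^ k) \<phi> t))))"

definition tempered_functional :: "functional \<Rightarrow> bool" where
  "tempered_functional U \<longleftrightarrow> linear_functional_on schwartz_functions U \<and>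
     (\<exists>C N. \<forall>\<phi>\<in>schwartz_functions.
        norm (U \<phi>) \<le> C * (\<Sum>j\<le>N. \<Sum>k\<le>N. schwartz_seminorm j k \<phi>))"

definition tempered_extension :: "functional \<Rightarrow> functional \<Rightarrow> bool" where
  "tempered_extension T U \<longleftrightarrow> tempered_functional U \<and> (\<forall>\<phi>\<in>test_functions. U \<phi> = T \<phi>)"

definition dist_support :: "functional \<Rightarrow> real set" where
  "dist_support T =
     - \<Union>{U. open U \<and> (\<forall>\<phi>\<in>test_functions. fun_support \<phi> \<subseteq> U \<longrightarrow> T \<phi> = 0)}"

definition dist_of_fun :: "(real \<Rightarrow> complex) \<Rightarrow> functional" where
  "dist_of_fun g \<phi> = (LINT t|lborel. g t * \<phi> t)"

definition dirac :: functional where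
  "dirac \<phi> = \<phi> 0"

definition dist_deriv :: "functional \<Rightarrow> functional" where
  "dist_deriv T \<phi> = - T (vderiv \<phi>)"

definition dist_mult :: "(real \<Rightarrow> complex) \<Rightarrow> functional \<Rightarrow> functional" where
  "dist_mult a T \<phi> = T (\<lambda>t. a t * \<phi> t)"


section \<open>The Laplace transform of a distribution\<close>

definition laplace_transformable :: "functional \<Rightarrow> bool" where
  "laplace_transformable W \<longleftrightarrow> distribution W \<and>
     (\<exists>M. dist_support W \<subseteq> {-M<..}) \<and>
     (\<exists>c::real. \<exists>U. tempered_extension (dist_mult (\<lambda>t. of_real (exp (- c * t))) W) U)"

text \<open>
  The pairing of \<open>W\<close> with \<open>e\<^sup>-\<^sup>s\<^sup>t\<close>, which is not a test function, is read as usual: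
  if \<open>U\<close> is the continuous extension of \<open>e\<^sup>-\<^sup>c\<^sup>t W\<close> to Schwartz functions, \<open>c < Re s\<close>, and \<open>\<theta>\<close> is a
  smooth cutoff that is 1 on a half-line \<open>[-M,\<infinity>[\<close> containing the support of \<open>W\<close> in its interior
  and 0 near \<open>-\<infinity>\<close>, it is the value of \<open>U\<close> at the Schwartz function \<open>\<theta>(t) e\<^sup>-\<^sup>(\<^sup>s\<^sup>-\<^sup>c\<^sup>)\<^sup>t\<close>.
  The value does not depend on \<open>c\<close>, \<open>U\<close>, \<open>M\<close>, \<open>M'\<close>, \<open>\<theta>\<close>.
\<close>

definition laplace_transform :: "functional \<Rightarrow> complex \<Rightarrow> complex" where
  "laplace_transform W s =
     (THE v. \<exists>c U M M' \<theta>. c < Re s \<and>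
        tempered_extension (dist_mult (\<lambda>t. of_real (exp (- c * t))) W) U \<and>
        dist_support W \<subseteq> {-M<..} \<and>
        smooth \<theta> \<and> (\<forall>t\<ge>-M. \<theta> t = 1) \<and> (\<forall>t\<le>-M'. \<theta> t = 0) \<and>
        v = U (\<lambda>t. \<theta> t * exp (- (s - of_real c) * of_real t)))"

text \<open>
  The inverse is unique as a distribution, i.e. on \<^const>\<open>test_functions\<close>, but not as a total
  function, hence \<open>SOME\<close>.
\<close>

definition inverse_laplace :: "(complex \<Rightarrow> complex) \<Rightarrow> functional" where
  "inverse_laplace F =
     (SOME W. laplace_transformable W \<and>
        (\<exists>a. \<forall>s. Re s > a \<longrightarrow> laplace_transform W s = F s))"


section \<open>Meromorphic functions of finite order\<close>

definition entire_finite_order :: "(complex \<Rightarrow> complex) \<Rightarrow> bool" where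
  "entire_finite_order g \<longleftrightarrow> g holomorphic_on UNIV \<and>
     (\<exists>k::nat. eventually (\<lambda>z. norm (g z) \<le> exp (norm z ^ k)) at_infinity)"

text \<open>
  A meromorphic function has finite order iff it is a quotient of entire functions of finite order.
\<close>

definition meromorphic_finite_order :: "(complex \<Rightarrow> complex) \<Rightarrow> bool" where
  "meromorphic_finite_order f \<longleftrightarrow> f meromorphic_on UNIV \<and>
     (\<exists>g h. entire_finite_order g \<and> entire_finite_order h \<and> (\<exists>z. h z \<noteq> 0) \<and>
        (\<forall>z. h z \<noteq> 0 \<longrightarrow> f z = g z / h z))"

text \<open>
  For \<open>f\<close> not identically zero, \<^term>\<open>zorder f \<rho>\<close> is the multiplicity \<open>n\<^sub>\<rho>\<close>: positive at zeros,
  negative at poles and 0 elsewhere.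
\<close>

definition convergence_exponent :: "(complex \<Rightarrow> complex) \<Rightarrow> nat" where
  "convergence_exponent f =
     (LEAST d. (\<lambda>\<rho>. \<bar>of_int (zorder f \<rho>)\<bar> / norm \<rho> ^ d :: real) summable_on (- {0}))"

text \<open>
  The infinite product is the unordered limit of its finite partial products. Points that are
  neither zeros nor poles contribute the factor 1. Since \<^term>\<open>(0::complex) powi n = 0\<close> for
  \<open>n \<noteq> 0\<close>, the right-hand side is 0 at the poles of \<open>f\<close>, which is also the value of a
  nicely meromorphic function there.
\<close>

definition hadamard_factorization ::
    "(complex \<Rightarrow> complex) \<Rightarrow> complex \<Rightarrow> complex poly \<Rightarrow> bool" where
  "hadamard_factorization f \<sigma> Q \<longleftrightarrow>
     (\<forall>s. \<exists>p. ((\<lambda>A. \<Prod>\<rho>\<in>A. weierstrass_factor (convergence_exponent f - 1) ((s - \<sigma>) / (\<rho> - \<sigma>))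
                              powi zorder f \<rho>) \<longlongrightarrow> p)
                (finite_subsets_at_top (- {\<sigma>})) \<and>
              f s = (s - \<sigma>) powi zorder f \<sigma> * exp (poly Q s) * p)"

text \<open>
  \<open>Q\<close> is only determined up to an additive constant, which affects neither the genus nor the
  discrepancy polynomial.
\<close>

definition hadamard_poly :: "(complex \<Rightarrow> complex) \<Rightarrow> complex \<Rightarrow> complex poly" where
  "hadamard_poly f \<sigma> = (SOME Q. hadamard_factorization f \<sigma> Q)"

text \<open>The genus does not depend on the base point \<open>\<sigma>\<close>.\<close>

definition genus :: "(complex \<Rightarrow> complex) \<Rightarrow> complex \<Rightarrow> nat" where
  "genus f \<sigma> = max (degree (hadamard_poly f \<sigma>)) (convergence_exponent f - 1)"

definition discrepancy_poly :: "(complex \<Rightarrow> complex) \<Rightarrow> complex \<Rightarrow> complex poly" where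
  "discrepancy_poly f \<sigma> = - pderiv (hadamard_poly f \<sigma>)"


section \<open>The Newton--Cramer distribution\<close>

text \<open>Here 0 belongs to the half-line of nonnegative reals; in particular \<open>K(0)\<close> is the full sum.\<close>

definition newton_cramer_kernel :: "(complex \<Rightarrow> complex) \<Rightarrow> complex \<Rightarrow> real \<Rightarrow> complex" where
  "newton_cramer_kernel f \<sigma> t =
     (let d = convergence_exponent f in
        (of_int (zorder f \<sigma>) * of_real (t ^ d / fact d) +
         (\<Sum>\<^sub>\<infinity>\<rho>\<in>-{\<sigma>}. of_int (zorder f \<rho>) / (\<rho> - \<sigma>) ^ d * exp ((\<rho> - \<sigma>) * of_real t)))
        * indicator {0..} t)"

definition newton_cramer :: "(complex \<Rightarrow> complex) \<Rightarrow> complex \<Rightarrow> functional" where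
  "newton_cramer f \<sigma> =
     dist_mult (\<lambda>t. exp (\<sigma> * of_real t))
       ((dist_deriv ^^ convergence_exponent f)
          (dist_of_fun (\<lambda>t. (newton_cramer_kernel f \<sigma> t - newton_cramer_kernel f \<sigma> 0)
                              * indicator {0..} t)))"

end

theory Submission
  imports Defs
begin

text \<open>
  The Laplace transform turns \<open>D\<^sup>d\<close> into multiplication by \<open>s\<^sup>d\<close>, so that the transform of
  \<open>W\<^sub>\<sigma>(f)\<close> at \<open>s\<close>, with \<open>w = s - \<sigma>\<close> and \<open>m = d - 1\<close>, is
  \<open>n\<^sub>\<sigma> / w + \<Sum>\<^sub>\<rho> n\<^sub>\<rho> (w / (\<rho> - \<sigma>))\<^sup>m / (s - \<rho>)\<close>. By logarithmic differentiation of the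
  Hadamard factorization this is \<open>f' / f - Q' = f' / f + P\<close>, and the polynomial \<open>P\<close> is the transform
  of \<open>\<Sum>\<^sub>j c\<^sub>j \<delta>\<^sup>(\<^sup>j\<^sup>)\<close>. The claim follows since the Laplace transform is injective: on test functions
  a distribution is determined by its values on the functions \<open>e\<^sup>-\<^sup>(\<^sup>L\<^sup>+\<^sup>n\<^sup>)\<^sup>t\<close>, whose linear
  combinations approximate every test function together with its derivatives (polynomial
  approximation in \<open>e\<^sup>-\<^sup>t\<close>).

  For the Hadamard factorization the quotient of \<open>f\<close> by its canonical product is a zero-free entire
  function \<open>e\<^sup>q\<close> and a quotient of two entire functions of finite order. Dividing these by the same
  Blaschke products makes them zero-free on a disc without spoiling their bounds, and the
  Borel--Caratheodory inequality for their logarithms shows that \<open>q\<close> grows polynomially.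
\<close>

section \<open>Smooth functions, test functions and Schwartz functions\<close>

text \<open>Both transforms are given by choice operators: \<open>laplace_transform\<close> by THE
  over all cutoffs and tempered extensions, \<open>inverse_laplace\<close> by SOME. A statement
  about either rests on uniqueness: the pairing with \<open>exp (- s t)\<close> is a limit of values
  of the distribution on test functions, hence independent of the choices, and these pairings
  determine the values on test functions. A preimage of \<open>f' / f\<close> is then exhibited
  instead of being produced by an inversion integral: the difference of the Newton-Cramer
  distribution and the delta terms is treated as one functional.

  Numerator and denominator of a function of finite order may share zeros. The exponent
  \<open>q\<close> is therefore estimated from an equation \<open>A = exp q * B\<close> whose two
  sides vanish together, so that one common division leaves \<open>q\<close> alone. The same
  division counts the zeros of an entire function and so shows that the convergence exponent is
  finite. Multiplicities are signed; zeros and poles get separate canonical products with natural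
  exponents.\<close>

abbreviation vd :: "nat \<Rightarrow> (real \<Rightarrow> complex) \<Rightarrow> real \<Rightarrow> complex" where
  "vd k \<equiv> vderiv ^^ k"

lemma vderiv_eqI: "(\<And>t. (f has_vector_derivative g t) (at t)) \<Longrightarrow> vderiv f = g"
  by (auto simp: vderiv_def fun_eq_iff intro: vector_derivative_at)

lemma vderiv_works: "f differentiable (at t) \<Longrightarrow> (f has_vector_derivative vderiv f t) (at t)"
  by (simp add: vderiv_def vector_derivative_works)

lemma vd_Suc: "vd (Suc k) f = vd k (vderiv f)"
  by (simp add: funpow_swap1)

lemma smoothD: "smooth f \<Longrightarrow> (vd k f has_vector_derivative vd (Suc k) f t) (at t)"
  by (auto simp: smooth_def intro: vderiv_works)

lemma smooth_vderiv: "smooth f \<Longrightarrow> smooth (vderiv f)"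
  unfolding smooth_def by (metis vd_Suc)

lemma smooth_vd: "smooth f \<Longrightarrow> smooth (vd k f)"
  by (induction k) (auto intro: smooth_vderiv)

lemma smooth_differentiable: "smooth f \<Longrightarrow> f differentiable (at t)"
  unfolding smooth_def by (metis funpow_0)

lemma smooth_has_vderiv: "smooth f \<Longrightarrow> (f has_vector_derivative vderiv f t) (at t)"
  using smoothD[of f 0] by simp

lemma smooth_if_vderiv:
  assumes "\<And>t. f differentiable (at t)" "smooth (vderiv f)" shows "smooth f"
  unfolding smooth_def
proof safe
  fix k t show "vd k f differentiable at t"
    using assms by (cases k) (auto simp: smooth_def vd_Suc simp del: funpow.simps(2))
qed

lemma smooth_continuous_on_vd: "smooth f \<Longrightarrow> continuous_on A (vd k f)"
  by (meson continuous_at_imp_continuous_on has_vector_derivative_continuous smoothD)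

lemma smooth_continuous_on: "smooth f \<Longrightarrow> continuous_on A f"
  using smooth_continuous_on_vd[of f A 0] by simp

text \<open>For families with a closed form for every derivative: one differentiation step, uniform
  in the order, yields smoothness and the formula for \<open>vd k\<close> together.\<close>

lemma higher_vderivI:
  assumes "\<And>k t. (D k has_vector_derivative D (Suc k) t) (at t)"
  shows "smooth (D 0)" "vd k (D 0) = D k"
proof -
  show *: "vd k (D 0) = D k" for k
    by (induction k) (use assms in \<open>auto intro!: vderiv_eqI\<close>)
  show "smooth (D 0)"
    unfolding smooth_def * using assms differentiableI_vector by blast
qed

text \<open>For functions whose \<open>k\<close>-th derivative has no convenient closed form: it
  suffices to find a class of differentiable functions that is closed under
  \<open>vderiv\<close>.\<close>

lemma smooth_coinduct:
  assumes "R f" and step: "\<And>f. R f \<Longrightarrow> (\<forall>t. f differentiable (at t)) \<and> R (vderiv f)"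
  shows "smooth f"
proof -
  have "R (vd k f)" for k by (induction k) (use assms in auto)
  then show ?thesis using step by (auto simp: smooth_def)
qed

lemma smooth_add: assumes "smooth f" "smooth g"
  shows "smooth (\<lambda>t. f t + g t)" "vd k (\<lambda>t. f t + g t) = (\<lambda>t. vd k f t + vd k g t)"
proof -
  have *: "((\<lambda>t. vd k f t + vd k g t) has_vector_derivative vd (Suc k) f t + vd (Suc k) g t) (at t)" for k t
    using assms by (intro has_vector_derivative_add smoothD)
  show "smooth (\<lambda>t. f t + g t)" "vd k (\<lambda>t. f t + g t) = (\<lambda>t. vd k f t + vd k g t)"
    using higher_vderivI[of "\<lambda>k t. vd k f t + vd k g t", OF *] by auto
qed

lemma smooth_cmult: assumes "smooth f"
  shows "smooth (\<lambda>t. c * f t)" "vd k (\<lambda>t. c * f t) = (\<lambda>t. c * vd k f t)"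
proof -
  have *: "((\<lambda>t. c * vd k f t) has_vector_derivative c * vd (Suc k) f t) (at t)" for k t
    using assms by (intro has_vector_derivative_mult_right smoothD)
  show "smooth (\<lambda>t. c * f t)" "vd k (\<lambda>t. c * f t) = (\<lambda>t. c * vd k f t)"
    using higher_vderivI[of "\<lambda>k t. c * vd k f t", OF *] by auto
qed

lemma smooth_diff: assumes "smooth f" "smooth g"
  shows "smooth (\<lambda>t. f t - g t)" "vd k (\<lambda>t. f t - g t) = (\<lambda>t. vd k f t - vd k g t)"
  using smooth_add(1)[OF assms(1) smooth_cmult(1)[OF assms(2), of "-1"]]
    smooth_add(2)[OF assms(1) smooth_cmult(1)[OF assms(2), of "-1"], of k]
    smooth_cmult(2)[OF assms(2), of k "-1"]
  by auto

lemma smooth_const: "smooth (\<lambda>t. c)" "vd k (\<lambda>t. c) = (\<lambda>t. if k = 0 then c else 0)"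
  using higher_vderivI[of "\<lambda>k t. if k = 0 then c else 0"] by auto

lemma smooth_sum:
  assumes "\<And>i. i \<in> A \<Longrightarrow> smooth (f i)"
  shows "smooth (\<lambda>t. \<Sum>i\<in>A. f i t)" "vd k (\<lambda>t. \<Sum>i\<in>A. f i t) = (\<lambda>t. \<Sum>i\<in>A. vd k (f i) t)"
proof -
  have "smooth (\<lambda>t. \<Sum>i\<in>A. f i t) \<and> vd k (\<lambda>t. \<Sum>i\<in>A. f i t) = (\<lambda>t. \<Sum>i\<in>A. vd k (f i) t)"
    using assms
    by (induction A rule: infinite_finite_induct) (auto simp: smooth_const smooth_add)
  then show "smooth (\<lambda>t. \<Sum>i\<in>A. f i t)" "vd k (\<lambda>t. \<Sum>i\<in>A. f i t) = (\<lambda>t. \<Sum>i\<in>A. vd k (f i) t)"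
    by auto
qed

lemma smooth_exp: "smooth (\<lambda>t. exp (z * of_real t))"
   "vd k (\<lambda>t. exp (z * of_real t)) = (\<lambda>t. z ^ k * exp (z * of_real t))"
proof -
  have *: "((\<lambda>t. z ^ k * exp (z * of_real t)) has_vector_derivative z ^ Suc k * exp (z * of_real t)) (at t)" for k t
    by (rule has_vector_derivative_real_field) (auto intro!: derivative_eq_intros)
  show "smooth (\<lambda>t. exp (z * of_real t))"
   "vd k (\<lambda>t. exp (z * of_real t)) = (\<lambda>t. z ^ k * exp (z * of_real t))"
    using higher_vderivI[of "\<lambda>k t. z ^ k * exp (z * of_real t)", OF *] by auto
qed

lemma smooth_affine: assumes "smooth f"
  shows "smooth (\<lambda>t. f (a + b * t))" "vd k (\<lambda>t. f (a + b * t)) = (\<lambda>t. b ^ k *\<^sub>R vd k f (a + b * t))"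
proof -
  have *: "((\<lambda>t. b ^ k *\<^sub>R vd k f (a + b * t)) has_vector_derivative b ^ Suc k *\<^sub>R vd (Suc k) f (a + b * t)) (at t)" for k t
  proof -
    have "((vd k f \<circ> (\<lambda>t. a + b * t)) has_vector_derivative b *\<^sub>R vd (Suc k) f (a + b * t)) (at t)"
      by (rule vector_diff_chain_at) (use smoothD[OF assms] in \<open>auto intro!: derivative_eq_intros simp: has_real_derivative_iff_has_vector_derivative[symmetric]\<close>)
    from has_vector_derivative_scaleR[OF DERIV_const this, of "b^k"]
    show ?thesis by (simp add: o_def mult.commute)
  qed
  show "smooth (\<lambda>t. f (a + b * t))" "vd k (\<lambda>t. f (a + b * t)) = (\<lambda>t. b ^ k *\<^sub>R vd k f (a + b * t))"
    using higher_vderivI[of "\<lambda>k t. b ^ k *\<^sub>R vd k f (a + b * t)", OF *] by auto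
qed

section \<open>Products: the Leibniz rule and its norm bound\<close>

lemma vderiv_mult: assumes "smooth f" "smooth g"
  shows "vderiv (\<lambda>t. f t * g t) = (\<lambda>t. vderiv f t * g t + f t * vderiv g t)"
  by (rule vderiv_eqI) (use has_vector_derivative_mult[OF smooth_has_vderiv[OF assms(1)] smooth_has_vderiv[OF assms(2)]] in \<open>simp add: add.commute\<close>)

text \<open>The Leibniz rule is kept in recursive form, one derivative being spent on splitting
  \<open>f * g\<close> into \<open>f' * g\<close> and \<open>f * g'\<close>. Differentiability of
  the lower derivatives is carried along because \<open>vderiv\<close> of the resulting sum can only
  be split if both summands are differentiable, and smoothness of products is what is being
  proved.\<close>

lemma vd_mult_aux:
  assumes "smooth f" "smooth g"
  shows "(\<forall>i\<le>k. \<forall>t. vd i (\<lambda>t. f t * g t) differentiable (at t)) \<and>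
     vd (Suc k) (\<lambda>t. f t * g t) = (\<lambda>t. vd k (\<lambda>t. vderiv f t * g t) t + vd k (\<lambda>t. f t * vderiv g t) t)"
  using assms
proof (induction k arbitrary: f g)
  case 0
  then have "(\<lambda>t. f t * g t) differentiable (at t)" for t
    by (intro differentiable_mult smooth_differentiable)
  with 0 show ?case by (simp add: vderiv_mult)
next
  case (Suc k)
  have d: "vd i (\<lambda>t. f t * g t) differentiable (at t)" if "i \<le> Suc k" for i t
  proof (cases "i \<le> k")
    case False
    with that have i: "i = Suc k" by simp
    show ?thesis unfolding i using Suc.IH[OF Suc.prems] Suc.IH[OF smooth_vderiv[OF Suc.prems(1)] Suc.prems(2)]
       Suc.IH[OF Suc.prems(1) smooth_vderiv[OF Suc.prems(2)]] by (auto simp del: funpow.simps)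
  qed (use Suc.IH[OF Suc.prems] in auto)
  have "vd (Suc (Suc k)) (\<lambda>t. f t * g t) = vderiv (vd (Suc k) (\<lambda>t. f t * g t))" by simp
  also have "\<dots> = vderiv (\<lambda>t. vd k (\<lambda>t. vderiv f t * g t) t + vd k (\<lambda>t. f t * vderiv g t) t)"
    using Suc.IH[OF Suc.prems] by (simp del: funpow.simps)
  also have "\<dots> = (\<lambda>t. vd (Suc k) (\<lambda>t. vderiv f t * g t) t + vd (Suc k) (\<lambda>t. f t * vderiv g t) t)"
  proof (rule vderiv_eqI)
    fix t
    have "vd k (\<lambda>t. vderiv f t * g t) differentiable (at t)" "vd k (\<lambda>t. f t * vderiv g t) differentiable (at t)"
      using Suc.IH[OF smooth_vderiv[OF Suc.prems(1)] Suc.prems(2)]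
         Suc.IH[OF Suc.prems(1) smooth_vderiv[OF Suc.prems(2)]] by blast+
    then show "((\<lambda>t. vd k (\<lambda>t. vderiv f t * g t) t + vd k (\<lambda>t. f t * vderiv g t) t) has_vector_derivative
        vd (Suc k) (\<lambda>t. vderiv f t * g t) t + vd (Suc k) (\<lambda>t. f t * vderiv g t) t) (at t)"
      using has_vector_derivative_add[OF vderiv_works vderiv_works] by simp
  qed
  finally show ?case using d by simp
qed

lemma smooth_mult: "smooth f \<Longrightarrow> smooth g \<Longrightarrow> smooth (\<lambda>t. f t * g t)"
  using vd_mult_aux unfolding smooth_def by (metis order_refl)

text \<open>Each order of differentiation doubles the number of products in the recursive Leibniz
  rule, whence \<open>2 ^ k\<close>.\<close>

lemma norm_vd_mult_le:
  assumes "smooth f" "smooth g" "\<And>i. i \<le> k \<Longrightarrow> norm (vd i f t) \<le> A" "\<And>i. i \<le> k \<Longrightarrow> norm (vd i g t) \<le> B"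
  shows "norm (vd k (\<lambda>t. f t * g t) t) \<le> 2 ^ k * (A * B)"
  using assms
proof (induction k arbitrary: f g)
  case 0
  have "norm (f t) \<le> A" "norm (g t) \<le> B" using 0(3,4)[of 0] by auto
  then have "norm (f t) * norm (g t) \<le> A * B"
    using order_trans[OF norm_ge_zero] by (intro mult_mono) blast+
  then show ?case by (simp add: norm_mult)
next
  case (Suc k)
  have "norm (vd (Suc k) (\<lambda>t. f t * g t) t) \<le> norm (vd k (\<lambda>t. vderiv f t * g t) t) + norm (vd k (\<lambda>t. f t * vderiv g t) t)"
    using vd_mult_aux[OF Suc.prems(1,2), of k] by (simp add: norm_triangle_ineq del: funpow.simps)
  also have "\<dots> \<le> 2 ^ k * (A * B) + 2 ^ k * (A * B)"
    using Suc.prems(3)[of "Suc _"] Suc.prems(4)[of "Suc _"]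
    by (intro add_mono Suc.IH smooth_vderiv Suc.prems) (auto simp: vd_Suc simp del: funpow.simps)
  finally show ?case by (simp add: mult_ac del: funpow.simps)
qed

text \<open>Locality of \<open>vderiv\<close>, default values included. It lets a cut-off function
  be replaced by the original one wherever the cutoff is constant.\<close>

lemma vd_cong_open:
  assumes "open S" "\<And>t. t \<in> S \<Longrightarrow> f t = g t" "t \<in> S"
  shows "vd k f t = vd k g t"
  using assms(3)
proof (induction k arbitrary: t)
  case (Suc k)
  have "eventually (\<lambda>x. x \<in> S) (nhds t)"
    using assms(1) Suc.prems by (rule eventually_nhds_in_open)
  then have "eventually (\<lambda>x. x \<in> UNIV \<longrightarrow> vd k f x = vd k g x) (nhds t)"
    by (rule eventually_mono) (use Suc.IH in blast)
  from vector_derivative_cong_eq[OF this refl refl UNIV_I]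
  show ?case by (simp add: vderiv_def[of _ t])
next
  case 0
  then show ?case using assms(2)[of t] by simp
qed

section \<open>Supports, test functions and Schwartz functions\<close>

lemma fun_supportI: "f t \<noteq> 0 \<Longrightarrow> t \<in> fun_support f"
  using closure_subset[of "{t. f t \<noteq> 0}"] by (auto simp: fun_support_def)

lemma vd_zero_outside_support:
  assumes "t \<notin> fun_support f" shows "vd k f t = 0"
proof -
  have "vd k f t = vd k (\<lambda>_. 0) t"
  proof (rule vd_cong_open)
    show "open (- fun_support f)" by (simp add: fun_support_def open_Compl)
  qed (use assms fun_supportI in auto)
  then show ?thesis by (simp add: smooth_const)
qed

lemma fun_support_minimal: "closed S \<Longrightarrow> (\<And>t. f t \<noteq> 0 \<Longrightarrow> t \<in> S) \<Longrightarrow> fun_support f \<subseteq> S"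
  unfolding fun_support_def by (intro closure_minimal) auto

lemma fun_support_mult: "fun_support (\<lambda>t. a t * f t) \<subseteq> fun_support f"
  unfolding fun_support_def by (intro closure_mono) auto

lemma fun_support_vd: "fun_support (vd k f) \<subseteq> fun_support f"
  by (rule fun_support_minimal) (use vd_zero_outside_support in \<open>auto simp: fun_support_def\<close>)

lemma test_functions_smooth: "f \<in> test_functions \<Longrightarrow> smooth f"
  by (simp add: test_functions_def)

lemma test_functionsI:
  assumes "smooth f" "\<And>t. f t \<noteq> 0 \<Longrightarrow> a \<le> t \<and> t \<le> b" shows "f \<in> test_functions"
proof -
  have "fun_support f \<subseteq> {a..b}" using assms by (intro fun_support_minimal) auto
  then show ?thesis using assms compact_Int_closed[OF compact_Icc, of "fun_support f" a b]
    by (auto simp: test_functions_def fun_support_def Int_absorb1)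
qed

lemma test_functionsE:
  assumes "f \<in> test_functions" obtains b where "b > 0" "fun_support f \<subseteq> {-b..b}"
proof -
  have "bounded (fun_support f)" using assms by (auto simp: test_functions_def compact_imp_bounded)
  then obtain b where "b > 0" "\<And>t. t \<in> fun_support f \<Longrightarrow> norm t \<le> b" unfolding bounded_pos by blast
  then show ?thesis by (intro that[of b]) (auto simp: abs_le_iff minus_le_iff)
qed

lemma test_functions_mult:
  assumes "smooth a" "f \<in> test_functions" shows "(\<lambda>t. a t * f t) \<in> test_functions"
proof -
  obtain b where "fun_support f \<subseteq> {-b..b}" using test_functionsE[OF assms(2)] .
  then show ?thesis using fun_support_mult[of a f] assms
    by (intro test_functionsI[of _ "-b" b] smooth_mult) (auto simp: test_functions_smooth dest!: fun_supportI)
qed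

lemma test_functions_add:
  assumes "f \<in> test_functions" "g \<in> test_functions" shows "(\<lambda>t. f t + g t) \<in> test_functions"
proof -
  obtain b where b: "fun_support f \<subseteq> {-b..b}" using test_functionsE[OF assms(1)] .
  obtain c where c: "fun_support g \<subseteq> {-c..c}" using test_functionsE[OF assms(2)] .
  have nz: "- max b c \<le> t \<and> t \<le> max b c" if "f t + g t \<noteq> 0" for t
  proof -
    have "f t \<noteq> 0 \<or> g t \<noteq> 0" using that by auto
    then have "t \<in> {-b..b} \<or> t \<in> {-c..c}" using b c fun_supportI by blast
    then show ?thesis by auto
  qed
  have "smooth (\<lambda>t. f t + g t)" using assms by (intro smooth_add test_functions_smooth)
  then show ?thesis using nz by (rule test_functionsI)
qed

lemma test_functions_vd: "f \<in> test_functions \<Longrightarrow> vd k f \<in> test_functions"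
  using fun_support_vd[of k f] compact_Int_closed[of "fun_support f" "fun_support (vd k f)"]
  by (auto simp: test_functions_def smooth_vd fun_support_def Int_absorb1)

lemma test_functions_bounded:
  assumes "f \<in> test_functions" obtains B where "B \<ge> 0" "\<And>t. norm (vd k f t) \<le> B"
proof -
  have "compact (vd k f ` fun_support f)"
    using assms by (intro compact_continuous_image smooth_continuous_on_vd) (auto simp: test_functions_def)
  then obtain B where B: "B > 0" "\<And>y. y \<in> vd k f ` fun_support f \<Longrightarrow> norm y \<le> B"
    using compact_imp_bounded bounded_pos by metis
  have "norm (vd k f t) \<le> B" for t
    using B vd_zero_outside_support[of t f k] by (cases "t \<in> fun_support f") auto
  then show ?thesis using B(1) that[of B] by auto
qed

lemma test_functions_subset_schwartz: "test_functions \<subseteq> schwartz_functions"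
proof
  fix f assume f: "f \<in> test_functions"
  obtain b where b: "b > 0" "fun_support f \<subseteq> {-b..b}" using test_functionsE[OF f] .
  have "bounded (range (\<lambda>t. of_real (t ^ j) * vd k f t))" for j k
  proof -
    obtain B where B: "B \<ge> 0" "\<And>t. norm (vd k f t) \<le> B" using test_functions_bounded[OF f] by blast
    have "norm (of_real (t ^ j) * vd k f t) \<le> b ^ j * B" for t
    proof (cases "t \<in> fun_support f")
      case True
      then have "\<bar>t\<bar> \<le> b" using b by (force simp: abs_le_iff)
      then show ?thesis using B by (auto simp: norm_mult norm_power power_abs intro!: mult_mono power_mono)
    next
      case False
      then show ?thesis using B b by (simp add: vd_zero_outside_support)
    qed
    then show ?thesis unfolding bounded_iff by blast
  qed
  then show "f \<in> schwartz_functions" using f by (auto simp: schwartz_functions_def test_functions_smooth)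
qed

lemma schwartz_functions_smooth: "f \<in> schwartz_functions \<Longrightarrow> smooth f"
  by (simp add: schwartz_functions_def)

lemma schwartz_seminorm_le:
  "(\<And>t. \<bar>t\<bar> ^ j * norm (vd k f t) \<le> B) \<Longrightarrow> schwartz_seminorm j k f \<le> B"
  unfolding schwartz_seminorm_def by (intro cSUP_least) auto

lemma schwartz_seminorm_ge:
  assumes "f \<in> schwartz_functions" shows "\<bar>t\<bar> ^ j * norm (vd k f t) \<le> schwartz_seminorm j k f"
proof -
  have "bounded (range (\<lambda>t. of_real (t ^ j) * vd k f t))" using assms by (auto simp: schwartz_functions_def)
  then obtain B where "\<And>t. norm (of_real (t ^ j) * vd k f t) \<le> B" by (auto simp: bounded_iff)
  then have "bdd_above (range (\<lambda>t. \<bar>t\<bar> ^ j * norm (vd k f t)))"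
    by (intro bdd_aboveI[of _ B]) (auto simp: norm_mult norm_power power_abs)
  then show ?thesis unfolding schwartz_seminorm_def by (intro cSUP_upper) auto
qed

lemma schwartz_functionsI:
  assumes "smooth f" "\<And>j k. \<exists>B. \<forall>t. \<bar>t\<bar> ^ j * norm (vd k f t) \<le> B"
  shows "f \<in> schwartz_functions"
  unfolding schwartz_functions_def bounded_iff
proof (safe)
  fix j k
  obtain B where "\<forall>t. \<bar>t\<bar> ^ j * norm (vd k f t) \<le> B" using assms(2) by blast
  then show "\<exists>a. \<forall>x\<in>range (\<lambda>t. complex_of_real (t ^ j) * vd k f t). norm x \<le> a"
    by (intro exI[of _ B]) (auto simp: norm_mult norm_power power_abs)
qed fact

lemma schwartz_functions_add:
  assumes "f \<in> schwartz_functions" "g \<in> schwartz_functions"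
  shows "(\<lambda>t. f t + g t) \<in> schwartz_functions"
proof (rule schwartz_functionsI)
  have s: "smooth f" "smooth g" using assms by (auto simp: schwartz_functions_smooth)
  then show "smooth (\<lambda>t. f t + g t)" by (rule smooth_add)
  fix j k
  have "\<bar>t\<bar> ^ j * norm (vd k (\<lambda>t. f t + g t) t) \<le> schwartz_seminorm j k f + schwartz_seminorm j k g" for t
  proof -
    have "\<bar>t\<bar> ^ j * norm (vd k (\<lambda>t. f t + g t) t) \<le> \<bar>t\<bar> ^ j * (norm (vd k f t) + norm (vd k g t))"
      by (simp add: smooth_add[OF s] mult_left_mono norm_triangle_ineq)
    also have "\<dots> \<le> schwartz_seminorm j k f + schwartz_seminorm j k g"
      using schwartz_seminorm_ge[OF assms(1), of t j k] schwartz_seminorm_ge[OF assms(2), of t j k] by (simp add: algebra_simps)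
    finally show ?thesis .
  qed
  then show "\<exists>B. \<forall>t. \<bar>t\<bar> ^ j * norm (vd k (\<lambda>t. f t + g t) t) \<le> B" by blast
qed

lemma schwartz_functions_cmult:
  assumes "f \<in> schwartz_functions"
  shows "(\<lambda>t. c * f t) \<in> schwartz_functions"
proof (rule schwartz_functionsI)
  have s: "smooth f" using assms by (auto simp: schwartz_functions_smooth)
  then show "smooth (\<lambda>t. c * f t)" by (rule smooth_cmult)
  fix j k
  have "\<bar>t\<bar> ^ j * norm (vd k (\<lambda>t. c * f t) t) \<le> norm c * schwartz_seminorm j k f" for t
    using mult_left_mono[OF schwartz_seminorm_ge[OF assms, of t j k] norm_ge_zero[of c]]
    by (simp add: smooth_cmult[OF s] norm_mult mult_ac)
  then show "\<exists>B. \<forall>t. \<bar>t\<bar> ^ j * norm (vd k (\<lambda>t. c * f t) t) \<le> B" by blast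
qed

section \<open>Flat functions and a smooth step\<close>

definition flat_poly :: "real poly \<Rightarrow> real \<Rightarrow> real" where
  "flat_poly p t = (if t \<le> 0 then 0 else poly p (inverse t) * exp (- inverse t))"

lemma tendsto_poly_exp_minus: "((\<lambda>x::real. poly p x * exp (- x)) \<longlongrightarrow> 0) at_top"
proof -
  have *: "((\<lambda>x::real. x ^ k * exp (- x)) \<longlongrightarrow> 0) at_top" for k :: nat
    using tendsto_power_div_exp_0[of k] by (simp add: exp_minus divide_inverse)
  have "((\<lambda>x. \<Sum>i\<le>degree p. coeff p i * (x ^ i * exp (- x))) \<longlongrightarrow> (\<Sum>i\<le>degree p. coeff p i * 0)) at_top"
    by (intro tendsto_sum tendsto_mult tendsto_const *)
  then show ?thesis by (simp add: poly_altdef sum_distrib_right mult.assoc)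
qed

lemma flat_poly_tendsto_0: "((\<lambda>t. flat_poly p t / t) \<longlongrightarrow> 0) (at 0)"
proof -
  \<comment> \<open>Dividing by \<open>t\<close> multiplies the polynomial in
    \<open>inverse t\<close> by its variable, which is \<open>pCons 0 p\<close>; the difference
    quotient at 0 is thus again of the flat form.\<close>
  have "((\<lambda>t. poly (pCons 0 p) (inverse t) * exp (- inverse t)) \<longlongrightarrow> 0) (at_right 0)"
    using filterlim_compose[OF tendsto_poly_exp_minus filterlim_inverse_at_top_right] .
  then have "((\<lambda>t. flat_poly p t / t) \<longlongrightarrow> 0) (at_right 0)"
    by (rule Lim_transform_eventually) (auto simp: flat_poly_def eventually_at_filter field_simps)
  moreover have "((\<lambda>t. flat_poly p t / t) \<longlongrightarrow> 0) (at_left 0)"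
    by (rule Lim_transform_eventually[OF tendsto_const]) (auto simp: flat_poly_def eventually_at_filter)
  ultimately show ?thesis by (simp add: filterlim_split_at)
qed

text \<open>With \<open>x = 1 / t\<close> one has \<open>d/dt = - x^2 d/dx\<close>, which sends
  \<open>p(x) e^(-x)\<close> to \<open>x^2 (p - p')(x) e^(-x)\<close>. Allowing every polynomial
  \<open>p\<close> closes the family under differentiation; \<open>p = 1\<close> is the classical
  flat function.\<close>

lemma flat_poly_deriv:
  "(flat_poly p has_real_derivative flat_poly (monom 1 2 * (p - pderiv p)) t) (at t)"
proof -
  consider "t < 0" | "t = 0" | "t > 0" by linarith
  then show ?thesis
  proof cases
    case 1
    have "((\<lambda>_. 0) has_real_derivative 0) (at t)" by simp
    then have "(flat_poly p has_real_derivative 0) (at t)"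
      by (rule has_field_derivative_transform_within_open[of _ _ _ "{..<0}"]) (use 1 in \<open>auto simp: flat_poly_def\<close>)
    then show ?thesis using 1 by (simp add: flat_poly_def)
  next
    case 2
    then show ?thesis using flat_poly_tendsto_0[of p] by (simp add: has_field_derivative_iff flat_poly_def)
  next
    case 3
    have "((\<lambda>t. poly p (inverse t) * exp (- inverse t)) has_real_derivative
        flat_poly (monom 1 2 * (p - pderiv p)) t) (at t)"
      using 3 by (auto intro!: derivative_eq_intros DERIV_chain2[OF poly_DERIV] simp: flat_poly_def poly_monom power2_eq_square field_simps)
    then show ?thesis
      by (rule has_field_derivative_transform_within_open[of _ _ _ "{0<..}"]) (use 3 in \<open>auto simp: flat_poly_def\<close>)
  qed
qed

lemma smooth_flat: "smooth (\<lambda>t. of_real (flat_poly p t))"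
proof (rule smooth_coinduct[where R = "\<lambda>f. \<exists>p. f = (\<lambda>t. of_real (flat_poly p t))"])
  fix f assume "\<exists>p. f = (\<lambda>t. complex_of_real (flat_poly p t))"
  then obtain p where f: "f = (\<lambda>t. of_real (flat_poly p t))" by blast
  have d: "(f has_vector_derivative of_real (flat_poly (monom 1 2 * (p - pderiv p)) t)) (at t)" for t
    unfolding f by (rule has_vector_derivative_of_real) (use flat_poly_deriv in \<open>simp add: has_real_derivative_iff_has_vector_derivative\<close>)
  then show "(\<forall>t. f differentiable at t) \<and> (\<exists>p. vderiv f = (\<lambda>t. of_real (flat_poly p t)))"
    using vderiv_eqI[OF d] differentiableI_vector[OF d] by blast
qed auto

lemma smooth_step_exists:
  obtains H where "smooth H" "\<And>t. t \<le> 0 \<Longrightarrow> H t = 0" "\<And>t. t \<ge> 1 \<Longrightarrow> H t = 1"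
proof -
  \<comment> \<open>A bump that is positive exactly on the open unit interval; its normalized
    integral will be the step.\<close>
  define b where "b t = flat_poly 1 t * flat_poly 1 (1 + (-1) * t)" for t
  have b_pos: "b t > 0" if "0 < t" "t < 1" for t using that by (simp add: b_def flat_poly_def)
  have b_0: "b t = 0" if "t \<le> 0 \<or> t \<ge> 1" for t using that by (auto simp: b_def flat_poly_def)
  have smb: "smooth (\<lambda>t. of_real (b t))"
    unfolding b_def of_real_mult by (intro smooth_mult smooth_flat smooth_affine(1)[of "\<lambda>t. of_real (flat_poly 1 t)"])
  have contb: "continuous_on A b" for A
    using smooth_continuous_on[OF smb, of A] continuous_on_Re by fastforce
  \<comment> \<open>Starting the integral at -1 puts 0 inside the interval of integration, so that
    the fundamental theorem of calculus gives a two-sided derivative at 0.\<close>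
  define F where "F t = integral {-1..t} b" for t
  have F0: "F t = 0" if "t \<le> 0" for t
    unfolding F_def using that b_0 integral_cong[of "{-1..t}" b "\<lambda>_. 0"] by simp
  have dF: "(F has_real_derivative b t) (at t)" for t
  proof (cases "t < 0")
    case True
    have "((\<lambda>_. 0) has_real_derivative 0) (at t)" by simp
    then have "(F has_real_derivative 0) (at t)"
      by (rule has_field_derivative_transform_within_open[of _ _ _ "{..<0}"]) (use True in \<open>auto simp: F0\<close>)
    then show ?thesis using True by (simp add: b_0)
  next
    case False
    have "(F has_vector_derivative b t) (at t within {-1..t+1})"
      unfolding F_def using False by (intro integral_has_vector_derivative contb) auto
    moreover have "at t within {-1..t+1} = at t"
      using False by (intro at_within_Icc_at) auto
    ultimately show ?thesis by (simp add: has_real_derivative_iff_has_vector_derivative)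
  qed
  have F1: "F t = F 1" if "t \<ge> 1" for t
  proof (cases "t = 1")
    case False
    with that have "1 < t" by simp
    from MVT2[OF this, of F b, OF dF] obtain z where "1 < z" "z < t" "F t - F 1 = (t - 1) * b z" by blast
    then show ?thesis by (simp add: b_0)
  qed simp
  have F1_pos: "F 1 > 0"
  proof -
    from MVT2[OF zero_less_one, of F b, OF dF] obtain z where "0 < z" "z < 1" "F 1 - F 0 = (1 - 0) * b z"
      by blast
    then show ?thesis using b_pos F0 by simp
  qed
  define H where "H t = complex_of_real (F t / F 1)" for t
  have dH: "(H has_vector_derivative of_real (b t / F 1)) (at t)" for t
    unfolding H_def by (rule has_vector_derivative_of_real)
      (use DERIV_cdivide[OF dF] in \<open>simp add: has_real_derivative_iff_has_vector_derivative[symmetric]\<close>)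
  have "smooth H"
  proof (rule smooth_if_vderiv)
    show "H differentiable (at t)" for t using differentiableI_vector[OF dH] .
    show "smooth (vderiv H)" using smooth_cmult(1)[OF smb, of "of_real (1 / F 1)"]
      by (simp add: vderiv_eqI[OF dH])
  qed
  moreover have "H t = 1" if "t \<ge> 1" for t
    using F1[OF that] F1_pos by (simp add: H_def)
  moreover have "H t = 0" if "t \<le> 0" for t
    using F0[OF that] by (simp add: H_def)
  ultimately show ?thesis by (intro that[of H])
qed

definition smooth_step :: "real \<Rightarrow> complex" where
  "smooth_step = (SOME H. smooth H \<and> (\<forall>t\<le>0. H t = 0) \<and> (\<forall>t\<ge>1. H t = 1))"

lemma smooth_step: "smooth smooth_step"
  and smooth_step_0: "t \<le> 0 \<Longrightarrow> smooth_step t = 0"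
  and smooth_step_1: "t \<ge> 1 \<Longrightarrow> smooth_step t = 1"
proof -
  have "\<exists>H. smooth H \<and> (\<forall>t\<le>0. H t = 0) \<and> (\<forall>t\<ge>1. H t = 1)"
    using smooth_step_exists by metis
  from someI_ex[OF this] show "smooth smooth_step" "t \<le> 0 \<Longrightarrow> smooth_step t = 0"  "t \<ge> 1 \<Longrightarrow> smooth_step t = 1"
    unfolding smooth_step_def by blast+
qed

lemma bounded_vd_eventually_const:
  assumes "smooth a" "\<And>t. t < l \<Longrightarrow> a t = c" "\<And>t. t > u \<Longrightarrow> a t = d"
  obtains B where "\<And>t. norm (vd k a t) \<le> B"
proof -
  have "compact (vd k a ` {l..u})" using assms(1) by (intro compact_continuous_image smooth_continuous_on_vd) auto
  then obtain B where B: "\<And>y. y \<in> vd k a ` {l..u} \<Longrightarrow> norm y \<le> B"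
    using compact_imp_bounded bounded_iff by metis
  have "norm (vd k a t) \<le> norm B + (norm c + norm d)" for t
  proof -
    consider "t < l" | "t > u" | "t \<in> {l..u}" by fastforce
    then show ?thesis
    proof cases
      case 1
      then have "vd k a t = vd k (\<lambda>_. c) t" by (intro vd_cong_open[of "{..<l}"]) (use assms in auto)
      then show ?thesis by (simp add: smooth_const)
    next
      case 2
      then have "vd k a t = vd k (\<lambda>_. d) t" by (intro vd_cong_open[of "{u<..}"]) (use assms in auto)
      then show ?thesis by (simp add: smooth_const)
    next
      case 3
      then have "norm (vd k a t) \<le> B" using B by blast
      also have "B \<le> norm B + (norm c + norm d)" using norm_ge_zero[of c] norm_ge_zero[of d] abs_ge_self[of B] unfolding real_norm_def by linarith
      finally show ?thesis .
    qed
  qed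
  then show ?thesis using that by blast
qed

lemma bounded_vd_smooth_step: obtains B where "\<And>t. norm (vd k smooth_step t) \<le> B"
  using bounded_vd_eventually_const[of smooth_step 0 0 1 1] smooth_step smooth_step_0 smooth_step_1
  by (metis less_le)

section \<open>Tempered bounds and supports\<close>

lemma linear_functional_cmult:
  "linear_functional_on V T \<Longrightarrow> f \<in> V \<Longrightarrow> T (\<lambda>t. c * f t) = c * T f"
  and linear_functional_add:
  "linear_functional_on V T \<Longrightarrow> f \<in> V \<Longrightarrow> g \<in> V \<Longrightarrow> T (\<lambda>t. f t + g t) = T f + T g"
  unfolding linear_functional_on_def by auto

lemma linear_functional_diff:
  assumes "linear_functional_on V T" "f \<in> V" "g \<in> V" "(\<lambda>t. -1 * g t) \<in> V"
  shows "T (\<lambda>t. f t - g t) = T f - T g"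
proof -
  have "T (\<lambda>t. f t + -1 * g t) = T f + T (\<lambda>t. -1 * g t)" "T (\<lambda>t. -1 * g t) = -1 * T g"
    by (rule linear_functional_add[OF assms(1,2,4)], rule linear_functional_cmult[OF assms(1,3)])
  then show ?thesis by simp
qed

lemma linear_functional_sum:
  assumes T: "linear_functional_on V T" and V: "\<And>f g. f \<in> V \<Longrightarrow> g \<in> V \<Longrightarrow> (\<lambda>t. f t + g t) \<in> V"
    "\<And>f c. f \<in> V \<Longrightarrow> (\<lambda>t. c * f t) \<in> V" "f0 \<in> V"
    and f: "\<And>i. i \<in> A \<Longrightarrow> f i \<in> V" and "finite A"
  shows "(\<lambda>t. \<Sum>i\<in>A. c i * f i t) \<in> V \<and> T (\<lambda>t. \<Sum>i\<in>A. c i * f i t) = (\<Sum>i\<in>A. c i * T (f i))"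
  using \<open>finite A\<close> f
proof (induction A)
  case empty
  have "T (\<lambda>t. 0 * f0 t) = 0 * T f0" by (rule linear_functional_cmult[OF T V(3)])
  then show ?case using V(2)[of f0 0] V(3) by simp
next
  case (insert i A)
  then have IH: "(\<lambda>t. \<Sum>i\<in>A. c i * f i t) \<in> V" "T (\<lambda>t. \<Sum>i\<in>A. c i * f i t) = (\<Sum>i\<in>A. c i * T (f i))"
    by auto
  have fi: "f i \<in> V" "(\<lambda>t. c i * f i t) \<in> V" using insert V by auto
  have "T (\<lambda>t. c i * f i t + (\<Sum>i\<in>A. c i * f i t)) = T (\<lambda>t. c i * f i t) + T (\<lambda>t. \<Sum>i\<in>A. c i * f i t)"
     "T (\<lambda>t. c i * f i t) = c i * T (f i)"
    using T IH(1) fi by (auto intro: linear_functional_cmult linear_functional_add)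
  with insert IH V(1)[OF fi(2) IH(1)] show ?case by simp
qed

lemma test_functions_cmult: "f \<in> test_functions \<Longrightarrow> (\<lambda>t. c * f t) \<in> test_functions"
  by (rule test_functions_mult[OF smooth_const(1)])

lemma test_functions_diff:
  assumes "f \<in> test_functions" "g \<in> test_functions" shows "(\<lambda>t. f t - g t) \<in> test_functions"
  using test_functions_add[OF assms(1) test_functions_cmult[OF assms(2), of "-1"]] by simp

text \<open>A finite partition of unity by hand: step functions peel off pieces of the support that are shorter
  than a Lebesgue number of the cover by null sets.\<close>

lemma distribution_eq_0_off_support:
  assumes W: "distribution W" and \<phi>: "\<phi> \<in> test_functions" and disj: "fun_support \<phi> \<inter> dist_support W = {}"
  shows "W \<phi> = 0"
proof -
  define K where "K = fun_support \<phi>"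
  \<comment> \<open>The empty set keeps the cover nonempty for the Lebesgue number lemma; only the
    zero function is supported there.\<close>
  define \<C> where "\<C> = insert {} {U. open U \<and> (\<forall>\<phi>\<in>test_functions. fun_support \<phi> \<subseteq> U \<longrightarrow> W \<phi> = 0)}"
  have K: "compact K" using \<phi> by (simp add: K_def test_functions_def)
  have lin: "linear_functional_on test_functions W" using W by (simp add: distribution_def)
  have "K \<subseteq> \<Union>\<C>" using disj by (auto simp: dist_support_def K_def \<C>_def)
  moreover have "\<C> \<noteq> {}" and "\<And>B. B \<in> \<C> \<Longrightarrow> open B" by (auto simp: \<C>_def)
  ultimately obtain \<delta> where \<delta>: "\<delta> > 0" "\<And>T. T \<subseteq> K \<Longrightarrow> diameter T < \<delta> \<Longrightarrow> \<exists>B\<in>\<C>. T \<subseteq> B"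
    using Lebesgue_number_lemma[OF K] by metis
  have W0: "W (\<lambda>t. 0) = 0"
  proof -
    have "W (\<lambda>t. 0 * \<phi> t) = 0 * W \<phi>" by (rule linear_functional_cmult[OF lin \<phi>])
    then show ?thesis by simp
  qed
  have small: "W \<psi> = 0" if \<psi>: "\<psi> \<in> test_functions" "fun_support \<psi> \<subseteq> K" "diameter (fun_support \<psi>) < \<delta>" for \<psi>
  proof -
    obtain B where "B \<in> \<C>" "fun_support \<psi> \<subseteq> B" using \<delta>(2)[OF \<psi>(2,3)] by blast
    moreover have "W \<psi> = 0" if "fun_support \<psi> \<subseteq> {}"
    proof -
      have "\<psi> = (\<lambda>t. 0)" using fun_supportI[of \<psi>] that by blast
      then show ?thesis using W0 by simp
    qed
    ultimately show ?thesis using \<psi>(1) by (auto simp: \<C>_def)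
  qed
  have small': "W \<psi> = 0" if \<psi>: "\<psi> \<in> test_functions" "fun_support \<psi> \<subseteq> K" "fun_support \<psi> \<subseteq> {x..x+2*(\<delta>/3)}" for \<psi> x
  proof (rule small[OF \<psi>(1,2)])
    have "diameter (fun_support \<psi>) \<le> diameter {x..x+2*(\<delta>/3)}" by (rule diameter_subset[OF \<psi>(3)]) simp
    also have "\<dots> < \<delta>" using \<delta>(1) by (simp add: diameter_closed_interval)
    finally show "diameter (fun_support \<psi>) < \<delta>" .
  qed
  obtain b where b: "b > 0" "K \<subseteq> {-b..b}" using test_functionsE[OF \<phi>] K_def by blast
  \<comment> \<open>Each piece cut off below has length at most \<open>2 * e\<close>: one
    \<open>e\<close> of new support and one \<open>e\<close> in which the step rises. With a third
    of \<open>\<delta>\<close> this stays below the Lebesgue number.\<close>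
  define e where "e = \<delta> / 3"
  have e: "e > 0" using \<delta> by (simp add: e_def)
  have main: "W \<psi> = 0" if "\<psi> \<in> test_functions" "fun_support \<psi> \<subseteq> K" "fun_support \<psi> \<subseteq> {-b..-b+real n*e}" for n \<psi>
    using that
  proof (induction n arbitrary: \<psi>)
    case 0
    then show ?case using e by (intro small'[of \<psi> "-b"]) (auto simp: e_def)
  next
    case (Suc n)
    define x where "x = -b + real n * e"
    \<comment> \<open>The affine argument makes \<open>\<eta>\<close> rise from 0 at
      \<open>x - e\<close> to 1 at \<open>x\<close>: the part with \<open>1 - \<eta>\<close> ends at
      \<open>x\<close> and falls under the induction hypothesis, the part with \<open>\<eta>\<close>
      is short.\<close>
    define \<eta> where "\<eta> t = smooth_step ((1 - x / e) + (1 / e) * t)" for t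
    have sm: "smooth \<eta>" unfolding \<eta>_def by (rule smooth_affine[OF smooth_step])
    have \<eta>0: "\<eta> t = 0" if "t \<le> x - e" for t
      unfolding \<eta>_def by (rule smooth_step_0) (use that e in \<open>simp add: field_simps\<close>)
    have \<eta>1: "\<eta> t = 1" if "t \<ge> x" for t
      unfolding \<eta>_def by (rule smooth_step_1) (use that e in \<open>simp add: field_simps\<close>)
    have sm1: "smooth (\<lambda>t. 1 - \<eta> t)" by (intro smooth_diff smooth_const sm)
    have t: "(\<lambda>t. (1 - \<eta> t) * \<psi> t) \<in> test_functions" "(\<lambda>t. \<eta> t * \<psi> t) \<in> test_functions"
      using Suc.prems by (auto intro!: test_functions_mult sm sm1)
    have "W (\<lambda>t. (1 - \<eta> t) * \<psi> t) = 0"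
    proof (rule Suc.IH[OF t(1)])
      show "fun_support (\<lambda>t. (1 - \<eta> t) * \<psi> t) \<subseteq> K" by (rule order_trans[OF fun_support_mult Suc.prems(2)])
      show "fun_support (\<lambda>t. (1 - \<eta> t) * \<psi> t) \<subseteq> {-b..-b + real n * e}"
      proof (rule fun_support_minimal)
        fix t assume "(1 - \<eta> t) * \<psi> t \<noteq> 0"
        then have "\<eta> t \<noteq> 1" "\<psi> t \<noteq> 0" by auto
        then show "t \<in> {-b..-b + real n * e}" using \<eta>1[of t] fun_supportI[of \<psi> t] Suc.prems(3) by (force simp: x_def)
      qed auto
    qed
    moreover have "W (\<lambda>t. \<eta> t * \<psi> t) = 0"
    proof (rule small'[OF t(2)])
      show "fun_support (\<lambda>t. \<eta> t * \<psi> t) \<subseteq> K" by (rule order_trans[OF fun_support_mult Suc.prems(2)])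
      show "fun_support (\<lambda>t. \<eta> t * \<psi> t) \<subseteq> {x - e..x - e + 2 * (\<delta> / 3)}"
      proof (rule fun_support_minimal)
        fix t assume "\<eta> t * \<psi> t \<noteq> 0"
        then have "\<eta> t \<noteq> 0" "\<psi> t \<noteq> 0" by auto
        then show "t \<in> {x - e..x - e + 2 * (\<delta> / 3)}" using \<eta>0[of t] fun_supportI[of \<psi> t] Suc.prems(3)
          by (force simp: x_def e_def algebra_simps)
      qed auto
    qed
    moreover have "W (\<lambda>t. (1 - \<eta> t) * \<psi> t + \<eta> t * \<psi> t) = W (\<lambda>t. (1 - \<eta> t) * \<psi> t) + W (\<lambda>t. \<eta> t * \<psi> t)"
      by (rule linear_functional_add[OF lin t])
    ultimately show ?case by (simp add: algebra_simps)
  qed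
  obtain n where "2 * b / e < real n" using reals_Archimedean2 by blast
  then have "b \<le> -b + real n * e" using e by (simp add: field_simps)
  then have "fun_support \<phi> \<subseteq> {-b..-b + real n * e}" using b(2) by (fastforce simp: K_def)
  then show ?thesis by (intro main[OF \<phi>]) (simp add: K_def)
qed

lemma abs_power_exp_bound:
  fixes \<delta> m :: real assumes "\<delta> > 0"
  obtains C where "C \<ge> 0" "\<And>j t. j \<le> N \<Longrightarrow> t \<ge> m \<Longrightarrow> \<bar>t\<bar> ^ j * exp (- \<delta> * t) \<le> C"
proof -
  have *: "\<exists>C\<ge>0. \<forall>t\<ge>m. \<bar>t\<bar> ^ j * exp (- \<delta> * t) \<le> C" for j :: nat
  proof -
    \<comment> \<open>With this rate \<open>(e t)^j <= exp (j e t) <= exp (\<delta> t)\<close> for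
      \<open>t >= 0\<close>; the denominator \<open>j + 1\<close> instead of \<open>j\<close> covers
      \<open>j = 0\<close>.\<close>
    define e where "e = \<delta> / (real j + 1)"
    have e: "e > 0" "real j * e \<le> \<delta>" using assms by (auto simp: e_def field_simps)
    have "\<bar>t\<bar> ^ j * exp (- \<delta> * t) \<le> inverse e ^ j + \<bar>m\<bar> ^ j * exp (\<delta> * \<bar>m\<bar>)" if "t \<ge> m" for t
    proof (cases "t \<ge> 0")
      case True
      have "(e * t) ^ j \<le> exp (e * t) ^ j"
        using e True exp_ge_add_one_self[of "e * t"] by (intro power_mono) (auto simp del: exp_ge_add_one_self)
      also have "\<dots> = exp (real j * e * t)" by (simp add: exp_of_nat_mult[symmetric] mult.assoc)
      also have "\<dots> \<le> exp (\<delta> * t)" using e True by (simp add: mult_right_mono)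
      finally have "t ^ j * exp (- \<delta> * t) \<le> inverse e ^ j"
        using e by (simp add: power_mult_distrib exp_minus field_simps)
      moreover have "0 \<le> \<bar>m\<bar> ^ j * exp (\<delta> * \<bar>m\<bar>)" by simp
      ultimately have "t ^ j * exp (- \<delta> * t) \<le> inverse e ^ j + \<bar>m\<bar> ^ j * exp (\<delta> * \<bar>m\<bar>)" by linarith
      then show ?thesis using True by simp
    next
      case False
      then have "\<bar>t\<bar> ^ j * exp (- \<delta> * t) \<le> \<bar>m\<bar> ^ j * exp (\<delta> * \<bar>m\<bar>)"
        using that assms by (intro mult_mono power_mono) auto
      moreover have "inverse e ^ j \<ge> 0" using e by simp
      ultimately show ?thesis by simp
    qed
    moreover have "0 \<le> inverse e ^ j + \<bar>m\<bar> ^ j * exp (\<delta> * \<bar>m\<bar>)" using e by simp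
    ultimately show ?thesis by blast
  qed
  then obtain C where C: "\<And>j. C j \<ge> 0" "\<And>j t. t \<ge> m \<Longrightarrow> \<bar>t\<bar> ^ j * exp (- \<delta> * t) \<le> C j"
    by metis
  show ?thesis
  proof (rule that[of "sum C {..N}"])
    fix j t assume "j \<le> N" "t \<ge> m"
    then show "\<bar>t\<bar> ^ j * exp (- \<delta> * t) \<le> sum C {..N}"
      using C(2)[of t j] member_le_sum[of j "{..N}" C] C(1) by fastforce
  qed (auto simp: C sum_nonneg)
qed

lemma uniform_bound_atMost:
  fixes f :: "nat \<Rightarrow> 'a \<Rightarrow> real"
  assumes "\<And>k. \<exists>B. \<forall>t\<in>S. f k t \<le> B"
  obtains B where "B \<ge> 0" "\<And>k t. k \<le> N \<Longrightarrow> t \<in> S \<Longrightarrow> f k t \<le> B"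
proof -
  obtain B where B: "\<And>k t. t \<in> S \<Longrightarrow> f k t \<le> B k" using assms by metis
  show ?thesis
  proof (rule that[of "\<Sum>k\<le>N. \<bar>B k\<bar>"])
    fix k t assume "k \<le> N" "t \<in> S"
    then show "f k t \<le> (\<Sum>k\<le>N. \<bar>B k\<bar>)"
      using B[of t k] member_le_sum[of k "{..N}" "\<lambda>k. \<bar>B k\<bar>"] by fastforce
  qed (auto intro: sum_nonneg)
qed

text \<open>The factor \<open>a\<close> carries the cutoff and is merely bounded, the factor
  \<open>r\<close> carries the decay: left of \<open>m\<close> the product vanishes, right of it the
  exponential absorbs the polynomial weight. The result is linear in \<open>\<epsilon>\<close>, as
  limits and approximations require.\<close>

lemma weighted_vd_mult_bound:
  assumes "smooth a" "smooth r" and a: "\<And>k t. k \<le> N \<Longrightarrow> norm (vd k a t) \<le> A" "\<And>t. t < m \<Longrightarrow> a t = 0"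
    and r: "\<And>k t. k \<le> N \<Longrightarrow> t \<ge> m \<Longrightarrow> norm (vd k r t) \<le> \<epsilon> * exp (- \<delta> * t)"
    and C: "\<And>j t. j \<le> N \<Longrightarrow> t \<ge> m \<Longrightarrow> \<bar>t\<bar> ^ j * exp (- \<delta> * t) \<le> C" and jk: "j \<le> N" "k \<le> N"
  shows "\<bar>t\<bar> ^ j * norm (vd k (\<lambda>t. a t * r t) t) \<le> 2 ^ N * A * C * \<epsilon>"
proof -
  have A: "A \<ge> 0" using a(1)[of 0 0] norm_ge_zero order_trans by blast
  have "0 \<le> \<epsilon> * exp (- \<delta> * m)" using r[of 0 m] norm_ge_zero order_trans by blast
  then have \<epsilon>: "\<epsilon> \<ge> 0" by (simp add: zero_le_mult_iff)
  have "exp (- \<delta> * m) \<le> C" using C[of 0 m] by simp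
  then have C0: "C \<ge> 0" by (rule order_trans[OF exp_ge_zero])
  show ?thesis
  proof (cases "t < m")
    case True
    have "vd k (\<lambda>t. a t * r t) t = vd k (\<lambda>t. 0) t"
      by (rule vd_cong_open[of "{..<m}"]) (use True a(2) in auto)
    then show ?thesis using A C0 \<epsilon> by (simp add: smooth_const)
  next
    case False
    then have t: "t \<ge> m" by simp
    have "norm (vd k (\<lambda>t. a t * r t) t) \<le> 2 ^ k * (A * (\<epsilon> * exp (- \<delta> * t)))"
      using jk t by (intro norm_vd_mult_le assms(1,2) a(1) r) auto
    also have "\<dots> \<le> 2 ^ N * (A * (\<epsilon> * exp (- \<delta> * t)))"
      using jk A \<epsilon> by (intro mult_right_mono power_increasing) auto
    finally have "\<bar>t\<bar> ^ j * norm (vd k (\<lambda>t. a t * r t) t) \<le> \<bar>t\<bar> ^ j * (2 ^ N * (A * (\<epsilon> * exp (- \<delta> * t))))"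
      by (intro mult_left_mono) auto
    also have "\<dots> = (2 ^ N * A * \<epsilon>) * (\<bar>t\<bar> ^ j * exp (- \<delta> * t))" by (simp add: mult_ac)
    also have "\<dots> \<le> (2 ^ N * A * \<epsilon>) * C" using C[OF jk(1) t] A \<epsilon> by (intro mult_left_mono) auto
    finally show ?thesis by (simp add: mult_ac)
  qed
qed

lemma schwartz_functions_amplitude:
  assumes "smooth a" "smooth r" and a: "\<And>k. \<exists>B. \<forall>t. norm (vd k a t) \<le> B" "\<And>t. t < m \<Longrightarrow> a t = 0"
    and r: "\<And>k. \<exists>B. \<forall>t\<ge>m. norm (vd k r t) \<le> B * exp (- \<delta> * t)" and "\<delta> > 0"
  shows "(\<lambda>t. a t * r t) \<in> schwartz_functions"
proof (rule schwartz_functionsI)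
  show "smooth (\<lambda>t. a t * r t)" using assms by (intro smooth_mult)
  fix j k :: nat
  define N where "N = max j k"
  have a': "\<exists>B. \<forall>t\<in>UNIV. norm (vd k a t) \<le> B" for k using a(1)[of k] by blast
  obtain A where "A \<ge> 0" and A: "\<And>k t. k \<le> N \<Longrightarrow> t \<in> UNIV \<Longrightarrow> norm (vd k a t) \<le> A"
    by (rule uniform_bound_atMost[of UNIV "\<lambda>k t. norm (vd k a t)" N, OF a']) blast
  have r': "\<exists>B. \<forall>t\<in>{m..}. norm (vd k r t) * exp (\<delta> * t) \<le> B" for k
  proof -
    obtain B where B: "\<And>t. t \<ge> m \<Longrightarrow> norm (vd k r t) \<le> B * exp (- \<delta> * t)" using r[of k] by blast
    have "norm (vd k r t) * exp (\<delta> * t) \<le> B" if "t \<in> {m..}" for t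
    proof -
      have "norm (vd k r t) * exp (\<delta> * t) \<le> B * exp (- \<delta> * t) * exp (\<delta> * t)"
        using that by (intro mult_right_mono B) auto
      then show ?thesis by (simp add: mult.assoc exp_add[symmetric])
    qed
    then show ?thesis by blast
  qed
  obtain E where "E \<ge> 0" and E: "\<And>k t. k \<le> N \<Longrightarrow> t \<in> {m..} \<Longrightarrow> norm (vd k r t) * exp (\<delta> * t) \<le> E"
    by (rule uniform_bound_atMost[of "{m..}" "\<lambda>k t. norm (vd k r t) * exp (\<delta> * t)" N, OF r']) blast
  have E': "norm (vd k r t) \<le> E * exp (- \<delta> * t)" if "k \<le> N" "t \<ge> m" for k t
  proof -
    have "norm (vd k r t) * exp (\<delta> * t) * exp (- \<delta> * t) \<le> E * exp (- \<delta> * t)"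
      using that by (intro mult_right_mono E) auto
    then show ?thesis by (simp add: mult.assoc exp_add[symmetric])
  qed
  obtain C where "C \<ge> 0" and C: "\<And>j t. j \<le> N \<Longrightarrow> t \<ge> m \<Longrightarrow> \<bar>t\<bar> ^ j * exp (- \<delta> * t) \<le> C"
    by (rule abs_power_exp_bound[OF \<open>\<delta> > 0\<close>, of N m]) blast
  have "\<bar>t\<bar> ^ j * norm (vd k (\<lambda>t. a t * r t) t) \<le> 2 ^ N * A * C * E" for t
    by (rule weighted_vd_mult_bound[OF assms(1,2) A[OF _ UNIV_I] a(2) E' C]) (auto simp: N_def)
  then show "\<exists>B. \<forall>t. \<bar>t\<bar> ^ j * norm (vd k (\<lambda>t. a t * r t) t) \<le> B" by blast
qed

text \<open>Continuity of \<open>U\<close> in the form used throughout: the value at a cutoff times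
  a small decaying function is small. The cutoff may start at any \<open>m' >= m\<close> with the
  same constant \<open>K\<close>, so that it can move to infinity.\<close>

definition amplitude_bound :: "functional \<Rightarrow> nat \<Rightarrow> real \<Rightarrow> real \<Rightarrow> real \<Rightarrow> real \<Rightarrow> bool" where
  "amplitude_bound U N \<delta> m A K \<longleftrightarrow> (\<forall>a r \<epsilon> m'. m' \<ge> m \<longrightarrow> smooth a \<longrightarrow> smooth r \<longrightarrow>
      (\<forall>k\<le>N. \<forall>t. norm (vd k a t) \<le> A) \<longrightarrow> (\<forall>t<m'. a t = 0) \<longrightarrow>
      (\<forall>k\<le>N. \<forall>t\<ge>m'. norm (vd k r t) \<le> \<epsilon> * exp (- \<delta> * t)) \<longrightarrow>
      (\<lambda>t. a t * r t) \<in> schwartz_functions \<longrightarrow> norm (U (\<lambda>t. a t * r t)) \<le> K * \<epsilon>)"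

lemma amplitude_boundD:
  assumes "amplitude_bound U N \<delta> m A K" "m' \<ge> m" "smooth a" "smooth r"
    "\<And>k t. k \<le> N \<Longrightarrow> norm (vd k a t) \<le> A" "\<And>t. t < m' \<Longrightarrow> a t = 0"
    "\<And>k t. k \<le> N \<Longrightarrow> t \<ge> m' \<Longrightarrow> norm (vd k r t) \<le> \<epsilon> * exp (- \<delta> * t)"
    "(\<lambda>t. a t * r t) \<in> schwartz_functions"
  shows "norm (U (\<lambda>t. a t * r t)) \<le> K * \<epsilon>"
  using assms unfolding amplitude_bound_def by blast

text \<open>The order \<open>N\<close> of \<open>U\<close> comes before \<open>\<delta>\<close>,
  \<open>m\<close> and \<open>A\<close>: it tells how many derivatives are to be controlled before
  rates and cutoffs are chosen.\<close>

lemma tempered_functional_bound: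
  assumes "tempered_functional U"
  obtains N where "\<And>\<delta> m A. \<delta> > 0 \<Longrightarrow> \<exists>K\<ge>0. amplitude_bound U N \<delta> m A K"
proof -
  obtain C0 N where U: "\<And>\<phi>. \<phi>\<in>schwartz_functions \<Longrightarrow>
        norm (U \<phi>) \<le> C0 * (\<Sum>j\<le>N. \<Sum>k\<le>N. schwartz_seminorm j k \<phi>)"
    using assms unfolding tempered_functional_def by blast
  show ?thesis
  proof (rule that[of N])
    fix \<delta> m A :: real assume "\<delta> > 0"
    obtain C where C: "C \<ge> 0" "\<And>j t. j \<le> N \<Longrightarrow> t \<ge> m \<Longrightarrow> \<bar>t\<bar> ^ j * exp (- \<delta> * t) \<le> C"
      by (rule abs_power_exp_bound[OF \<open>\<delta> > 0\<close>, of N m]) blast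
    \<comment> \<open>There are \<open>(N + 1)^2\<close> seminorms in the bound of \<open>U\<close>,
      each at most \<open>2 ^ N * A * C * \<epsilon>\<close>.\<close>
    define K where "K = \<bar>C0\<bar> * (real (Suc N) * (real (Suc N) * (2 ^ N * \<bar>A\<bar> * C)))"
    have "norm (U (\<lambda>t. a t * r t)) \<le> K * \<epsilon>" if m': "m' \<ge> m" and sm: "smooth a" "smooth r"
      and a: "\<forall>k\<le>N. \<forall>t. norm (vd k a t) \<le> A" "\<forall>t<m'. a t = 0"
      and r: "\<forall>k\<le>N. \<forall>t\<ge>m'. norm (vd k r t) \<le> \<epsilon> * exp (- \<delta> * t)"
      and ar: "(\<lambda>t. a t * r t) \<in> schwartz_functions" for a r \<epsilon> m'
    proof -
      have A: "A \<ge> 0" using a(1) norm_ge_zero order_trans by blast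
      have sem: "schwartz_seminorm j k (\<lambda>t. a t * r t) \<le> 2 ^ N * A * C * \<epsilon>" if "j \<le> N" "k \<le> N" for j k
        by (rule schwartz_seminorm_le, rule weighted_vd_mult_bound[OF sm, of N A m' \<epsilon> \<delta> C])
          (use a r C m' that in auto)
      have sem0: "0 \<le> schwartz_seminorm j k (\<lambda>t. a t * r t)" for j k
        using schwartz_seminorm_ge[OF ar, of 0 j k] by (rule order_trans[rotated]) simp
      have "norm (U (\<lambda>t. a t * r t)) \<le> C0 * (\<Sum>j\<le>N. \<Sum>k\<le>N. schwartz_seminorm j k (\<lambda>t. a t * r t))"
        by (rule U[OF ar])
      also have "\<dots> \<le> \<bar>C0\<bar> * (\<Sum>j\<le>N. \<Sum>k\<le>N. schwartz_seminorm j k (\<lambda>t. a t * r t))"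
        by (intro mult_right_mono sum_nonneg sem0) auto
      also have "\<dots> \<le> \<bar>C0\<bar> * (\<Sum>j\<le>N. \<Sum>k\<le>N. 2 ^ N * A * C * \<epsilon>)"
        by (intro mult_left_mono sum_mono sem) auto
      also have "\<dots> = K * \<epsilon>" using A by (simp add: K_def mult_ac)
      finally show ?thesis .
    qed
    moreover have "K \<ge> 0" using C by (simp add: K_def)
    ultimately show "\<exists>K\<ge>0. amplitude_bound U N \<delta> m A K"
      unfolding amplitude_bound_def by (intro exI[of _ K] conjI allI impI)
  qed
qed

section \<open>The Laplace transform determines a distribution\<close>

lemma norm_vd_exp: "norm (vd k (\<lambda>t. exp (- z * of_real t)) t) = norm z ^ k * exp (- Re z * t)"
  using smooth_exp(2)[of k "- z"] by (simp add: norm_mult norm_power)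

lemma smooth_exp_minus: "smooth (\<lambda>t. exp (- z * of_real t))"
  using smooth_exp(1)[of "- z"] by simp

lemma schwartz_cutoff_exp:
  assumes "smooth \<theta>" "\<And>t. t \<ge> -M \<Longrightarrow> \<theta> t = 1" "\<And>t. t \<le> -M' \<Longrightarrow> \<theta> t = 0" "Re z > 0"
  shows "(\<lambda>t. \<theta> t * exp (- z * of_real t)) \<in> schwartz_functions"
proof (rule schwartz_functions_amplitude[where m = "-M'" and \<delta> = "Re z"])
  show "\<exists>B. \<forall>t. norm (vd k \<theta> t) \<le> B" for k
    by (rule bounded_vd_eventually_const[of \<theta> "-M'" 0 "-M" 1 k]) (use assms in auto)
  show "\<exists>B. \<forall>t\<ge>-M'. norm (vd k (\<lambda>t. exp (- z * of_real t)) t) \<le> B * exp (- Re z * t)" for k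
    by (rule exI[of _ "norm z ^ k"]) (unfold norm_vd_exp, simp)
qed (use assms smooth_exp_minus in auto)

lemma test_cutoff_exp:
  assumes "smooth \<theta>" "\<And>t. t \<le> -M' \<Longrightarrow> \<theta> t = 0" "smooth h"
  shows "(\<lambda>t. (1 - smooth_step (t - real n)) * (\<theta> t * h t)) \<in> test_functions"
proof (rule test_functionsI[of _ "-M'" "real n + 1"])
  have s: "smooth (\<lambda>t. smooth_step (t - real n))"
    using smooth_affine(1)[OF smooth_step, of "- real n" 1] by simp
  show "smooth (\<lambda>t. (1 - smooth_step (t - real n)) * (\<theta> t * h t))"
    by (intro smooth_mult smooth_diff smooth_const s assms)
  fix t assume nz: "(1 - smooth_step (t - real n)) * (\<theta> t * h t) \<noteq> 0"
  then have "\<not> t \<le> -M'" using assms(2)[of t] by auto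
  moreover have "\<not> t - real n \<ge> 1" using nz smooth_step_1[of "t - real n"] by auto
  ultimately show "- M' \<le> t \<and> t \<le> real n + 1" by auto
qed

text \<open>The sequence mentions neither \<open>c\<close> nor \<open>U\<close>. Its convergence to
  the value of \<open>U\<close> therefore shows that the pairing with \<open>exp (- s t)\<close> is
  determined by \<open>W\<close> and the cutoff \<open>\<theta>\<close>.\<close>

lemma tempered_extension_limit:
  assumes U: "tempered_extension (dist_mult (\<lambda>t. of_real (exp (- c * t))) W) U" and c: "c < Re s"
    and \<theta>: "smooth \<theta>" "\<And>t. t \<ge> -M \<Longrightarrow> \<theta> t = 1" "\<And>t. t \<le> -M' \<Longrightarrow> \<theta> t = 0"
  shows "(\<lambda>n. W (\<lambda>t. (1 - smooth_step (t - real n)) * (\<theta> t * exp (- s * of_real t))))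
     \<longlonglongrightarrow> U (\<lambda>t. \<theta> t * exp (- (s - of_real c) * of_real t))"
proof -
  define z where "z = s - of_real c"
  define r where "r t = exp (- z * of_real t)" for t :: real
  define \<psi> where "\<psi> t = \<theta> t * r t" for t
  \<comment> \<open>Half of the decay rate is spent on the factor
    \<open>exp (- \<delta> * n)\<close>, the other half on the polynomial weights of the
    seminorms.\<close>
  define \<delta> where "\<delta> = Re z / 2"
  have z: "Re z > 0" using c by (simp add: z_def)
  then have \<delta>: "\<delta> > 0" by (simp add: \<delta>_def)
  have tU: "tempered_functional U" and Ut: "\<And>\<phi>. \<phi> \<in> test_functions \<Longrightarrow> U \<phi> = W (\<lambda>t. of_real (exp (- c * t)) * \<phi> t)"
    using U by (auto simp: tempered_extension_def dist_mult_def)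
  have lin: "linear_functional_on schwartz_functions U" using tU by (simp add: tempered_functional_def)
  have \<psi>: "\<psi> \<in> schwartz_functions" unfolding \<psi>_def r_def by (rule schwartz_cutoff_exp[OF \<theta> z])
  have smr: "smooth r" unfolding r_def by (rule smooth_exp_minus)
  have s_step: "smooth (\<lambda>t. smooth_step (t - real n))" "vd k (\<lambda>t. smooth_step (t - real n)) = (\<lambda>t. vd k smooth_step (t - real n))" for n k
    using smooth_affine[OF smooth_step, where a = "- real n" and b = 1] by simp_all
  obtain N where N: "\<And>\<delta> m A. \<delta> > 0 \<Longrightarrow> \<exists>K\<ge>0. amplitude_bound U N \<delta> m A K"
    by (rule tempered_functional_bound[OF tU]) blast
  have step_bd: "\<exists>B. \<forall>t\<in>UNIV. norm (vd k smooth_step t) \<le> B" for k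
    by (rule bounded_vd_smooth_step[of k]) blast
  obtain A where A: "A \<ge> 0" "\<And>k t. k \<le> N \<Longrightarrow> t \<in> UNIV \<Longrightarrow> norm (vd k smooth_step t) \<le> A"
    by (rule uniform_bound_atMost[of UNIV "\<lambda>k t. norm (vd k smooth_step t)" N, OF step_bd]) blast
  obtain K where K: "K \<ge> 0" "amplitude_bound U N \<delta> 0 A K"
    using N[OF \<delta>, of 0 A] by blast
  define \<epsilon> where "\<epsilon> n = (1 + norm z) ^ N * exp (- \<delta> * real n)" for n
  have test: "(\<lambda>t. (1 - smooth_step (t - real n)) * \<psi> t) \<in> test_functions" for n
    unfolding \<psi>_def by (rule test_cutoff_exp[OF \<theta>(1) \<theta>(3) smr])
  have W_eq: "W (\<lambda>t. (1 - smooth_step (t - real n)) * (\<theta> t * exp (- s * of_real t)))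
      = U (\<lambda>t. (1 - smooth_step (t - real n)) * \<psi> t)" for n
  proof -
    have "(\<lambda>t. of_real (exp (- c * t)) * ((1 - smooth_step (t - real n)) * \<psi> t)) =
        (\<lambda>t. (1 - smooth_step (t - real n)) * (\<theta> t * exp (- s * of_real t)))"
    proof
      fix t
      have "of_real (exp (- c * t)) * exp (- z * of_real t) = exp (- s * of_real t)"
        unfolding exp_of_real[symmetric] exp_add[symmetric] by (simp add: z_def algebra_simps)
      then show "of_real (exp (- c * t)) * ((1 - smooth_step (t - real n)) * \<psi> t) =
        (1 - smooth_step (t - real n)) * (\<theta> t * exp (- s * of_real t))"
        unfolding \<psi>_def r_def by (metis mult.left_commute)
    qed
    then show ?thesis using Ut[OF test[of n]] by simp
  qed
  \<comment> \<open>For \<open>n >= - M\<close> the cutoff \<open>\<theta>\<close> is 1 wherever the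
    translated step is nonzero, so the truncation error is the step times the plain
    exponential.\<close>
  have bound: "norm (U (\<lambda>t. (1 - smooth_step (t - real n)) * \<psi> t) - U \<psi>) \<le> K * \<epsilon> n" if "real n \<ge> - M" for n
  proof -
    have eq: "(\<lambda>t. \<psi> t - (1 - smooth_step (t - real n)) * \<psi> t) = (\<lambda>t. smooth_step (t - real n) * r t)"
    proof
      fix t show "\<psi> t - (1 - smooth_step (t - real n)) * \<psi> t = smooth_step (t - real n) * r t"
      proof (cases "t \<le> real n")
        case True
        then show ?thesis by (simp add: smooth_step_0)
      next
        case False
        then show ?thesis using that by (simp add: \<psi>_def \<theta>(2) algebra_simps)
      qed
    qed
    have sch: "(\<lambda>t. (1 - smooth_step (t - real n)) * \<psi> t) \<in> schwartz_functions"
      using test test_functions_subset_schwartz by blast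
    have sch2: "(\<lambda>t. smooth_step (t - real n) * r t) \<in> schwartz_functions"
      using schwartz_functions_add[OF \<psi> schwartz_functions_cmult[OF sch, of "-1"]] by (simp add: eq[symmetric])
    have "U \<psi> - U (\<lambda>t. (1 - smooth_step (t - real n)) * \<psi> t) = U (\<lambda>t. smooth_step (t - real n) * r t)"
      unfolding eq[symmetric]
      by (rule linear_functional_diff[OF lin \<psi> sch schwartz_functions_cmult[OF sch], symmetric])
    moreover have "norm (U (\<lambda>t. smooth_step (t - real n) * r t)) \<le> K * \<epsilon> n"
    proof (rule amplitude_boundD[OF K(2), of "real n", OF _ s_step(1) smr _ _ _ sch2])
      show "norm (vd k (\<lambda>t. smooth_step (t - real n)) t) \<le> A" if "k \<le> N" for k t
        using A(2)[OF that] by (simp add: s_step)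
      show "smooth_step (t - real n) = 0" if "t < real n" for t using that by (simp add: smooth_step_0)
      show "norm (vd k r t) \<le> \<epsilon> n * exp (- \<delta> * t)" if k: "k \<le> N" and t: "real n \<le> t" for k t
      proof -
        have "norm (vd k r t) = norm z ^ k * exp (- Re z * t)" unfolding r_def by (rule norm_vd_exp)
        also have "\<dots> \<le> (1 + norm z) ^ N * (exp (- \<delta> * real n) * exp (- \<delta> * t))"
        proof (rule mult_mono)
          have "norm z ^ k \<le> (1 + norm z) ^ k" by (intro power_mono) auto
          also have "\<dots> \<le> (1 + norm z) ^ N" using k by (intro power_increasing) auto
          finally show "norm z ^ k \<le> (1 + norm z) ^ N" .
          have "\<delta> * real n \<le> \<delta> * t" using \<delta> t by (intro mult_left_mono) auto
          then show "exp (- Re z * t) \<le> exp (- \<delta> * real n) * exp (- \<delta> * t)"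
            unfolding exp_add[symmetric] by (simp add: \<delta>_def)
        qed auto
        finally show ?thesis by (simp add: \<epsilon>_def mult.assoc)
      qed
    qed simp
    ultimately show ?thesis by (metis norm_minus_commute)
  qed
  have "(\<lambda>n. exp (- \<delta> * real n)) \<longlonglongrightarrow> 0"
  proof -
    have "filterlim (\<lambda>n. - \<delta> * real n) at_bot sequentially"
      using \<delta> by (intro filterlim_tendsto_neg_mult_at_bot[OF tendsto_const _ filterlim_real_sequentially]) auto
    then show ?thesis by (rule filterlim_compose[OF exp_at_bot])
  qed
  then have "(\<lambda>n. K * ((1 + norm z) ^ N * exp (- \<delta> * real n))) \<longlonglongrightarrow> K * ((1 + norm z) ^ N * 0)"
    by (intro tendsto_mult tendsto_const)
  then have \<epsilon>0: "(\<lambda>n. K * \<epsilon> n) \<longlonglongrightarrow> 0" by (simp add: \<epsilon>_def)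
  have "(\<lambda>n. U (\<lambda>t. (1 - smooth_step (t - real n)) * \<psi> t) - U \<psi>) \<longlonglongrightarrow> 0"
  proof (rule Lim_null_comparison[OF _ \<epsilon>0])
    have "eventually (\<lambda>n. real n \<ge> - M) sequentially"
      using filterlim_real_sequentially by (simp add: filterlim_at_top)
    then show "\<forall>\<^sub>F n in sequentially. norm (U (\<lambda>t. (1 - smooth_step (t - real n)) * \<psi> t) - U \<psi>) \<le> K * \<epsilon> n"
      by (rule eventually_mono) (rule bound)
  qed
  then have "(\<lambda>n. U (\<lambda>t. (1 - smooth_step (t - real n)) * \<psi> t)) \<longlonglongrightarrow> U \<psi>"
    by (simp add: LIM_zero_iff)
  then show ?thesis unfolding W_eq \<psi>_def r_def z_def .
qed

text \<open>Well-definedness of the THE: for two admissible choices the truncated exponentials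
  differ by a test function that misses the support of \<open>W\<close>, so both values are limits
  of the same sequence.\<close>

lemma laplace_transform_eqI:
  assumes W: "distribution W" and U: "tempered_extension (dist_mult (\<lambda>t. of_real (exp (- c * t))) W) U"
    and c: "c < Re s" and supp: "dist_support W \<subseteq> {-M<..}"
    and \<theta>: "smooth \<theta>" "\<And>t. t \<ge> -M \<Longrightarrow> \<theta> t = 1" "\<And>t. t \<le> -M' \<Longrightarrow> \<theta> t = 0"
  shows "laplace_transform W s = U (\<lambda>t. \<theta> t * exp (- (s - of_real c) * of_real t))"
  unfolding laplace_transform_def
proof (rule the_equality)
  let ?v = "U (\<lambda>t. \<theta> t * exp (- (s - of_real c) * of_real t))"
  show "\<exists>c U M M' \<theta>. c < Re s \<and>
        tempered_extension (dist_mult (\<lambda>t. of_real (exp (- c * t))) W) U \<and>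
        dist_support W \<subseteq> {-M<..} \<and>
        smooth \<theta> \<and> (\<forall>t\<ge>-M. \<theta> t = 1) \<and> (\<forall>t\<le>-M'. \<theta> t = 0) \<and>
        ?v = U (\<lambda>t. \<theta> t * exp (- (s - of_real c) * of_real t))"
    using assms by blast
  fix v assume "\<exists>c U M M' \<theta>. c < Re s \<and>
        tempered_extension (dist_mult (\<lambda>t. of_real (exp (- c * t))) W) U \<and>
        dist_support W \<subseteq> {-M<..} \<and>
        smooth \<theta> \<and> (\<forall>t\<ge>-M. \<theta> t = 1) \<and> (\<forall>t\<le>-M'. \<theta> t = 0) \<and>
        v = U (\<lambda>t. \<theta> t * exp (- (s - of_real c) * of_real t))"
  then obtain c2 U2 M2 M2' \<theta>2 where c2: "c2 < Re s"
        "tempered_extension (dist_mult (\<lambda>t. of_real (exp (- c2 * t))) W) U2"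
        "dist_support W \<subseteq> {-M2<..}" and
        \<theta>2: "smooth \<theta>2" "\<And>t. t\<ge>-M2 \<Longrightarrow> \<theta>2 t = 1" "\<And>t. t\<le>-M2' \<Longrightarrow> \<theta>2 t = 0" and
        v: "v = U2 (\<lambda>t. \<theta>2 t * exp (- (s - of_real c2) * of_real t))" by blast
  let ?f = "\<lambda>\<theta> n t. (1 - smooth_step (t - real n)) * (\<theta> t * exp (- s * of_real t))"
  have lim1: "(\<lambda>n. W (?f \<theta> n)) \<longlonglongrightarrow> ?v" by (rule tempered_extension_limit[OF U c \<theta>])
  have lim2: "(\<lambda>n. W (?f \<theta>2 n)) \<longlonglongrightarrow> v" unfolding v by (rule tempered_extension_limit[OF c2(2,1) \<theta>2])
  have W_eq: "W (?f \<theta> n) = W (?f \<theta>2 n)" for n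
  proof -
    have t: "?f \<theta> n \<in> test_functions" "?f \<theta>2 n \<in> test_functions"
      using test_cutoff_exp[OF \<theta>(1,3) smooth_exp_minus] test_cutoff_exp[OF \<theta>2(1,3) smooth_exp_minus] by auto
    have lin: "linear_functional_on test_functions W" using W by (simp add: distribution_def)
    have eq: "W (\<lambda>t. ?f \<theta> n t - ?f \<theta>2 n t) = W (?f \<theta> n) - W (?f \<theta>2 n)"
      by (rule linear_functional_diff[OF lin t test_functions_cmult[OF t(2)]])
    have "W (\<lambda>t. ?f \<theta> n t - ?f \<theta>2 n t) = 0"
    proof (rule distribution_eq_0_off_support[OF W])
      show "(\<lambda>t. ?f \<theta> n t - ?f \<theta>2 n t) \<in> test_functions" by (rule test_functions_diff[OF t])
      \<comment> \<open>Both cutoffs are 1 beyond \<open>max (-M) (-M2)\<close>, and the support of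
        \<open>W\<close> lies strictly beyond that point.\<close>
      have "fun_support (\<lambda>t. ?f \<theta> n t - ?f \<theta>2 n t) \<subseteq> {..max (-M) (-M2)}"
      proof (rule fun_support_minimal)
        fix t assume "?f \<theta> n t - ?f \<theta>2 n t \<noteq> 0"
        then have "\<theta> t \<noteq> \<theta>2 t" by auto
        then have "\<not> (t \<ge> -M \<and> t \<ge> -M2)" using \<theta>(2)[of t] \<theta>2(2)[of t] by auto
        then show "t \<in> {..max (-M) (-M2)}" by auto
      qed auto
      moreover have "dist_support W \<subseteq> {max (-M) (-M2)<..}" using supp c2(3) by auto
      ultimately show "fun_support (\<lambda>t. ?f \<theta> n t - ?f \<theta>2 n t) \<inter> dist_support W = {}" by fastforce
    qed
    from trans[OF eq[symmetric] this] show ?thesis by (simp only: eq_iff_diff_eq_0[symmetric])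
  qed
  have "(\<lambda>n. W (?f \<theta>2 n)) \<longlonglongrightarrow> ?v"
    by (rule Lim_transform_eventually[OF lim1]) (intro always_eventually allI W_eq)
  then show "v = ?v" by (rule LIMSEQ_unique[OF lim2])
qed

section \<open>Approximation of test functions by exponential sums\<close>

lemma uniform_polynomial_approximation:
  fixes f :: "real \<Rightarrow> complex"
  assumes "compact S" "continuous_on S f" "e > 0"
  obtains n q where "\<And>x. x \<in> S \<Longrightarrow> norm (f x - (\<Sum>j<n. q j * of_real x ^ j)) \<le> e"
proof -
  obtain g where g: "polynomial_function g" "\<And>x. x \<in> S \<Longrightarrow> norm (f x - g x) < e"
    using Stone_Weierstrass_polynomial_function[OF assms] by blast
  have "real_polynomial_function (Re \<circ> g)" "real_polynomial_function (Im \<circ> g)"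
    using g(1) bounded_linear_Re bounded_linear_Im by (auto simp: polynomial_function_def)
  then obtain a n b n' where ab: "Re \<circ> g = (\<lambda>x. \<Sum>i\<le>n. a i * x ^ i)" "Im \<circ> g = (\<lambda>x. \<Sum>i\<le>n'. b i * x ^ i)"
    unfolding real_polynomial_function_iff_sum by blast
  \<comment> \<open>Real and imaginary part may have different degrees; padding with zeros gives
    complex coefficients of one common length.\<close>
  define k where "k = Suc (max n n')"
  define q where "q j = Complex (if j \<le> n then a j else 0) (if j \<le> n' then b j else 0)" for j
  have "g x = (\<Sum>j<k. q j * of_real x ^ j)" for x
  proof (rule complex_eqI)
    have "Re (g x) = (\<Sum>i\<le>n. a i * x ^ i)" using ab(1) by (metis o_apply)
    also have "\<dots> = (\<Sum>j<k. (if j \<le> n then a j else 0) * x ^ j)"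
      by (rule sum.mono_neutral_cong_left) (auto simp: k_def)
    finally show "Re (g x) = Re (\<Sum>j<k. q j * of_real x ^ j)"
      by (simp add: q_def flip: of_real_power)
    have "Im (g x) = (\<Sum>i\<le>n'. b i * x ^ i)" using ab(2) by (metis o_apply)
    also have "\<dots> = (\<Sum>j<k. (if j \<le> n' then b j else 0) * x ^ j)"
      by (rule sum.mono_neutral_cong_left) (auto simp: k_def)
    finally show "Im (g x) = Im (\<Sum>j<k. q j * of_real x ^ j)"
      by (simp add: q_def flip: of_real_power)
  qed
  then show ?thesis using g(2) by (intro that[of q k]) (auto simp: less_imp_le)
qed

text \<open>Unit spacing above an offset \<open>L\<close>: the uniqueness proof samples the Laplace
  transform at the points \<open>L + j\<close>, with \<open>L\<close> beyond the abscissa of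
  convergence.\<close>

abbreviation exp_sum :: "real \<Rightarrow> nat \<Rightarrow> (nat \<Rightarrow> complex) \<Rightarrow> real \<Rightarrow> complex" where
  "exp_sum L n q t \<equiv> (\<Sum>j<n. q j * exp (- of_real (L + real j) * of_real t))"

lemma smooth_exp_sum: "smooth (exp_sum L n q)"
  by (intro smooth_sum(1) smooth_cmult(1) smooth_exp_minus)

text \<open>In the variable \<open>x = e\<^sup>-\<^sup>t\<close> the exponential sums are polynomials.\<close>

lemma exp_sum_approximation_0:
  assumes \<phi>: "\<phi> \<in> test_functions" and \<epsilon>: "\<epsilon> > 0"
  shows "\<exists>n q. \<forall>t\<ge>m. norm (\<phi> t - exp_sum L n q t) \<le> \<epsilon> * exp (- L * t)"
proof -
  obtain b where b: "b > 0" "fun_support \<phi> \<subseteq> {-b..b}" using test_functionsE[OF \<phi>] .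
  have \<phi>0: "\<phi> t = 0" if "t > b" for t using b that fun_supportI[of \<phi> t] by force
  \<comment> \<open>Dividing \<open>\<phi>\<close> by \<open>exp (- L t)\<close> turns the weighted
    error into a plain uniform one. As \<open>\<phi>\<close> vanishes for large \<open>t\<close>,
    the quotient is 0 for small positive \<open>x\<close> and extends continuously by 0 to
    \<open>x <= 0\<close>; the compact interval can thus include \<open>x = 0\<close>, that is
    \<open>t\<close> at infinity.\<close>
  define F where "F x = (if x \<le> 0 then 0 else \<phi> (- ln x) * of_real (x powr (- L)))" for x
  have "continuous_on ({..<exp (-b)} \<union> {0<..}) F"
  proof (rule continuous_on_open_Un)
    have "F x = 0" if x: "x \<in> {..<exp (-b)}" for x
    proof (cases "x \<le> 0")
      case False
      then have "ln x < ln (exp (-b))" using x by (subst ln_less_cancel_iff) auto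
      then have "- ln x > b" by simp
      then show ?thesis by (simp add: F_def \<phi>0)
    qed (simp add: F_def)
    then show "continuous_on {..<exp (-b)} F"
      using continuous_on_cong[OF refl, of "{..<exp (-b)}" F "\<lambda>_. 0"] by simp
    have "continuous_on {0<..} (\<lambda>x. \<phi> (- ln x) * of_real (x powr (- L)))"
      by (intro continuous_intros continuous_on_compose2[OF smooth_continuous_on[OF test_functions_smooth[OF \<phi>], of UNIV]]) auto
    then show "continuous_on {0<..} F"
      using continuous_on_cong[OF refl, of "{0<..}" F "\<lambda>x. \<phi> (- ln x) * of_real (x powr (- L))"] by (simp add: F_def)
  qed auto
  then have "continuous_on {0..exp (- m)} F"
    by (rule continuous_on_subset) (auto intro: le_less_trans)
  from uniform_polynomial_approximation[OF compact_Icc this \<epsilon>]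
  obtain n q where nq: "\<And>x. x \<in> {0..exp (-m)} \<Longrightarrow> norm (F x - (\<Sum>j<n. q j * of_real x ^ j)) \<le> \<epsilon>" by blast
  have "norm (\<phi> t - exp_sum L n q t) \<le> \<epsilon> * exp (- L * t)" if t: "t \<ge> m" for t
  proof -
    have 1: "F (exp (-t)) = \<phi> t * of_real (exp (L * t))" by (simp add: F_def powr_def)
    have "exp_sum L n q t = of_real (exp (- L * t)) * (\<Sum>j<n. q j * of_real (exp (-t)) ^ j)"
      unfolding sum_distrib_left
    proof (rule sum.cong[OF refl])
      fix j
      have "complex_of_real (exp (-t)) ^ j = of_real (exp (- (real j * t)))"
        by (simp add: exp_of_nat_mult[symmetric] flip: of_real_power)
      moreover have "exp (- of_real (L + real j) * complex_of_real t) = of_real (exp (- L * t) * exp (- (real j * t)))"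
        unfolding exp_add[symmetric] exp_of_real[symmetric] by (rule arg_cong[where f = exp]) (simp add: algebra_simps)
      ultimately show "q j * exp (- of_real (L + real j) * of_real t) = of_real (exp (- L * t)) * (q j * of_real (exp (-t)) ^ j)"
        by simp
    qed
    moreover have "\<phi> t = of_real (exp (- L * t)) * F (exp (-t))"
      unfolding 1 by (simp add: mult.left_commute[of _ "\<phi> t"] exp_add[symmetric] flip: of_real_mult)
    ultimately have "\<phi> t - exp_sum L n q t = of_real (exp (- L * t)) * (F (exp (-t)) - (\<Sum>j<n. q j * of_real (exp (-t)) ^ j))"
      by (simp only: right_diff_distrib)
    then have "norm (\<phi> t - exp_sum L n q t) = exp (- L * t) * norm (F (exp (-t)) - (\<Sum>j<n. q j * of_real (exp (-t)) ^ j))"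
      by (simp add: norm_mult)
    also have "\<dots> \<le> exp (- L * t) * \<epsilon>" using t by (intro mult_left_mono nq) auto
    finally show ?thesis by (simp add: mult.commute)
  qed
  then show ?thesis by blast
qed

lemma exp_sum_tendsto_0: assumes "L > 0" shows "(exp_sum L n q \<longlongrightarrow> 0) at_top"
proof -
  have "((\<lambda>t. exp (- of_real (L + real j) * complex_of_real t)) \<longlongrightarrow> 0) at_top" for j
  proof (rule tendsto_norm_zero_cancel)
    have "filterlim (\<lambda>t. - (L + real j) * t) at_bot at_top"
      using assms by (intro filterlim_tendsto_neg_mult_at_bot[OF tendsto_const _ filterlim_ident]) auto
    then have "((\<lambda>t. exp (- (L + real j) * t)) \<longlongrightarrow> 0) at_top" by (rule filterlim_compose[OF exp_at_bot])
    then show "((\<lambda>t. norm (exp (- of_real (L + real j) * complex_of_real t))) \<longlongrightarrow> 0) at_top" by simp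
  qed
  then have "(exp_sum L n q \<longlongrightarrow> (\<Sum>j<n. q j * 0)) at_top" by (intro tendsto_sum tendsto_mult tendsto_const)
  then show ?thesis by simp
qed

text \<open>Integration from infinity multiplies an error bounded by \<open>\<epsilon> e\<^sup>-\<^sup>L\<^sup>t\<close> by at most \<open>1 / L\<close>.\<close>

lemma exp_sum_approximation:
  assumes "\<phi> \<in> test_functions" "\<epsilon> > 0" "L \<ge> 1"
  shows "\<exists>n q. \<forall>k\<le>N. \<forall>t\<ge>m. norm (vd k (\<lambda>t. \<phi> t - exp_sum L n q t) t) \<le> \<epsilon> * exp (- L * t)"
  using assms(1)
proof (induction N arbitrary: \<phi>)
  case 0
  then show ?case using exp_sum_approximation_0[OF 0 assms(2), of m L] by simp
next
  case (Suc N)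
  have "vderiv \<phi> \<in> test_functions" using test_functions_vd[OF Suc.prems, of 1] by simp
  then obtain n q where nq: "\<And>k t. k \<le> N \<Longrightarrow> t \<ge> m \<Longrightarrow> norm (vd k (\<lambda>t. vderiv \<phi> t - exp_sum L n q t) t) \<le> \<epsilon> * exp (- L * t)"
    using Suc.IH by blast
  \<comment> \<open>Coefficients of the antiderivative that vanishes at infinity;
    \<open>L >= 1\<close> keeps the exponents away from 0.\<close>
  define q' where "q' j = - q j / of_real (L + real j)" for j
  define r where "r t = \<phi> t - exp_sum L n q' t" for t
  have sm: "smooth \<phi>" using Suc.prems by (rule test_functions_smooth)
  have dr: "(r has_vector_derivative (vderiv \<phi> t - exp_sum L n q t)) (at t)" for t
  proof -
    have "((\<lambda>t. q' j * exp (- of_real (L + real j) * of_real t)) has_vector_derivative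
       q j * exp (- of_real (L + real j) * of_real t)) (at t)" for j
    proof (rule has_vector_derivative_real_field)
      have "L + real j \<noteq> 0" using assms(3) by linarith
      then have "complex_of_real (L + real j) \<noteq> 0" by (simp only: of_real_eq_0_iff not_False_eq_True)
      then have "q' j * - of_real (L + real j) = q j"
        unfolding q'_def by (metis minus_mult_minus minus_divide_left nonzero_eq_divide_eq minus_minus)
      moreover have "((\<lambda>z. q' j * exp (- of_real (L + real j) * z)) has_field_derivative
         q' j * - of_real (L + real j) * exp (- of_real (L + real j) * of_real t)) (at (of_real t))"
        by (auto intro!: derivative_eq_intros)
      ultimately show "((\<lambda>z. q' j * exp (- of_real (L + real j) * z)) has_field_derivative
         q j * exp (- of_real (L + real j) * of_real t)) (at (of_real t))"
        by simp
    qed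
    then show ?thesis unfolding r_def
      by (intro has_vector_derivative_diff has_vector_derivative_sum smooth_has_vderiv[OF sm])
  qed
  have vr: "vderiv r = (\<lambda>t. vderiv \<phi> t - exp_sum L n q t)" by (rule vderiv_eqI[OF dr])
  have r0: "norm (r t) \<le> \<epsilon> * exp (- L * t)" if t: "t \<ge> m" for t
  proof -
    obtain b where b: "b > 0" "fun_support \<phi> \<subseteq> {-b..b}" using test_functionsE[OF Suc.prems] .
    have "eventually (\<lambda>T. \<phi> T = 0) at_top"
      using eventually_gt_at_top[of b] by eventually_elim (use b(2) fun_supportI[of \<phi>] in force)
    then have "(\<phi> \<longlongrightarrow> 0) at_top" by (rule tendsto_eventually)
    then have "(r \<longlongrightarrow> 0 - 0) at_top" unfolding r_def
      using assms(3) by (intro tendsto_diff exp_sum_tendsto_0) auto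
    \<comment> \<open>Since \<open>r\<close> vanishes at infinity, its value at \<open>t\<close> is
      recovered from the increments over \<open>[t, T]\<close> as \<open>T\<close> grows.\<close>
    then have lim: "((\<lambda>T. norm (r T - r t)) \<longlongrightarrow> norm (0 - r t)) at_top" by (intro tendsto_intros) simp
    have "norm (r T - r t) \<le> \<epsilon> * exp (- L * t)" if T: "T > t" for T
    proof -
      have "norm (r T - r t) \<le> (- \<epsilon> / L) * exp (- L * T) - (- \<epsilon> / L) * exp (- L * t)"
      proof (rule differentiable_bound_general[OF T])
        show "continuous_on {t..T} r"
          using dr has_vector_derivative_continuous by (blast intro: continuous_at_imp_continuous_on)
        show "continuous_on {t..T} (\<lambda>x. - \<epsilon> / L * exp (- L * x))" by (intro continuous_intros)
        show "(r has_vector_derivative (vderiv \<phi> x - exp_sum L n q x)) (at x)" for x by (rule dr)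
        show "((\<lambda>x. - \<epsilon> / L * exp (- L * x)) has_vector_derivative \<epsilon> * exp (- L * x)) (at x)" for x
          unfolding has_real_derivative_iff_has_vector_derivative[symmetric]
          using assms(3) by (auto intro!: derivative_eq_intros)
        show "norm (vderiv \<phi> x - exp_sum L n q x) \<le> \<epsilon> * exp (- L * x)" if "t < x" for x
          using nq[of 0 x] t that by simp
      qed
      also have "\<dots> \<le> \<epsilon> / L * exp (- L * t)" using assms(2,3) by simp
      \<comment> \<open>As \<open>L >= 1\<close>, integration does not enlarge the bound, so the
        same \<open>\<epsilon>\<close> survives the whole induction on the order.\<close>
      also have "\<dots> \<le> \<epsilon> * exp (- L * t)" using assms(2,3) by (intro mult_right_mono) (auto simp: field_simps)
      finally show ?thesis .
    qed
    then have "eventually (\<lambda>T. norm (r T - r t) \<le> \<epsilon> * exp (- L * t)) at_top"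
      using eventually_gt_at_top[of t] by (rule eventually_mono[rotated])
    from tendsto_upperbound[OF lim this] show ?thesis by simp
  qed
  have "norm (vd k r t) \<le> \<epsilon> * exp (- L * t)" if "k \<le> Suc N" "t \<ge> m" for k t
  proof (cases k)
    case 0
    then show ?thesis using r0[OF that(2)] by simp
  next
    case (Suc k')
    then show ?thesis using nq[of k' t] that by (simp add: vd_Suc vr del: funpow.simps(2))
  qed
  then show ?case unfolding r_def by blast
qed

section \<open>Recovering a distribution from its Laplace transform\<close>

lemma schwartz_linear_functional_sum:
  assumes lin: "linear_functional_on schwartz_functions U" and f: "\<And>j :: nat. f j \<in> schwartz_functions"
  shows "(\<lambda>t. \<Sum>j<n. q j * f j t) \<in> schwartz_functions" (is ?A)
    and "U (\<lambda>t. \<Sum>j<n. q j * f j t) = (\<Sum>j<n. q j * U (f j))" (is ?B)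
proof -
  have "?A \<and> ?B"
  proof (rule linear_functional_sum[OF lin])
    show "f 0 \<in> schwartz_functions" by (rule f)
  qed (use f in \<open>auto intro: schwartz_functions_add schwartz_functions_cmult\<close>)
  then show ?A ?B by auto
qed

text \<open>\<open>K\<close> is fixed before \<open>\<epsilon>\<close>, \<open>n\<close> and
  \<open>q\<close>: a good approximant, however many terms it has, makes the error as small as
  desired.\<close>

definition laplace_approximates :: "functional \<Rightarrow> (real \<Rightarrow> complex) \<Rightarrow> nat \<Rightarrow> real \<Rightarrow> real \<Rightarrow> real \<Rightarrow> bool" where
  "laplace_approximates W \<phi> N L M K \<longleftrightarrow> (\<forall>\<epsilon> n q.
     (\<forall>k\<le>N. \<forall>t\<ge>-M-1. norm (vd k (\<lambda>t. \<phi> t - exp_sum L n q t) t) \<le> \<epsilon> * exp (- L * t)) \<longrightarrow>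
     norm (W \<phi> - (\<Sum>j<n. q j * laplace_transform W (of_real (L + real j)))) \<le> K * \<epsilon>)"

lemma laplace_approximatesD:
  assumes "laplace_approximates W \<phi> N L M K"
    "\<forall>k\<le>N. \<forall>t\<ge>-M-1. norm (vd k (\<lambda>t. \<phi> t - exp_sum L n q t) t) \<le> \<epsilon> * exp (- L * t)"
  shows "norm (W \<phi> - (\<Sum>j<n. q j * laplace_transform W (of_real (L + real j)))) \<le> K * \<epsilon>"
  using assms unfolding laplace_approximates_def by blast

text \<open>\<open>U\<close> is applied to \<open>\<theta> * exp (c t)\<close> times the
  approximation error: linearity turns the exponential sum into Laplace values, and the amplitude
  bound controls the rest at the rate \<open>L - c\<close>.\<close>

lemma laplace_transform_determines:
  assumes W: "laplace_transformable W" and \<phi>: "\<phi> \<in> test_functions"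
  shows "\<exists>N L0 M0. \<forall>L>L0. \<forall>M\<ge>M0. \<exists>K\<ge>0. laplace_approximates W \<phi> N L M K"
proof -
  obtain M1 c U where dW: "distribution W" and M1: "dist_support W \<subseteq> {-M1<..}" and
     U: "tempered_extension (dist_mult (\<lambda>t. of_real (exp (- c * t))) W) U"
    using W unfolding laplace_transformable_def by blast
  obtain b where b: "b > 0" "fun_support \<phi> \<subseteq> {-b..b}" using test_functionsE[OF \<phi>] .
  have tU: "tempered_functional U" and Ut: "\<And>\<phi>. \<phi> \<in> test_functions \<Longrightarrow> U \<phi> = W (\<lambda>t. of_real (exp (- c * t)) * \<phi> t)"
    using U by (auto simp: tempered_extension_def dist_mult_def)
  have lin: "linear_functional_on schwartz_functions U" using tU by (simp add: tempered_functional_def)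
  obtain N where N: "\<And>\<delta> m A. \<delta> > 0 \<Longrightarrow> \<exists>K\<ge>0. amplitude_bound U N \<delta> m A K"
    by (rule tempered_functional_bound[OF tU]) blast
  have "\<exists>K\<ge>0. laplace_approximates W \<phi> N L M K"
    if L: "L > c" and M: "M \<ge> max M1 b" for L M
  proof -
    \<comment> \<open>\<open>\<theta>\<close> is 1 on the supports of \<open>W\<close> and of
      \<open>\<phi>\<close>. It vanishes up to \<open>- M - 1\<close>, which is where the
      approximation of \<open>\<phi>\<close> has to start.\<close>
    define \<theta> where "\<theta> t = smooth_step (M + 1 + 1 * t)" for t
    have \<theta>: "smooth \<theta>" "\<And>t. t \<ge> -M \<Longrightarrow> \<theta> t = 1" "\<And>t. t \<le> -(M+1) \<Longrightarrow> \<theta> t = 0"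
      unfolding \<theta>_def using smooth_affine(1)[OF smooth_step, of "M+1" 1] smooth_step_0 smooth_step_1 by auto
    have supp: "dist_support W \<subseteq> {-M<..}" using M1 M by auto
    have step_bd: "\<exists>B. \<forall>t\<in>UNIV. norm (vd k \<theta> t) \<le> B" for k
      by (rule bounded_vd_eventually_const[of \<theta> "-(M+1)" 0 "-M" 1 k]) (use \<theta> in auto)
    obtain A where A: "A \<ge> 0" "\<And>k t. k \<le> N \<Longrightarrow> t \<in> UNIV \<Longrightarrow> norm (vd k \<theta> t) \<le> A"
      by (rule uniform_bound_atMost[of UNIV "\<lambda>k t. norm (vd k \<theta> t)" N, OF step_bd]) blast
    define \<delta> where "\<delta> = L - c"
    have \<delta>: "\<delta> > 0" using L by (simp add: \<delta>_def)
    obtain K where K: "K \<ge> 0" "amplitude_bound U N \<delta> (-M-1) A K" using N[OF \<delta>] by blast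
    \<comment> \<open>Leibniz constant for the factor \<open>exp (c t)\<close>, whose
      \<open>i\<close>-th derivative brings \<open>c ^ i\<close>.\<close>
    define B where "B = 2 ^ N * (1 + \<bar>c\<bar>) ^ N"
    define e where "e t = complex_of_real (exp (c * t))" for t
    have e: "e = (\<lambda>t. exp (of_real c * of_real t))" by (auto simp: e_def exp_of_real[symmetric])
    have sme: "smooth e" unfolding e by (rule smooth_exp)
    have LT: "laplace_transform W (of_real (L + real j)) = U (\<lambda>t. \<theta> t * exp (- of_real (L + real j - c) * of_real t))" for j
    proof -
      have "laplace_transform W (of_real (L + real j)) = U (\<lambda>t. \<theta> t * exp (- (of_real (L + real j) - of_real c) * of_real t))"
        by (rule laplace_transform_eqI[OF dW U _ supp \<theta>]) (use L in simp)
      then show ?thesis by (simp only: of_real_diff)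
    qed
    have sch: "(\<lambda>t. \<theta> t * exp (- of_real (L + real j - c) * of_real t)) \<in> schwartz_functions" for j
          proof (rule schwartz_cutoff_exp[OF \<theta>])
      show "Re (of_real (L + real j - c)) > 0" unfolding Re_complex_of_real using L by simp
    qed
    have e\<phi>: "(\<lambda>t. e t * \<phi> t) \<in> test_functions" by (rule test_functions_mult[OF sme \<phi>])
    have W\<phi>: "W \<phi> = U (\<lambda>t. e t * \<phi> t)"
    proof -
      have "(\<lambda>t. of_real (exp (- c * t)) * (e t * \<phi> t)) = \<phi>"
        by (auto simp: e_def exp_minus)
      then show ?thesis using Ut[OF e\<phi>] by simp
    qed
    have "norm (W \<phi> - (\<Sum>j<n. q j * laplace_transform W (of_real (L + real j)))) \<le> K * B * \<epsilon>"
      if ap: "\<forall>k\<le>N. \<forall>t\<ge>-M-1. norm (vd k (\<lambda>t. \<phi> t - exp_sum L n q t) t) \<le> \<epsilon> * exp (- L * t)" for \<epsilon> n q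
    proof -
      let ?S = "\<lambda>t. \<Sum>j<n. q j * (\<theta> t * exp (- of_real (L + real j - c) * of_real t))"
      have S: "?S \<in> schwartz_functions" "U ?S = (\<Sum>j<n. q j * U (\<lambda>t. \<theta> t * exp (- of_real (L + real j - c) * of_real t)))"
        by (rule schwartz_linear_functional_sum[OF lin sch])+
      define r where "r t = e t * (\<phi> t - exp_sum L n q t)" for t
      have smd: "smooth (\<lambda>t. \<phi> t - exp_sum L n q t)" by (intro smooth_diff test_functions_smooth[OF \<phi>] smooth_exp_sum)
      have smr: "smooth r" unfolding r_def by (intro smooth_mult sme smd)
      have eq: "(\<lambda>t. e t * \<phi> t - ?S t) = (\<lambda>t. \<theta> t * r t)"
      proof
        fix t
        have "e t * exp (- of_real (L + real j) * of_real t) = exp (- of_real (L + real j - c) * of_real t)" for j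
          unfolding e exp_add[symmetric] by (simp add: algebra_simps)
        then have "?S t = (\<Sum>j<n. (\<theta> t * e t) * (q j * exp (- of_real (L + real j) * of_real t)))"
          by (intro sum.cong) (simp_all only: mult_ac)
        also have "\<dots> = (\<theta> t * e t) * exp_sum L n q t" by (simp only: sum_distrib_left)
        finally have "?S t = (\<theta> t * e t) * exp_sum L n q t" .
        moreover have "e t * \<phi> t = (\<theta> t * e t) * \<phi> t"
        proof (cases "t \<ge> -M")
          case False
          then have "\<phi> t = 0" using b M fun_supportI[of \<phi> t] by force
          then show ?thesis by simp
        qed (simp add: \<theta>)
        ultimately show "e t * \<phi> t - ?S t = \<theta> t * r t" unfolding r_def by (simp only: right_diff_distrib mult.assoc)
      qed
      have e\<phi>s: "(\<lambda>t. e t * \<phi> t) \<in> schwartz_functions" using e\<phi> test_functions_subset_schwartz by blast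
      have "(\<lambda>t. e t * \<phi> t + -1 * ?S t) \<in> schwartz_functions"
        by (rule schwartz_functions_add[OF e\<phi>s schwartz_functions_cmult[OF S(1)]])
      moreover have "(\<lambda>t. e t * \<phi> t + -1 * ?S t) = (\<lambda>t. \<theta> t * r t)" unfolding eq[symmetric] by simp
      ultimately have sch2: "(\<lambda>t. \<theta> t * r t) \<in> schwartz_functions" by (simp only:)
      have "W \<phi> - (\<Sum>j<n. q j * laplace_transform W (of_real (L + real j))) = U (\<lambda>t. \<theta> t * r t)"
        unfolding W\<phi> LT S(2)[symmetric] eq[symmetric]
        by (rule linear_functional_diff[OF lin e\<phi>s S(1) schwartz_functions_cmult[OF S(1)], symmetric])
      moreover have "norm (U (\<lambda>t. \<theta> t * r t)) \<le> K * (B * \<epsilon>)"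
      proof (rule amplitude_boundD[OF K(2) order_refl \<theta>(1) smr _ _ _ sch2])
        show "norm (vd k \<theta> t) \<le> A" if "k \<le> N" for k t using A(2)[OF that] by simp
        show "\<theta> t = 0" if "t < -M-1" for t using that by (simp add: \<theta>)
        show "norm (vd k r t) \<le> B * \<epsilon> * exp (- \<delta> * t)" if k: "k \<le> N" and t: "t \<ge> -M-1" for k t
        proof -
          have "norm (vd k r t) \<le> 2 ^ k * (((1 + \<bar>c\<bar>) ^ N * exp (c * t)) * (\<epsilon> * exp (- L * t)))"
            unfolding r_def
          proof (rule norm_vd_mult_le[OF sme smd])
            fix i assume i: "i \<le> k"
            have "norm (vd i e t) = \<bar>c\<bar> ^ i * exp (c * t)" unfolding e smooth_exp(2) by (simp add: norm_mult norm_power)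
            also have "\<dots> \<le> (1 + \<bar>c\<bar>) ^ N * exp (c * t)"
            proof (rule mult_right_mono)
              have "\<bar>c\<bar> ^ i \<le> (1 + \<bar>c\<bar>) ^ i" by (intro power_mono) auto
              also have "\<dots> \<le> (1 + \<bar>c\<bar>) ^ N" using i k by (intro power_increasing) auto
              finally show "\<bar>c\<bar> ^ i \<le> (1 + \<bar>c\<bar>) ^ N" .
            qed simp
            finally show "norm (vd i e t) \<le> (1 + \<bar>c\<bar>) ^ N * exp (c * t)" .
            show "norm (vd i (\<lambda>t. \<phi> t - exp_sum L n q t) t) \<le> \<epsilon> * exp (- L * t)" using ap i k t by simp
          qed
          also have "\<dots> \<le> 2 ^ N * (((1 + \<bar>c\<bar>) ^ N * exp (c * t)) * (\<epsilon> * exp (- L * t)))"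
          proof (rule mult_right_mono)
            have "0 \<le> norm (vd 0 (\<lambda>t. \<phi> t - exp_sum L n q t) t)" by simp
            also have "\<dots> \<le> \<epsilon> * exp (- L * t)" using ap t by blast
            finally show "0 \<le> ((1 + \<bar>c\<bar>) ^ N * exp (c * t)) * (\<epsilon> * exp (- L * t))" by (rule mult_nonneg_nonneg[rotated]) simp
            show "(2::real) ^ k \<le> 2 ^ N" using k by (intro power_increasing) auto
          qed
          also have "\<dots> = B * \<epsilon> * (exp (c * t) * exp (- L * t))" by (simp add: B_def mult_ac)
          also have "exp (c * t) * exp (- L * t) = exp (- \<delta> * t)" unfolding exp_add[symmetric] by (simp add: \<delta>_def algebra_simps)
          finally show ?thesis .
        qed
      qed
      ultimately show ?thesis by (simp only: mult.assoc)
    qed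
    moreover have "K * B \<ge> 0" using K(1) by (simp add: B_def)
    ultimately show ?thesis unfolding laplace_approximates_def by blast
  qed
  then show ?thesis by blast
qed

lemma laplace_transform_inj:
  assumes W: "laplace_transformable W1" "laplace_transformable W2"
    and eq: "\<And>s. Re s > a \<Longrightarrow> laplace_transform W1 s = laplace_transform W2 s" and \<phi>: "\<phi> \<in> test_functions"
  shows "W1 \<phi> = W2 \<phi>"
proof -
  obtain N1 L1 M1 where 1: "\<And>L M. L > L1 \<Longrightarrow> M \<ge> M1 \<Longrightarrow> \<exists>K\<ge>0. laplace_approximates W1 \<phi> N1 L M K"
    using laplace_transform_determines[OF W(1) \<phi>] by blast
  obtain N2 L2 M2 where 2: "\<And>L M. L > L2 \<Longrightarrow> M \<ge> M2 \<Longrightarrow> \<exists>K\<ge>0. laplace_approximates W2 \<phi> N2 L M K"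
    using laplace_transform_determines[OF W(2) \<phi>] by blast
  \<comment> \<open>Beyond both thresholds and the abscissa \<open>a\<close>, and at least 1 as the
    approximation in derivatives requires.\<close>
  define L where "L = max (max L1 L2) (max a 1) + 1"
  define M where "M = max M1 M2"
  have L: "L > L1" "L > L2" "L > a" "L \<ge> 1" and M: "M \<ge> M1" "M \<ge> M2" by (auto simp: L_def M_def)
  obtain K1 where K1: "K1 \<ge> 0" "laplace_approximates W1 \<phi> N1 L M K1" using 1[OF L(1) M(1)] by blast
  obtain K2 where K2: "K2 \<ge> 0" "laplace_approximates W2 \<phi> N2 L M K2" using 2[OF L(2) M(2)] by blast
  have "norm (W1 \<phi> - W2 \<phi>) \<le> 0 + e" if e: "e > 0" for e
  proof -
    define \<epsilon> where "\<epsilon> = e / (K1 + K2 + 1)"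
    have \<epsilon>: "\<epsilon> > 0" using e K1(1) K2(1) by (simp add: \<epsilon>_def)
    \<comment> \<open>One approximant serves both functionals, with as many derivatives as the
      larger order demands.\<close>
    obtain n q where nq: "\<forall>k\<le>max N1 N2. \<forall>t\<ge>-M-1. norm (vd k (\<lambda>t. \<phi> t - exp_sum L n q t) t) \<le> \<epsilon> * exp (- L * t)"
      using exp_sum_approximation[OF \<phi> \<epsilon> L(4)] by blast
    let ?S = "\<Sum>j<n. q j * laplace_transform W1 (of_real (L + real j))"
    have S: "?S = (\<Sum>j<n. q j * laplace_transform W2 (of_real (L + real j)))"
      using L(3) by (intro sum.cong refl arg_cong2[where f = "(*)"] eq) simp
    have "norm (W1 \<phi> - ?S) \<le> K1 * \<epsilon>" by (rule laplace_approximatesD[OF K1(2)]) (use nq in simp)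
    moreover have "norm (W2 \<phi> - ?S) \<le> K2 * \<epsilon>" unfolding S by (rule laplace_approximatesD[OF K2(2)]) (use nq in simp)
    moreover have "norm (W1 \<phi> - W2 \<phi>) \<le> norm (W1 \<phi> - ?S) + norm (W2 \<phi> - ?S)"
      using norm_triangle_ineq4[of "W1 \<phi> - ?S" "W2 \<phi> - ?S"] by simp
    ultimately have "norm (W1 \<phi> - W2 \<phi>) \<le> (K1 + K2) * \<epsilon>" by (simp add: algebra_simps)
    also have "\<dots> \<le> e" using e K1(1) K2(1) by (simp add: \<epsilon>_def field_simps)
    finally show ?thesis by simp
  qed
  then have "norm (W1 \<phi> - W2 \<phi>) \<le> 0" by (rule field_le_epsilon)
  then show ?thesis by simp
qed

section \<open>Entire functions of finite order\<close>

lemma eventually_eq_at_imp_eq: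
  fixes f g :: "complex \<Rightarrow> complex"
  assumes "continuous_on UNIV f" "continuous_on UNIV g" "eventually (\<lambda>w. f w = g w) (at z)"
  shows "f z = g z"
proof -
  have "f \<midarrow>z\<rightarrow> f z" "g \<midarrow>z\<rightarrow> g z"
    using assms(1,2) by (auto simp: continuous_on_eq_continuous_at isCont_def)
  moreover have "g \<midarrow>z\<rightarrow> f z" by (rule Lim_transform_eventually[OF calculation(1) assms(3)])
  ultimately show ?thesis using LIM_unique by blast
qed

lemma nicely_meromorphic_cosparse_nonzero:
  assumes "f nicely_meromorphic_on UNIV" "\<exists>z. f z \<noteq> 0"
  shows "eventually (\<lambda>w. f w \<noteq> 0) (cosparse UNIV)"
  using nicely_meromorphic_imp_constant_or_avoid[OF assms(1), of 0] assms(2) by auto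

lemma nicely_meromorphic_eventually_nonzero:
  assumes "f nicely_meromorphic_on UNIV" "\<exists>z. f z \<noteq> 0"
  shows "eventually (\<lambda>w. f w \<noteq> 0) (at z)"
  using nicely_meromorphic_cosparse_nonzero[OF assms] by (rule eventually_cosparse_imp_eventually_at) auto

lemma entire_nicely_meromorphic: "f holomorphic_on UNIV \<Longrightarrow> f nicely_meromorphic_on UNIV"
  by (intro analytic_on_imp_nicely_meromorphic_on) (simp add: analytic_on_open)

lemma entire_analytic_at: "f holomorphic_on UNIV \<Longrightarrow> f analytic_on {z}"
  using holomorphic_on_imp_analytic_at by blast

lemma entire_meromorphic: "f holomorphic_on UNIV \<Longrightarrow> f meromorphic_on A"
  by (meson analytic_on_imp_meromorphic_on analytic_on_subset open_UNIV analytic_on_open subset_UNIV)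

lemmas entire_eventually_nonzero = nicely_meromorphic_eventually_nonzero[OF entire_nicely_meromorphic]

lemma entire_zorder_nonneg:
  assumes "f holomorphic_on UNIV" "\<exists>z. f z \<noteq> 0" shows "zorder f z \<ge> 0"
  using entire_eventually_nonzero[OF assms] by (intro zorder_ge_0 entire_analytic_at assms eventually_frequently) auto

lemma entire_zorder_pos_iff:
  assumes "f holomorphic_on UNIV" "\<exists>z. f z \<noteq> 0" shows "zorder f z > 0 \<longleftrightarrow> f z = 0"
  using entire_eventually_nonzero[OF assms] by (intro zorder_pos_iff' entire_analytic_at assms eventually_frequently) auto

lemma finite_zorder_nonzero:
  assumes "f nicely_meromorphic_on UNIV" "\<exists>z. f z \<noteq> 0" "compact K"
  shows "finite {z \<in> K. zorder f z \<noteq> 0}"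
proof -
  have "f meromorphic_on UNIV" using assms(1) by (simp add: nicely_meromorphic_on_def)
  then have "eventually (\<lambda>z. f analytic_on {z}) (cosparse UNIV)" by (rule meromorphic_on_imp_analytic_cosparse)
  with nicely_meromorphic_cosparse_nonzero[OF assms(1,2)]
  have "eventually (\<lambda>z. zorder f z = 0) (cosparse UNIV)"
    by eventually_elim (rule zorder_eq_0I)
  then have "{z. zorder f z \<noteq> 0} sparse_in UNIV" by (simp add: eventually_cosparse)
  then have "{z. zorder f z \<noteq> 0} sparse_in K" by (rule sparse_in_subset) auto
  then have "finite (K \<inter> {z. zorder f z \<noteq> 0})" using assms(3) by (intro sparse_in_compact_finite)
  then show ?thesis by (simp add: Int_def)
qed

text \<open>An order \<open>>= 0\<close> everywhere excludes poles, so all singularities are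
  removable. The extension is related to \<open>F\<close> on punctured neighbourhoods because
  \<open>F\<close> may take arbitrary values at isolated points.\<close>

lemma meromorphic_entire_extension:
  assumes F: "F meromorphic_on UNIV" "\<And>z. eventually (\<lambda>w. F w \<noteq> 0) (at z)" "\<And>z. zorder F z \<ge> 0"
  obtains h where "h holomorphic_on UNIV" "\<And>z. eventually (\<lambda>w. h w = F w) (at z)"
     "\<And>z. zorder F z = 0 \<Longrightarrow> h z \<noteq> 0"
proof -
  define h where "h = remove_sings F"
  have F1: "isolated_singularity_at F z" "not_essential F z" for z
    using F(1) by (auto intro: meromorphic_on_isolated_singularity meromorphic_on_not_essential meromorphic_on_subset)
  have eq: "eventually (\<lambda>w. h w = F w) (at z)" for z
    unfolding h_def by (rule eventually_remove_sings_eq_at[OF F1(1)])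
  have np: "\<not> is_pole F z" for z
    using isolated_pole_imp_neg_zorder[of F z] F1(1)[of z] F(3)[of z] by auto
  have npole: "\<not> is_pole h z" for z using np[of z] is_pole_cong[OF eq refl] by blast
  have an: "h analytic_on {z}" for z
    by (rule nicely_meromorphic_on_imp_analytic_at[OF _ UNIV_I npole]) (simp add: h_def remove_sings_nicely_meromorphic F(1))
  show ?thesis
  proof (rule that[of h])
    show "h holomorphic_on UNIV" using an by (auto simp: analytic_on_analytic_at[of h UNIV] analytic_imp_holomorphic)
    show "eventually (\<lambda>w. h w = F w) (at z)" for z by (rule eq)
    fix z assume "zorder F z = 0"
    then have "zorder h z = 0" using zorder_cong[OF eq refl, of z] by simp
    moreover have "eventually (\<lambda>w. h w \<noteq> 0) (at z)" using eq[of z] F(2)[of z] by eventually_elim auto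
    ultimately show "h z \<noteq> 0" using an[of z] by (subst zorder_eq_0_iff[symmetric]) (auto intro: eventually_frequently)
  qed
qed

lemma zorder_linear_power: "zorder (\<lambda>w. (w - a) ^ n) z = (if z = a then int n else 0)"
proof (cases "z = a")
  case True
  then show ?thesis by (auto intro!: zorder_eqI[of UNIV _ "\<lambda>_. 1"])
next
  case False
  then show ?thesis by (auto intro!: zorder_eq_0I analytic_intros)
qed

text \<open>Only the zeros in the finite set \<open>Z\<close> are removed: the quotient by a
  polynomial has order 0 on \<open>Z\<close> and keeps the order of \<open>g\<close>
  elsewhere.\<close>

lemma entire_divide_zeros:
  assumes g: "g holomorphic_on UNIV" "\<exists>z. g z \<noteq> 0" and Z: "finite Z"
  obtains h where "h holomorphic_on UNIV" "\<And>z. g z = h z * (\<Prod>a\<in>Z. (z - a) ^ nat (zorder g a))"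
     "\<And>z. z \<in> Z \<Longrightarrow> h z \<noteq> 0"
proof -
  define P where "P z = (\<Prod>a\<in>Z. (z - a) ^ nat (zorder g a))" for z
  have holP: "P holomorphic_on UNIV" unfolding P_def by (intro holomorphic_intros)
  obtain w where "w \<notin> Z" using Z ex_new_if_finite[OF infinite_UNIV_char_0] by metis
  then have nzP: "\<exists>z. P z \<noteq> 0" using Z by (intro exI[of _ w]) (auto simp: P_def)
  have zP: "zorder P z = (if z \<in> Z then zorder g z else 0)" for z
  proof -
    have "zorder P z = (\<Sum>a\<in>Z. zorder (\<lambda>z. (z - a) ^ nat (zorder g a)) z)"
      unfolding P_def by (rule zorder_prod_analytic)
       (use entire_eventually_nonzero[OF holP nzP] in \<open>auto simp: P_def intro!: analytic_intros\<close>)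
    also have "\<dots> = (\<Sum>a\<in>Z. if z = a then zorder g a else 0)"
      using entire_zorder_nonneg[OF g] by (intro sum.cong) (auto simp: zorder_linear_power)
    also have "\<dots> = (if z \<in> Z then zorder g z else 0)" using Z by (simp add: sum.delta')
    finally show ?thesis .
  qed
  define F where "F z = g z / P z" for z
  have zF: "zorder F z = zorder g z - zorder P z" for z
    unfolding F_def using entire_eventually_nonzero[OF holP nzP] entire_eventually_nonzero[OF g]
    by (intro zorder_divide entire_meromorphic g holP eventually_frequently) auto
  obtain h where h: "h holomorphic_on UNIV" "\<And>z. eventually (\<lambda>w. h w = F w) (at z)"
     "\<And>z. zorder F z = 0 \<Longrightarrow> h z \<noteq> 0"
  proof (rule meromorphic_entire_extension[of F])
    show "F meromorphic_on UNIV" unfolding F_def by (intro meromorphic_intros entire_meromorphic g holP)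
    show "eventually (\<lambda>w. F w \<noteq> 0) (at z)" for z
      using entire_eventually_nonzero[OF holP nzP, of z] entire_eventually_nonzero[OF g, of z]
      by eventually_elim (simp add: F_def)
    show "zorder F z \<ge> 0" for z using zF[of z] zP[of z] entire_zorder_nonneg[OF g, of z] by auto
  qed blast
  show ?thesis
  proof (rule that[OF h(1)])
    show "g z = h z * (\<Prod>a\<in>Z. (z - a) ^ nat (zorder g a))" for z
      unfolding P_def[symmetric]
    proof (rule eventually_eq_at_imp_eq[of g "\<lambda>z. h z * P z"])
      show "continuous_on UNIV g" "continuous_on UNIV (\<lambda>z. h z * P z)"
        by (intro holomorphic_on_imp_continuous_on holomorphic_intros g h holP)+
      show "eventually (\<lambda>w. g w = h w * P w) (at z)"
        using h(2)[of z] entire_eventually_nonzero[OF holP nzP, of z] by eventually_elim (simp add: F_def)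
    qed
    show "h z \<noteq> 0" if "z \<in> Z" for z using that zF[of z] zP[of z] by (intro h(3)) simp
  qed
qed

text \<open>
  Dividing by Blaschke factors of the disc of radius \<open>2 r\<close> removes the zeros in the disc of radius
  \<open>r\<close> without increasing the maximum modulus, and each of them doubles the value at 0.
\<close>

lemma blaschke_division:
  assumes g: "g holomorphic_on UNIV" "g 0 \<noteq> 0" and r: "r > 0"
    and M: "\<And>z. norm z \<le> 2 * r \<Longrightarrow> norm (g z) \<le> M"
    and Z: "finite Z" "Z \<subseteq> cball 0 r" "\<And>z. norm z \<le> r \<Longrightarrow> g z = 0 \<Longrightarrow> z \<in> Z"
  obtains h where "h holomorphic_on UNIV" "\<And>z. norm z \<le> r \<Longrightarrow> h z \<noteq> 0"
     "\<And>z. norm z \<le> 2 * r \<Longrightarrow> norm (h z) \<le> M"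
     "norm (h 0) \<ge> 2 ^ (\<Sum>a\<in>Z. nat (zorder g a)) * norm (g 0)"
     "\<And>z. h z * (\<Prod>a\<in>Z. (of_real (2 * r) * (z - a)) ^ nat (zorder g a)) =
        g z * (\<Prod>a\<in>Z. ((of_real (2 * r))\<^sup>2 - cnj a * z) ^ nat (zorder g a))"
proof -
  define R where "R = 2 * r"
  have R: "R > 0" using r by (simp add: R_def)
  define n where "n a = nat (zorder g a)" for a
  obtain g0 where g0: "g0 holomorphic_on UNIV" "\<And>z. g z = g0 z * (\<Prod>a\<in>Z. (z - a) ^ n a)"
     "\<And>z. z \<in> Z \<Longrightarrow> g0 z \<noteq> 0"
    by (rule entire_divide_zeros[OF g(1) _ Z(1)]) (use g(2) in \<open>auto simp: n_def\<close>)
  \<comment> \<open>Each factor \<open>z - a\<close> of \<open>g\<close> is replaced by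
    \<open>(R^2 - cnj a * z) / R\<close>, which has the same modulus on the circle of radius
    \<open>R\<close> and no zero with \<open>norm z <= r\<close>.\<close>
  define h where "h z = g0 z * (\<Prod>a\<in>Z. (((of_real R)\<^sup>2 - cnj a * z) / of_real R) ^ n a)" for z
  have holh: "h holomorphic_on UNIV" unfolding h_def by (intro holomorphic_intros g0) (use R in auto)
  have g0nz: "g0 z \<noteq> 0" if "norm z \<le> r" for z
    using g0(2)[of z] g0(3)[of z] Z(3)[of z] that by fastforce
  have mod: "norm (((of_real R)\<^sup>2 - cnj a * z) / of_real R) = norm (z - a)" if "norm z = R" for z a
  proof -
    have "(of_real R)\<^sup>2 = cnj z * z" using that by (simp add: complex_norm_square[symmetric] mult.commute)
    then have "(of_real R)\<^sup>2 - cnj a * z = cnj (z - a) * z" by (simp add: algebra_simps)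
    then have "norm ((of_real R)\<^sup>2 - cnj a * z) = norm (z - a) * R" using that by (simp only: norm_mult complex_mod_cnj)
    then show ?thesis using R by (simp add: norm_divide)
  qed
  have bnd: "norm (h z) \<le> M" if "norm z \<le> R" for z
  proof (rule maximum_modulus_frontier[of h "cball 0 R"])
    show "h holomorphic_on interior (cball 0 R)" using holh holomorphic_on_subset by blast
    show "continuous_on (closure (cball 0 R)) h" using holomorphic_on_imp_continuous_on[OF holh] continuous_on_subset by blast
    fix z assume "z \<in> frontier (cball 0 R :: complex set)"
    then have z: "norm z = R" by (simp add: frontier_cball)
    have "norm (h z) = norm (g z)"
      by (simp only: h_def g0(2) norm_mult prod_norm[symmetric] norm_power mod[OF z])
    then show "norm (h z) \<le> M" using M[of z] z by (simp add: R_def)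
  qed (use that in auto)
  have nz: "h z \<noteq> 0" if z: "norm z \<le> r" for z
  proof -
    have "(of_real R)\<^sup>2 - cnj a * z \<noteq> 0" if "a \<in> Z" for a
    proof
      assume "(of_real R)\<^sup>2 - cnj a * z = 0"
      then have "norm ((of_real R :: complex)\<^sup>2) = norm (cnj a * z)" by simp
      then have "R\<^sup>2 = norm a * norm z" by (simp add: norm_mult norm_power)
      also have "\<dots> \<le> r * r" using Z(2) that z r by (intro mult_mono) auto
      finally show False using r by (simp add: R_def power2_eq_square)
    qed
    then show ?thesis using g0nz[OF z] R Z(1) by (simp add: h_def)
  qed
  have h0: "norm (h 0) \<ge> 2 ^ (\<Sum>a\<in>Z. n a) * norm (g 0)"
  proof -
    \<comment> \<open>At 0 each factor \<open>norm a\<close> is replaced by \<open>R\<close>, and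
      \<open>norm a <= r = R / 2\<close>.\<close>
    have "norm (g 0) * 2 ^ (\<Sum>a\<in>Z. n a) = norm (g0 0) * (\<Prod>a\<in>Z. (2 * norm a) ^ n a)"
      unfolding g0(2)[of 0] power_sum
      by (simp add: norm_mult norm_power prod_norm[symmetric] prod.distrib[symmetric] power_mult_distrib mult_ac)
    also have "\<dots> \<le> norm (g0 0) * (\<Prod>a\<in>Z. R ^ n a)"
      using Z(2) by (intro mult_left_mono prod_mono conjI power_mono) (auto simp: R_def)
    also have "\<dots> = norm (h 0)"
      using R by (simp add: h_def norm_mult norm_power prod_norm[symmetric] power2_eq_square)
    finally show ?thesis by (simp add: mult.commute)
  qed
  \<comment> \<open>Stated without quotients, so that it holds at the points of \<open>Z\<close> as
    well.\<close>
  have "h z * (\<Prod>a\<in>Z. (of_real R * (z - a)) ^ n a) = g z * (\<Prod>a\<in>Z. ((of_real R)\<^sup>2 - cnj a * z) ^ n a)" for z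
  proof -
    have "(\<Prod>a\<in>Z. (((of_real R)\<^sup>2 - cnj a * z) / of_real R) ^ n a) * (\<Prod>a\<in>Z. (of_real R * (z - a)) ^ n a)
       = (\<Prod>a\<in>Z. ((of_real R)\<^sup>2 - cnj a * z) ^ n a) * (\<Prod>a\<in>Z. (z - a) ^ n a)"
      unfolding prod.distrib[symmetric] power_mult_distrib[symmetric]
      by (intro prod.cong refl arg_cong2[where f = "(^)"]) (use R in simp)
    then show ?thesis by (simp add: h_def g0(2)[of z] mult_ac)
  qed
  then show ?thesis using holh nz bnd h0 by (intro that[of h]) (auto simp: R_def n_def)
qed

text \<open>The values of \<open>\<beta>\<close> lie in the half-plane \<open>Re < M\<close>, whose
  points are nearer to 0 than to \<open>2 M\<close>. The quotient
  \<open>\<beta> / (2 M - \<beta>)\<close> therefore maps the unit disc into itself and fixes 0; the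
  Schwarz lemma bounds it by \<open>norm w <= 1 / 2\<close>, and solving for \<open>\<beta>\<close>
  gives \<open>2 M\<close>.\<close>

lemma borel_caratheodory:
  assumes \<alpha>: "\<alpha> holomorphic_on ball 0 r" and r: "r > 0"
    and M: "\<And>z. norm z < r \<Longrightarrow> Re (\<alpha> z - \<alpha> 0) < M" and z: "norm z \<le> r / 2"
  shows "norm (\<alpha> z - \<alpha> 0) \<le> 2 * M"
proof -
  have M0: "M > 0" using M[of 0] r by simp
  define \<beta> where "\<beta> z = \<alpha> (of_real r * z) - \<alpha> 0" for z
  have in_ball: "of_real r * w \<in> ball 0 r" if "norm w < 1" for w :: complex
    using that r by (simp add: norm_mult)
  have hol\<beta>: "\<beta> holomorphic_on ball 0 1"
  proof -
    have "(\<alpha> \<circ> (\<lambda>w. of_real r * w)) holomorphic_on ball 0 1"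
      by (rule holomorphic_on_compose_gen[OF _ \<alpha>]) (use in_ball in \<open>auto intro!: holomorphic_intros\<close>)
    then show ?thesis unfolding \<beta>_def o_def by (intro holomorphic_intros)
  qed
  have Re\<beta>: "Re (\<beta> w) < M" if "norm w < 1" for w
    using M[of "of_real r * w"] in_ball[OF that] by (simp add: \<beta>_def)
  have nz: "of_real (2 * M) - \<beta> w \<noteq> 0" if "norm w < 1" for w
  proof
    assume "of_real (2 * M) - \<beta> w = 0"
    then have "\<beta> w = of_real (2 * M)" by simp
    then show False using Re\<beta>[OF that] M0 by simp
  qed
  have lt: "norm (\<beta> w) < norm (of_real (2 * M) - \<beta> w)" if "norm w < 1" for w
  proof -
    have "(norm (of_real (2 * M) - \<beta> w))\<^sup>2 = (2 * M - Re (\<beta> w))\<^sup>2 + (Im (\<beta> w))\<^sup>2"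
       "(norm (\<beta> w))\<^sup>2 = (Re (\<beta> w))\<^sup>2 + (Im (\<beta> w))\<^sup>2"
      by (simp_all add: cmod_power2)
    then have "(norm (of_real (2 * M) - \<beta> w))\<^sup>2 - (norm (\<beta> w))\<^sup>2 = 4 * M * (M - Re (\<beta> w))"
      by (simp only:) (simp add: power2_eq_square algebra_simps)
    also have "\<dots> > 0" using M0 Re\<beta>[OF that] by simp
    finally show ?thesis by (simp add: power_less_imp_less_base)
  qed
  define w where "w = z / of_real r"
  have w: "norm w \<le> 1 / 2" using z r by (simp add: w_def norm_divide field_simps)
  have "norm (\<beta> w / (of_real (2 * M) - \<beta> w)) \<le> norm w"
  proof (rule Schwarz_Lemma(1)[of "\<lambda>w. \<beta> w / (of_real (2 * M) - \<beta> w)"])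
    show "(\<lambda>w. \<beta> w / (of_real (2 * M) - \<beta> w)) holomorphic_on ball 0 1"
      by (intro holomorphic_intros hol\<beta>) (use nz in auto)
    show "norm (\<beta> w / (of_real (2 * M) - \<beta> w)) < 1" if "norm w < 1" for w
    proof -
      have "0 < norm (of_real (2 * M) - \<beta> w)" using nz[OF that] by simp
      then show ?thesis using lt[OF that] by (simp only: norm_divide divide_less_eq_1_pos)
    qed
  qed (use w in \<open>auto simp: \<beta>_def\<close>)
  also note w
  finally have "norm (\<beta> w) \<le> 1 / 2 * norm (of_real (2 * M) - \<beta> w)"
    using nz[of w] w by (simp add: norm_divide field_simps)
  also have "norm (of_real (2 * M) - \<beta> w) \<le> 2 * M + norm (\<beta> w)"
    using norm_triangle_ineq4[of "of_real (2 * M)" "\<beta> w"] M0 by simp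
  finally have "norm (\<beta> w) \<le> 2 * M" by simp
  then show ?thesis using r by (simp add: \<beta>_def w_def)
qed

text \<open>The bound near infinity made global: the constant absorbs a compact disc, and the base
  \<open>1 + norm z >= 1\<close> allows exponents to be raised. In this form the condition passes to
  products and translates.\<close>

definition finite_order_growth :: "(complex \<Rightarrow> complex) \<Rightarrow> bool" where
  "finite_order_growth g \<longleftrightarrow> (\<exists>C k. C \<ge> 0 \<and> (\<forall>z. norm (g z) \<le> exp (C * (1 + norm z) ^ k)))"

lemma entire_finite_order_growth:
  assumes "entire_finite_order g" shows "finite_order_growth g"
proof -
  have hol: "g holomorphic_on UNIV" using assms by (simp add: entire_finite_order_def)
  obtain k where "eventually (\<lambda>z. norm (g z) \<le> exp (norm z ^ k)) at_infinity"
    using assms by (auto simp: entire_finite_order_def)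
  then obtain b where b: "\<And>z. norm z \<ge> b \<Longrightarrow> norm (g z) \<le> exp (norm z ^ k)"
    by (auto simp: eventually_at_infinity)
  have "compact (g ` cball 0 b)"
    by (intro compact_continuous_image holomorphic_on_imp_continuous_on holomorphic_on_subset[OF hol]) auto
  then obtain B where B: "B > 0" "\<And>z. norm z \<le> b \<Longrightarrow> norm (g z) \<le> B"
    using compact_imp_bounded bounded_pos by (metis image_eqI mem_cball_0)
  have "norm (g z) \<le> exp ((1 + B) * (1 + norm z) ^ k)" for z
  proof (cases "norm z \<ge> b")
    case True
    have "norm (g z) \<le> exp (norm z ^ k)" using b[OF True] .
    also have "norm z ^ k \<le> (1 + norm z) ^ k" by (intro power_mono) auto
    also have "\<dots> \<le> (1 + B) * (1 + norm z) ^ k"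
      using mult_right_mono[of 1 "1 + B" "(1 + norm z) ^ k"] B(1) by simp
    finally show ?thesis by simp
  next
    case False
    have "norm (g z) \<le> B" using False by (intro B) simp
    also have "B \<le> exp B" using exp_ge_add_one_self[of B] by linarith
    also have "B \<le> (1 + B) * (1 + norm z) ^ k"
      using B one_le_power[of "1 + norm z" k] mult_mono[of B "1 + B" 1 "(1 + norm z) ^ k"] by simp
    finally show ?thesis by simp
  qed
  then show ?thesis using B unfolding finite_order_growth_def by (intro exI[of _ "1 + B"] exI[of _ k]) auto
qed

lemma finite_order_growth_mult:
  assumes "finite_order_growth f" "finite_order_growth g" shows "finite_order_growth (\<lambda>z. f z * g z)"
proof -
  obtain C k where 1: "C \<ge> 0" "\<And>z. norm (f z) \<le> exp (C * (1 + norm z) ^ k)" using assms(1) by (auto simp: finite_order_growth_def)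
  obtain D l where 2: "D \<ge> 0" "\<And>z. norm (g z) \<le> exp (D * (1 + norm z) ^ l)" using assms(2) by (auto simp: finite_order_growth_def)
  have "norm (f z * g z) \<le> exp ((C + D) * (1 + norm z) ^ (k + l))" for z
  proof -
    have "norm (f z * g z) \<le> exp (C * (1 + norm z) ^ k) * exp (D * (1 + norm z) ^ l)"
      using 1 2 by (simp add: norm_mult mult_mono)
    also have "\<dots> = exp (C * (1 + norm z) ^ k + D * (1 + norm z) ^ l)" by (simp add: exp_add)
    also have "\<dots> \<le> exp (C * (1 + norm z) ^ (k + l) + D * (1 + norm z) ^ (k + l))"
      using 1 2 by (intro exp_le_cancel_iff[THEN iffD2] add_mono mult_left_mono power_increasing) auto
    finally show ?thesis by (simp add: algebra_simps)
  qed
  then show ?thesis using 1 2 unfolding finite_order_growth_def by (intro exI[of _ "C + D"] exI[of _ "k + l"]) auto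
qed

lemma finite_order_growth_shift:
  assumes "finite_order_growth f" shows "finite_order_growth (\<lambda>z. f (a + z))"
proof -
  obtain C k where 1: "C \<ge> 0" "\<And>z. norm (f z) \<le> exp (C * (1 + norm z) ^ k)" using assms(1) by (auto simp: finite_order_growth_def)
  have "norm (f (a + z)) \<le> exp ((C * (1 + norm a) ^ k) * (1 + norm z) ^ k)" for z
  proof -
    have "norm (f (a + z)) \<le> exp (C * (1 + norm (a + z)) ^ k)" by (rule 1)
    also have "\<dots> \<le> exp (C * ((1 + norm a) * (1 + norm z)) ^ k)"
    proof (intro exp_le_cancel_iff[THEN iffD2] mult_left_mono power_mono)
      have "1 + norm (a + z) \<le> 1 + norm a + norm z" using norm_triangle_ineq[of a z] by simp
      also have "\<dots> \<le> (1 + norm a) * (1 + norm z)" by (simp add: algebra_simps)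
      finally show "1 + norm (a + z) \<le> (1 + norm a) * (1 + norm z)" .
    qed (use 1 in auto)
    finally show ?thesis by (simp add: power_mult_distrib mult_ac)
  qed
  then show ?thesis using 1 unfolding finite_order_growth_def
    by (intro exI[of _ "C * (1 + norm a) ^ k"] exI[of _ "k"]) auto
qed

lemma entire_shift:
  assumes "F holomorphic_on UNIV" shows "(\<lambda>z. F (a + z)) holomorphic_on UNIV"
proof -
  have "(\<lambda>z. a + z) holomorphic_on UNIV" by (intro holomorphic_intros)
  then have "(F \<circ> (\<lambda>z. a + z)) holomorphic_on UNIV"
    by (rule holomorphic_on_compose) (rule holomorphic_on_subset[OF assms subset_UNIV])
  then show ?thesis by (simp add: o_def)
qed

lemma finite_zeros_cball:
  assumes "f holomorphic_on UNIV" "\<exists>z. f z \<noteq> 0"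
  shows "finite {z. norm z \<le> r \<and> f z = 0}"
proof (rule finite_subset)
  show "finite {z \<in> cball 0 r. zorder f z \<noteq> 0}"
    by (rule finite_zorder_nonzero[OF entire_nicely_meromorphic[OF assms(1)] assms(2)]) simp
  have "zorder f z \<noteq> 0" if "f z = 0" for z using entire_zorder_pos_iff[OF assms, of z] that by simp
  then show "{z. norm z \<le> r \<and> f z = 0} \<subseteq> {z \<in> cball 0 r. zorder f z \<noteq> 0}" by auto
qed

text \<open>\<open>A\<close> and \<open>B\<close> have the same zeros with the same orders, so the
  same factors are divided out of both and the relation with \<open>exp q\<close> persists. On the
  disc of radius \<open>r\<close> both quotients have logarithms, which differ by \<open>q\<close>.
  The division does not decrease the modulus at 0, so the lower bounds
  \<open>ln (norm (A 0))\<close> and \<open>ln (norm (B 0))\<close> do not depend on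
  \<open>r\<close>.\<close>

lemma zero_free_quotient_log_bound:
  assumes A: "A holomorphic_on UNIV" "A 0 \<noteq> 0" and B: "B holomorphic_on UNIV" "B 0 \<noteq> 0" and q: "q holomorphic_on UNIV"
    and AB: "\<And>z. A z = exp (q z) * B z" and r: "r > 0"
    and MA: "\<And>z. norm z \<le> 2 * r \<Longrightarrow> norm (A z) \<le> exp MA" and MB: "\<And>z. norm z \<le> 2 * r \<Longrightarrow> norm (B z) \<le> exp MB"
    and z: "norm z \<le> r / 2"
  shows "norm (q z - q 0) \<le> 2 * (MA - ln (norm (A 0)) + 1) + 2 * (MB - ln (norm (B 0)) + 1)"
proof -
  define Z where "Z = {z. norm z \<le> r \<and> A z = 0}"
  have ex: "\<exists>z. A z \<noteq> 0" "\<exists>z. B z \<noteq> 0" using A B by blast+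
  have ZB: "Z = {z. norm z \<le> r \<and> B z = 0}" unfolding Z_def AB by auto
  have fin: "finite Z" unfolding Z_def by (rule finite_zeros_cball[OF A(1) ex(1)])
  have zo: "zorder A z = zorder B z" for z
  proof -
    have "zorder A z = zorder (\<lambda>z. exp (q z) * B z) z" using AB by presburger
    also have "\<dots> = zorder (\<lambda>z. exp (q z)) z + zorder B z"
      using entire_eventually_nonzero[OF B(1) ex(2), of z]
      by (intro zorder_times_analytic entire_analytic_at holomorphic_intros q B) (auto elim: eventually_mono)
    also have "zorder (\<lambda>z. exp (q z)) z = 0"
      by (intro zorder_eq_0I entire_analytic_at holomorphic_intros q) auto
    finally show ?thesis by simp
  qed
  obtain A1 where A1: "A1 holomorphic_on UNIV" "\<And>z. norm z \<le> r \<Longrightarrow> A1 z \<noteq> 0"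
     "\<And>z. norm z \<le> 2 * r \<Longrightarrow> norm (A1 z) \<le> exp MA"
     "norm (A1 0) \<ge> 2 ^ (\<Sum>a\<in>Z. nat (zorder A a)) * norm (A 0)"
     "\<And>z. A1 z * (\<Prod>a\<in>Z. (of_real (2 * r) * (z - a)) ^ nat (zorder A a)) =
        A z * (\<Prod>a\<in>Z. ((of_real (2 * r))\<^sup>2 - cnj a * z) ^ nat (zorder A a))"
    by (rule blaschke_division[OF A r MA fin]) (auto simp: Z_def)
  obtain B1 where B1: "B1 holomorphic_on UNIV" "\<And>z. norm z \<le> r \<Longrightarrow> B1 z \<noteq> 0"
     "\<And>z. norm z \<le> 2 * r \<Longrightarrow> norm (B1 z) \<le> exp MB"
     "norm (B1 0) \<ge> 2 ^ (\<Sum>a\<in>Z. nat (zorder B a)) * norm (B 0)"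
     "\<And>z. B1 z * (\<Prod>a\<in>Z. (of_real (2 * r) * (z - a)) ^ nat (zorder B a)) =
        B z * (\<Prod>a\<in>Z. ((of_real (2 * r))\<^sup>2 - cnj a * z) ^ nat (zorder B a))"
    by (rule blaschke_division[OF B r MB fin]) (auto simp: ZB)
  have A1B1: "A1 z = exp (q z) * B1 z" for z
  proof (rule eventually_eq_at_imp_eq[of A1 "\<lambda>z. exp (q z) * B1 z"])
    show "continuous_on UNIV A1" "continuous_on UNIV (\<lambda>z. exp (q z) * B1 z)"
      by (intro holomorphic_on_imp_continuous_on holomorphic_intros A1 B1 q)+
    define P where "P z = (\<Prod>a\<in>Z. (of_real (2 * r) * (z - a)) ^ nat (zorder B a))" for z
    have "A1 w = exp (q w) * B1 w" if "P w \<noteq> 0" for w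
    proof -
      have "A1 w * P w = exp (q w) * (B1 w * P w)"
        unfolding P_def B1(5) using A1(5)[of w] by (simp add: zo AB[of w] mult.assoc)
      then show ?thesis using that by (simp add: mult.assoc[symmetric])
    qed
    moreover have "eventually (\<lambda>w. P w \<noteq> 0) (at z)"
    proof -
      obtain w where "w \<notin> Z" using fin ex_new_if_finite[OF infinite_UNIV_char_0] by metis
      then have "\<exists>z. P z \<noteq> 0" using fin r by (intro exI[of _ w]) (auto simp: P_def)
      then show ?thesis by (intro entire_eventually_nonzero) (auto simp: P_def intro!: holomorphic_intros)
    qed
    ultimately show "eventually (\<lambda>w. A1 w = exp (q w) * B1 w) (at z)" by (auto elim: eventually_mono)
  qed
  obtain \<beta> where \<beta>: "\<beta> holomorphic_on ball 0 r" "\<And>z. z \<in> ball 0 r \<Longrightarrow> exp (\<beta> z) = B1 z"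
    by (rule holomorphic_logarithm_exists[of "ball 0 r" B1 0]) (use B1 r holomorphic_on_subset in auto)
  define \<alpha> where "\<alpha> z = q z + \<beta> z" for z
  have \<alpha>: "\<alpha> holomorphic_on ball 0 r" "\<And>z. z \<in> ball 0 r \<Longrightarrow> exp (\<alpha> z) = A1 z"
    unfolding \<alpha>_def using holomorphic_on_subset[OF q] \<beta> by (auto intro!: holomorphic_intros simp: A1B1 exp_add)
  \<comment> \<open>Common estimate for the logarithms \<open>\<alpha>\<close> of \<open>A1\<close>
    and \<open>\<beta>\<close> of \<open>B1\<close>: \<open>M\<close> bounds the real part from
    above, \<open>G0\<close> bounds it from below at 0, and the summand 1 makes the inequality
    strict.\<close>
  have key: "norm (\<gamma> z - \<gamma> 0) \<le> 2 * (M - ln (norm G0) + 1)"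
    if \<gamma>: "\<gamma> holomorphic_on ball 0 r" "\<And>z. z \<in> ball 0 r \<Longrightarrow> exp (\<gamma> z) = G z"
      and G: "\<And>z. norm z \<le> 2 * r \<Longrightarrow> norm (G z) \<le> exp M" "norm (G 0) \<ge> 2 ^ n * norm G0" "G0 \<noteq> 0"
    for \<gamma> G M n G0
  proof (rule borel_caratheodory[OF \<gamma>(1) r _ z])
    fix z :: complex assume z: "norm z < r"
    have "exp (Re (\<gamma> z)) \<le> exp M" using \<gamma>(2)[of z] G(1)[of z] z r by (simp flip: norm_exp_eq_Re)
    moreover have "exp (ln (norm G0)) \<le> exp (Re (\<gamma> 0))"
    proof -
      have "norm G0 \<le> 2 ^ n * norm G0" using mult_right_mono[of 1 "2 ^ n" "norm G0"] by simp
      also have "\<dots> \<le> exp (Re (\<gamma> 0))" using G(2) \<gamma>(2)[of 0] r by (simp flip: norm_exp_eq_Re)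
      finally show ?thesis using G(3) by simp
    qed
    ultimately show "Re (\<gamma> z - \<gamma> 0) < M - ln (norm G0) + 1" by simp
  qed
  have "q z - q 0 = (\<alpha> z - \<alpha> 0) - (\<beta> z - \<beta> 0)" by (simp add: \<alpha>_def)
  then have "norm (q z - q 0) \<le> norm (\<alpha> z - \<alpha> 0) + norm (\<beta> z - \<beta> 0)" by (simp only: norm_triangle_ineq4)
  also have "\<dots> \<le> 2 * (MA - ln (norm (A 0)) + 1) + 2 * (MB - ln (norm (B 0)) + 1)"
    using A(2) B(2) by (intro add_mono key[OF \<alpha> A1(3,4)] key[OF \<beta> B1(3,4)])
  finally show ?thesis .
qed

lemma zero_free_quotient_exp_poly_at_0:
  assumes A: "A holomorphic_on UNIV" "finite_order_growth A" "A 0 \<noteq> 0"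
    and B: "B holomorphic_on UNIV" "finite_order_growth B" "B 0 \<noteq> 0" and q: "q holomorphic_on UNIV"
    and AB: "\<And>z. A z = exp (q z) * B z"
  shows "\<exists>Q. \<forall>z. q z = poly Q z"
proof -
  obtain C k where C: "C \<ge> 0" "\<And>z. norm (A z) \<le> exp (C * (1 + norm z) ^ k)" using A(2) by (auto simp: finite_order_growth_def)
  obtain D l where D: "D \<ge> 0" "\<And>z. norm (B z) \<le> exp (D * (1 + norm z) ^ l)" using B(2) by (auto simp: finite_order_growth_def)
  define c where "c = 2 * (\<bar>ln (norm (A 0))\<bar> + 1) + 2 * (\<bar>ln (norm (B 0))\<bar> + 1)"
  \<comment> \<open>The disc used for \<open>z\<close> has radius \<open>2 * norm z\<close>, so the
    maxima are taken over \<open>norm w <= 4 * norm z\<close>, and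
    \<open>1 + 4 * norm z <= 5 * norm z\<close> for \<open>norm z >= 1\<close>.\<close>
  define K where "K = (2 * C + 2 * D) * 5 ^ (k + l) + c"
  have bnd: "norm (q z - q 0) \<le> K * norm z ^ (k + l)" if z: "1 \<le> norm z" for z
  proof -
    define X where "X = (1 + 4 * norm z) ^ (k + l)"
    have X: "(1 + norm w) ^ k \<le> X" "(1 + norm w) ^ l \<le> X" if "norm w \<le> 2 * (2 * norm z)" for w :: complex
    proof -
      have "(1 + norm w) ^ j \<le> (1 + 4 * norm z) ^ (k + l)" if "j \<le> k + l" for j
      proof -
        have "(1 + norm w) ^ j \<le> (1 + 4 * norm z) ^ j" using \<open>norm w \<le> _\<close> by (intro power_mono) auto
        also have "\<dots> \<le> (1 + 4 * norm z) ^ (k + l)" using that by (intro power_increasing) auto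
        finally show ?thesis .
      qed
      then show "(1 + norm w) ^ k \<le> X" "(1 + norm w) ^ l \<le> X" by (auto simp: X_def)
    qed
    have "norm (q z - q 0) \<le> 2 * (C * X - ln (norm (A 0)) + 1) + 2 * (D * X - ln (norm (B 0)) + 1)"
    proof (rule zero_free_quotient_log_bound[OF A(1,3) B(1,3) q AB, of "2 * norm z"])
      fix w :: complex assume w: "norm w \<le> 2 * (2 * norm z)"
      have "C * (1 + norm w) ^ k \<le> C * X" using X(1)[OF w] C(1) by (intro mult_left_mono)
      then show "norm (A w) \<le> exp (C * X)" using C(2)[of w] by (meson exp_le_cancel_iff order_trans)
      have "D * (1 + norm w) ^ l \<le> D * X" using X(2)[OF w] D(1) by (intro mult_left_mono)
      then show "norm (B w) \<le> exp (D * X)" using D(2)[of w] by (meson exp_le_cancel_iff order_trans)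
    qed (use z in auto)
    also have "\<dots> \<le> (2 * C + 2 * D) * X + c" by (simp add: c_def algebra_simps)
    also have "\<dots> \<le> (2 * C + 2 * D) * (5 ^ (k + l) * norm z ^ (k + l)) + c * norm z ^ (k + l)"
    proof (intro add_mono mult_left_mono)
      have "X \<le> (5 * norm z) ^ (k + l)" unfolding X_def using z by (intro power_mono) auto
      then show "X \<le> 5 ^ (k + l) * norm z ^ (k + l)" by (simp add: power_mult_distrib)
      show "c \<le> c * norm z ^ (k + l)" using mult_left_mono[OF one_le_power[OF z, of "k + l"], of c] by (simp add: c_def)
    qed (use C D in auto)
    also have "\<dots> = K * norm z ^ (k + l)" by (simp add: K_def algebra_simps)
    finally show ?thesis .
  qed
  define Q0 where "Q0 z = q z - q 0" for z
  have "Q0 z = (\<Sum>j\<le>k+l. (deriv ^^ j) Q0 0 / fact j * z ^ j)" for z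
    by (rule Liouville_polynomial[of _ 1 K]) (use bnd q in \<open>auto simp: Q0_def intro!: holomorphic_intros\<close>)
  then have "q z - q 0 = (\<Sum>j\<le>k+l. (deriv ^^ j) Q0 0 / fact j * z ^ j)" for z by (simp only: Q0_def)
  then have qz: "q z = q 0 + (\<Sum>j\<le>k+l. (deriv ^^ j) Q0 0 / fact j * z ^ j)" for z
    by (subst (asm) diff_eq_eq) (rule trans[OF _ add.commute])
  have pz: "poly ([:q 0:] + (\<Sum>j\<le>k+l. monom ((deriv ^^ j) Q0 0 / fact j) j)) z =
     q 0 + (\<Sum>j\<le>k+l. (deriv ^^ j) Q0 0 / fact j * z ^ j)" for z
    by (simp add: poly_sum poly_monom)
  have "\<forall>z. q z = poly ([:q 0:] + (\<Sum>j\<le>k+l. monom ((deriv ^^ j) Q0 0 / fact j) j)) z"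
    by (intro allI trans[OF qz pz[symmetric]])
  then show ?thesis by blast
qed

text \<open>The logarithmic estimate asks for \<open>A\<close> and \<open>B\<close> to be nonzero at
  the centre. Translating to a point where \<open>A\<close> does not vanish arranges this, as
  \<open>B\<close> does not vanish there either.\<close>

lemma zero_free_quotient_exp_poly:
  assumes A: "A holomorphic_on UNIV" "finite_order_growth A" "\<exists>z. A z \<noteq> 0"
    and B: "B holomorphic_on UNIV" "finite_order_growth B" and u: "u holomorphic_on UNIV" "\<And>z. u z \<noteq> 0"
    and AB: "\<And>z. A z = u z * B z"
  obtains Q where "\<And>z. u z = exp (poly Q z)"
proof -
  obtain q where q: "q holomorphic_on UNIV" "\<And>z. exp (q z) = u z"
    by (rule holomorphic_logarithm_exists[of UNIV u 0]) (use u in auto)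
  obtain a where a: "A a \<noteq> 0" using A(3) by blast
  have "\<exists>Q. \<forall>z. q (a + z) = poly Q z"
  proof (rule zero_free_quotient_exp_poly_at_0)
    show "A (a + z) = exp (q (a + z)) * B (a + z)" for z by (simp add: q AB)
    show "A (a + 0) \<noteq> 0" "B (a + 0) \<noteq> 0" using a AB[of a] by auto
  qed (intro entire_shift finite_order_growth_shift A B q)+
  then obtain Q where Q: "\<And>z. q (a + z) = poly Q z" by blast
  have "u z = exp (poly (pcompose Q [:-a, 1:]) z)" for z
    using Q[of "z - a"] q(2)[of z] by (simp add: poly_pcompose)
  then show ?thesis by (rule that)
qed

text \<open>A substitute for Jensen's formula: dividing out \<open>N\<close> zeros multiplies the
  modulus at 0 by at least \<open>2 ^ N\<close> while the bound on the doubled disc is kept. Hence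
  \<open>N ln 2\<close> is at most the logarithm of that bound, up to a constant.\<close>

lemma zero_counting:
  assumes g: "g holomorphic_on UNIV" "finite_order_growth g" "\<exists>z. g z \<noteq> 0"
  obtains C k where "C \<ge> 0" "\<And>r A. r \<ge> 0 \<Longrightarrow> finite A \<Longrightarrow> A \<subseteq> cball 0 r \<Longrightarrow> (\<Sum>a\<in>A. real_of_int (zorder g a)) \<le> C * (1 + r) ^ k"
proof -
  obtain w where w: "g w \<noteq> 0" using g(3) by blast
  define h where "h z = g (w + z)" for z
  have holh: "h holomorphic_on UNIV"
    unfolding h_def[abs_def] by (rule entire_shift[OF g(1)])
  have "finite_order_growth h" unfolding h_def[abs_def] by (rule finite_order_growth_shift[OF g(2)])
  then obtain C k where C: "C \<ge> 0" "\<And>z. norm (h z) \<le> exp (C * (1 + norm z) ^ k)" by (auto simp: finite_order_growth_def)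
  have h0: "h 0 \<noteq> 0" using w by (simp add: h_def)
  have ex: "\<exists>z. h z \<noteq> 0" using h0 by blast
  have zo: "zorder g a = zorder h (a - w)" for a
    using zorder_shift[of g a] zorder_shift[of h "a - w"] by (simp add: h_def algebra_simps)
  \<comment> \<open>After the translation by \<open>w\<close> the disc of radius \<open>r\<close>
    about 0 lies in the one of radius \<open>r + norm w\<close>; the extra 1 makes the radius
    positive.\<close>
  define c where "c = 1 + norm w"
  define L where "L = \<bar>ln (norm (h 0))\<bar>"
  \<comment> \<open>The first summand comes from
    \<open>1 + 2 r' <= (3 + 2 norm w) (1 + r)\<close>.\<close>
  define K where "K = (C * (3 + 2 * norm w) ^ k + L) / ln 2"
  have "(\<Sum>a\<in>A. real_of_int (zorder g a)) \<le> K * (1 + r) ^ k" if r: "r \<ge> 0" and A: "finite A" "A \<subseteq> cball 0 r" for r A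
  proof -
    define r' where "r' = r + c"
    have r': "r' > 0" using r norm_ge_zero[of w] unfolding r'_def c_def by linarith
    define Z where "Z = {z. norm z \<le> r' \<and> h z = 0}"
    have fin: "finite Z" unfolding Z_def by (rule finite_zeros_cball[OF holh ex])
    define M where "M = C * (1 + 2 * r') ^ k"
    have M: "norm (h z) \<le> exp M" if "norm z \<le> 2 * r'" for z
    proof -
      have "C * (1 + norm z) ^ k \<le> M" unfolding M_def using C that by (intro mult_left_mono power_mono) auto
      then show ?thesis using C(2)[of z] by (meson exp_le_cancel_iff order_trans)
    qed
    define N where "N = (\<Sum>a\<in>Z. nat (zorder h a))"
    obtain h1 :: "complex \<Rightarrow> complex" where h1: "norm (h1 0) \<ge> 2 ^ N * norm (h 0)" "\<And>z. norm z \<le> 2 * r' \<Longrightarrow> norm (h1 z) \<le> exp M"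
      unfolding N_def by (rule blaschke_division[OF holh h0 r' M fin]) (auto simp: Z_def)
    have "2 ^ N * norm (h 0) \<le> exp M" using h1(1) h1(2)[of 0] r' by simp
    then have "ln (2 ^ N * norm (h 0)) \<le> ln (exp M)" using h0 by (subst ln_le_cancel_iff) auto
    then have "real N * ln 2 \<le> M + L" using h0 by (simp add: ln_mult ln_realpow L_def)
    also have "\<dots> \<le> C * ((3 + 2 * norm w) * (1 + r)) ^ k + L * (1 + r) ^ k"
    proof (intro add_mono)
      show "M \<le> C * ((3 + 2 * norm w) * (1 + r)) ^ k" unfolding M_def
        using C r by (intro mult_left_mono power_mono) (auto simp: r'_def c_def algebra_simps)
      show "L \<le> L * (1 + r) ^ k" using mult_left_mono[of 1 "(1 + r) ^ k" L] r by (simp add: L_def)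
    qed
    also have "\<dots> = (C * (3 + 2 * norm w) ^ k + L) * (1 + r) ^ k"
      by (simp only: power_mult_distrib distrib_right[of _ _ "(1 + r) ^ k"] mult.assoc)
    also have "C * (3 + 2 * norm w) ^ k + L = K * ln 2" by (simp add: K_def)
    also have "K * ln 2 * (1 + r) ^ k = K * (1 + r) ^ k * ln 2" by (simp only: mult_ac)
    finally have N: "real N \<le> K * (1 + r) ^ k" by simp
    have zpos: "real_of_int (zorder h a) = real (nat (zorder h a))" for a using entire_zorder_nonneg[OF holh ex, of a] by simp
    have "(\<Sum>a\<in>A. real_of_int (zorder g a)) = (\<Sum>b\<in>(\<lambda>a. a - w) ` A. real (nat (zorder h b)))"
      by (subst sum.reindex) (auto simp: inj_on_def zo zpos)
    also have "\<dots> = (\<Sum>b\<in>(\<lambda>a. a - w) ` A \<inter> Z. real (nat (zorder h b)))"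
    proof (rule sum.mono_neutral_right)
      show "\<forall>i\<in>(\<lambda>a. a - w) ` A - (\<lambda>a. a - w) ` A \<inter> Z. real (nat (zorder h i)) = 0"
      proof
        fix b assume b: "b \<in> (\<lambda>a. a - w) ` A - (\<lambda>a. a - w) ` A \<inter> Z"
        then obtain a where "a \<in> A" "b = a - w" by blast
        then have "norm b \<le> r'" using A(2) norm_triangle_ineq4[of a w] by (auto simp: r'_def c_def)
        then have "h b \<noteq> 0" using b by (auto simp: Z_def)
        then show "real (nat (zorder h b)) = 0" using entire_zorder_pos_iff[OF holh ex, of b] by simp
      qed
    qed (use A in auto)
    also have "\<dots> \<le> (\<Sum>b\<in>Z. real (nat (zorder h b)))" using fin by (intro sum_mono2) auto
    also have "\<dots> = real N" by (simp add: N_def)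
    finally show ?thesis using N by linarith
  qed
  moreover have "K \<ge> 0" using C(1) by (simp add: K_def L_def)
  ultimately show ?thesis by (intro that[of K k])
qed

section \<open>The convergence exponent\<close>

lemma summable_on_comparison_real:
  fixes f g :: "'a \<Rightarrow> real"
  assumes "f summable_on A" "\<And>x. x \<in> A \<Longrightarrow> g x \<le> f x" "\<And>x. x \<in> A \<Longrightarrow> 0 \<le> g x"
  shows "g summable_on A"
proof -
  have "(\<lambda>x. norm (g x)) summable_on A"
    by (rule Infinite_Sum.abs_summable_on_comparison_test'[OF assms(1)]) (use assms in auto)
  also have "(\<lambda>x. norm (g x)) summable_on A \<longleftrightarrow> g summable_on A"
    by (rule summable_on_cong) (use assms in auto)
  finally show ?thesis .
qed

text \<open>Both applications compare multiplicities over powers of distances from different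
  centres. The comparison can fail near the centres, but there only finitely many terms are
  nonzero.\<close>

lemma summable_on_compare_outside:
  fixes f1 f2 :: "complex \<Rightarrow> real"
  assumes "f1 summable_on S1" "\<And>\<rho>. \<rho> \<in> S2 \<Longrightarrow> f2 \<rho> \<ge> 0"
    and "\<And>\<rho>. \<rho> \<in> S2 \<Longrightarrow> norm \<rho> > R \<Longrightarrow> \<rho> \<in> S1 \<and> f2 \<rho> \<le> c * f1 \<rho>"
    and "finite {\<rho> \<in> S2. norm \<rho> \<le> R \<and> f2 \<rho> \<noteq> 0}"
  shows "f2 summable_on S2"
proof -
  define B where "B = {\<rho> \<in> S2. norm \<rho> \<le> R}"
  have "f2 summable_on {\<rho> \<in> S2. norm \<rho> \<le> R \<and> f2 \<rho> \<noteq> 0}" using assms(4) by (rule summable_on_finite)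
  then have 1: "f2 summable_on B"
    by (subst summable_on_cong_neutral[of "{\<rho> \<in> S2. norm \<rho> \<le> R \<and> f2 \<rho> \<noteq> 0}" _ f2 f2]) (auto simp: B_def)
  have out: "\<rho> \<in> S1 \<and> f2 \<rho> \<le> c * f1 \<rho>" if "\<rho> \<in> S2 - B" for \<rho>
    using assms(3)[of \<rho>] that by (auto simp: B_def not_le)
  then have "f1 summable_on (S2 - B)" by (intro summable_on_subset_banach[OF assms(1)]) blast
  then have "(\<lambda>\<rho>. c * f1 \<rho>) summable_on (S2 - B)" by (rule summable_on_cmult_right)
  then have 2: "f2 summable_on (S2 - B)"
    by (rule summable_on_comparison_real) (use assms(2) out in auto)
  have "f2 summable_on (B \<union> (S2 - B))" by (rule summable_on_Un_disjoint[OF 1 2]) auto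
  moreover have "B \<union> (S2 - B) = S2" by (auto simp: B_def)
  ultimately show ?thesis by simp
qed

text \<open>Zeros are collected in the annuli \<open>j <= norm \<rho> < j + 1\<close>. Their number
  grows at most like \<open>(j + 1) ^ k\<close>, so the exponent \<open>k + 2\<close> leaves the
  convergent series of \<open>1 / (j + 1)^2\<close>.\<close>

lemma entire_zeros_summable:
  assumes g: "g holomorphic_on UNIV" "finite_order_growth g" "\<exists>z. g z \<noteq> 0"
  obtains p where "(\<lambda>\<rho>. real_of_int (zorder g \<rho>) / (1 + norm \<rho>) ^ p) summable_on UNIV"
proof -
  obtain C k where C: "C \<ge> 0" "\<And>r A. r \<ge> 0 \<Longrightarrow> finite A \<Longrightarrow> A \<subseteq> cball 0 r \<Longrightarrow> (\<Sum>a\<in>A. real_of_int (zorder g a)) \<le> C * (1 + r) ^ k"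
    by (rule zero_counting[OF g]) blast
  define f where "f \<rho> = real_of_int (zorder g \<rho>) / (1 + norm \<rho>) ^ (k + 2)" for \<rho>
  have zpos: "0 \<le> real_of_int (zorder g \<rho>)" for \<rho> using entire_zorder_nonneg[OF g(1,3), of \<rho>] by simp
  have fpos: "f \<rho> \<ge> 0" for \<rho> using zpos[of \<rho>] by (simp add: f_def)
  define T where "T = (\<Sum>j. inverse (real (Suc j) ^ 2))"
  have summ: "summable (\<lambda>j. inverse (real (Suc j) ^ 2))"
    using inverse_power_summable[of 2, where 'a = real] by (subst summable_Suc_iff) simp
  have bnd: "sum f A \<le> C * 2 ^ k * T" if A: "finite A" for A
  proof -
    define J where "J = Suc (Max (insert 0 ((\<lambda>\<rho>. nat \<lfloor>norm \<rho>\<rfloor>) ` A)))"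
    have J: "(\<lambda>\<rho>. nat \<lfloor>norm \<rho>\<rfloor>) ` A \<subseteq> {..<J}"
      using A by (auto simp: J_def less_Suc_eq_le)
    have inner: "sum f {\<rho> \<in> A. nat \<lfloor>norm \<rho>\<rfloor> = j} \<le> C * 2 ^ k * inverse (real (Suc j) ^ 2)" for j
    proof -
      let ?B = "{\<rho> \<in> A. nat \<lfloor>norm \<rho>\<rfloor> = j}"
      have nb: "real j \<le> norm \<rho>" "norm \<rho> \<le> real j + 1" if "\<rho> \<in> ?B" for \<rho>
      proof -
        have "\<lfloor>norm \<rho>\<rfloor> = int j" using that by (auto simp: nat_eq_iff)
        then show "real j \<le> norm \<rho>" "norm \<rho> \<le> real j + 1" by linarith+
      qed
      have "sum f ?B \<le> (\<Sum>\<rho>\<in>?B. real_of_int (zorder g \<rho>) / (real (Suc j)) ^ (k + 2))"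
        unfolding f_def using nb zpos by (intro sum_mono divide_left_mono power_mono) (auto intro!: mult_pos_pos zero_less_power add_pos_nonneg)
      also have "\<dots> = (\<Sum>\<rho>\<in>?B. real_of_int (zorder g \<rho>)) / (real (Suc j)) ^ (k + 2)" by (simp add: sum_divide_distrib)
      also have "\<dots> \<le> (C * (1 + (real j + 1)) ^ k) / (real (Suc j)) ^ (k + 2)"
        using nb A by (intro divide_right_mono C(2)) auto
      also have "\<dots> \<le> (C * (2 * real (Suc j)) ^ k) / (real (Suc j)) ^ (k + 2)"
        using C(1) by (intro divide_right_mono mult_left_mono power_mono) auto
      also have "\<dots> = C * 2 ^ k * inverse (real (Suc j) ^ 2)"
        unfolding power_mult_distrib power_add by (simp add: field_simps del: of_nat_Suc)
      finally show ?thesis .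
    qed
    have "sum f A = (\<Sum>j<J. sum f {\<rho> \<in> A. nat \<lfloor>norm \<rho>\<rfloor> = j})"
      using sum.group[OF A finite_lessThan J, of f] by simp
    also have "\<dots> \<le> (\<Sum>j<J. C * 2 ^ k * inverse (real (Suc j) ^ 2))" by (intro sum_mono inner)
    also have "\<dots> = C * 2 ^ k * (\<Sum>j<J. inverse (real (Suc j) ^ 2))" by (simp only: sum_distrib_left)
    also have "\<dots> \<le> C * 2 ^ k * T" unfolding T_def
      using C(1) by (intro mult_left_mono sum_le_suminf[OF summ]) auto
    finally show ?thesis .
  qed
  have "f summable_on UNIV"
    by (rule nonneg_bdd_above_summable_on) (use fpos bnd in \<open>auto intro!: bdd_aboveI[of _ "C * 2 ^ k * T"]\<close>)
  then show ?thesis unfolding f_def by (rule that)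
qed

text \<open>\<open>g\<close> and \<open>h\<close> may have common zeros; only the difference of
  their orders is determined by \<open>f\<close>. That \<open>g\<close> is not identically zero is
  inherited from \<open>f\<close>.\<close>

lemma meromorphic_finite_orderE:
  assumes "f nicely_meromorphic_on UNIV" "\<exists>z. f z \<noteq> 0" "meromorphic_finite_order f"
  obtains g h where "g holomorphic_on UNIV" "finite_order_growth g" "\<exists>z. g z \<noteq> 0"
     "h holomorphic_on UNIV" "finite_order_growth h" "\<exists>z. h z \<noteq> 0"
     "\<And>z. h z \<noteq> 0 \<Longrightarrow> f z = g z / h z" "\<And>z. zorder f z = zorder g z - zorder h z"
proof -
  obtain g h where gh: "entire_finite_order g" "entire_finite_order h" "\<exists>z. h z \<noteq> 0" "\<And>z. h z \<noteq> 0 \<Longrightarrow> f z = g z / h z"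
    using assms(3) unfolding meromorphic_finite_order_def by blast
  have hol: "g holomorphic_on UNIV" "h holomorphic_on UNIV" using gh by (auto simp: entire_finite_order_def)
  have gr: "finite_order_growth g" "finite_order_growth h" using gh by (auto intro: entire_finite_order_growth)
  have ev: "eventually (\<lambda>w. f w = g w / h w) (at z)" for z
    using entire_eventually_nonzero[OF hol(2) gh(3), of z] by eventually_elim (rule gh(4))
  have "eventually (\<lambda>w. g w \<noteq> 0) (at 0)"
    using ev[of 0] nicely_meromorphic_eventually_nonzero[OF assms(1,2), of 0] by eventually_elim auto
  then have g0: "\<exists>z. g z \<noteq> 0" using eventually_happens by fastforce
  have "zorder f z = zorder g z - zorder h z" for z
  proof -
    have "zorder f z = zorder (\<lambda>w. g w / h w) z" by (rule zorder_cong[OF ev refl])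
    also have "\<dots> = zorder g z - zorder h z"
      using entire_eventually_nonzero[OF hol(1) g0, of z] entire_eventually_nonzero[OF hol(2) gh(3), of z]
      by (intro zorder_divide entire_meromorphic hol eventually_frequently) auto
    finally show ?thesis .
  qed
  then show ?thesis using that hol gr g0 gh by blast
qed

lemma finite_zorder_cball:
  assumes "f nicely_meromorphic_on UNIV" "\<exists>z. f z \<noteq> 0"
  shows "finite {\<rho>. norm \<rho> \<le> R \<and> zorder f \<rho> \<noteq> 0}"
  using finite_zorder_nonzero[OF assms compact_cball[of 0 R]] by simp

text \<open>This gives the LEAST in \<open>convergence_exponent\<close> its meaning. The
  multiplicities of \<open>f\<close> are dominated by those of the zeros of \<open>g\<close> and of
  \<open>h\<close> together.\<close>

lemma convergence_exponent_exists:
  assumes f: "f nicely_meromorphic_on UNIV" "\<exists>z. f z \<noteq> 0" "meromorphic_finite_order f"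
  shows "\<exists>d. (\<lambda>\<rho>. \<bar>of_int (zorder f \<rho>)\<bar> / norm \<rho> ^ d :: real) summable_on (- {0})"
proof -
  obtain g h where gh: "g holomorphic_on UNIV" "finite_order_growth g" "\<exists>z. g z \<noteq> 0"
     "h holomorphic_on UNIV" "finite_order_growth h" "\<exists>z. h z \<noteq> 0" and
     zo: "\<And>z. zorder f z = zorder g z - zorder h z"
    by (rule meromorphic_finite_orderE[OF f]) blast
  obtain p where p: "(\<lambda>\<rho>. real_of_int (zorder g \<rho>) / (1 + norm \<rho>) ^ p) summable_on UNIV"
    by (rule entire_zeros_summable[OF gh(1-3)])
  obtain q where q: "(\<lambda>\<rho>. real_of_int (zorder h \<rho>) / (1 + norm \<rho>) ^ q) summable_on UNIV"
    by (rule entire_zeros_summable[OF gh(4-6)])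
  define d where "d = max p q"
  have "(\<lambda>\<rho>. \<bar>of_int (zorder f \<rho>)\<bar> / norm \<rho> ^ d :: real) summable_on (- {0})"
  proof (rule summable_on_compare_outside[OF summable_on_add[OF p q], where R = 1 and c = "2 ^ d"])
    fix \<rho> :: complex assume \<rho>: "norm \<rho> > 1"
    have g0: "zorder g \<rho> \<ge> 0" "zorder h \<rho> \<ge> 0" using entire_zorder_nonneg[OF gh(1,3)] entire_zorder_nonneg[OF gh(4,6)] by auto
    have le: "x / norm \<rho> ^ d \<le> 2 ^ d * (x / (1 + norm \<rho>) ^ e)" if "x \<ge> 0" "e \<le> d" for x :: real and e
    proof -
      have "(1 + norm \<rho>) ^ e \<le> (1 + norm \<rho>) ^ d" using that by (intro power_increasing) auto
      also have "\<dots> \<le> (2 * norm \<rho>) ^ d" using \<rho> by (intro power_mono) auto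
      finally have "(1 + norm \<rho>) ^ e \<le> 2 ^ d * norm \<rho> ^ d" by (simp add: power_mult_distrib)
      moreover have "(1 + norm \<rho>) ^ e > 0" "norm \<rho> ^ d > 0" using \<rho> by (auto intro!: zero_less_power)
      ultimately have "1 / norm \<rho> ^ d \<le> 2 ^ d / (1 + norm \<rho>) ^ e" by (simp add: field_simps)
      from mult_left_mono[OF this that(1)] show ?thesis by (simp add: mult_ac)
    qed
    have "\<bar>of_int (zorder f \<rho>)\<bar> \<le> real_of_int (zorder g \<rho>) + real_of_int (zorder h \<rho>)"
      using g0 by (simp add: zo)
    then have "\<bar>of_int (zorder f \<rho>)\<bar> / norm \<rho> ^ d \<le> (real_of_int (zorder g \<rho>) + real_of_int (zorder h \<rho>)) / norm \<rho> ^ d"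
      by (intro divide_right_mono) auto
    also have "\<dots> = real_of_int (zorder g \<rho>) / norm \<rho> ^ d + real_of_int (zorder h \<rho>) / norm \<rho> ^ d" by (rule add_divide_distrib)
    also have "\<dots> \<le> 2 ^ d * (real_of_int (zorder g \<rho>) / (1 + norm \<rho>) ^ p) + 2 ^ d * (real_of_int (zorder h \<rho>) / (1 + norm \<rho>) ^ q)"
      using g0 by (intro add_mono le) (auto simp: d_def)
    also have "\<dots> = 2 ^ d * (real_of_int (zorder g \<rho>) / (1 + norm \<rho>) ^ p + real_of_int (zorder h \<rho>) / (1 + norm \<rho>) ^ q)"
      by (simp only: distrib_left)
    finally show "\<rho> \<in> UNIV \<and> \<bar>of_int (zorder f \<rho>)\<bar> / norm \<rho> ^ d \<le>
       2 ^ d * (real_of_int (zorder g \<rho>) / (1 + norm \<rho>) ^ p + real_of_int (zorder h \<rho>) / (1 + norm \<rho>) ^ q)" by simp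
  next
    show "finite {\<rho> \<in> - {0}. norm \<rho> \<le> 1 \<and> \<bar>of_int (zorder f \<rho>)\<bar> / norm \<rho> ^ d \<noteq> (0::real)}"
      by (rule finite_subset[OF _ finite_zorder_cball[OF f(1,2), of 1]]) auto
  qed auto
  then show ?thesis by blast
qed

text \<open>The exponent is defined with distances from 0; for
  \<open>norm \<rho> > 2 * norm \<sigma>\<close> one has
  \<open>norm \<rho> <= 2 * norm (\<rho> - \<sigma>)\<close>.\<close>

lemma zorder_summable_shifted:
  assumes f: "f nicely_meromorphic_on UNIV" "\<exists>z. f z \<noteq> 0" "meromorphic_finite_order f"
  shows "(\<lambda>\<rho>. \<bar>of_int (zorder f \<rho>)\<bar> / norm (\<rho> - \<sigma>) ^ convergence_exponent f :: real) summable_on (- {\<sigma>})"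
proof -
  define d where "d = convergence_exponent f"
  have s: "(\<lambda>\<rho>. \<bar>of_int (zorder f \<rho>)\<bar> / norm \<rho> ^ d :: real) summable_on (- {0})"
    unfolding d_def convergence_exponent_def by (rule LeastI_ex[OF convergence_exponent_exists[OF f]])
  have "(\<lambda>\<rho>. \<bar>of_int (zorder f \<rho>)\<bar> / norm (\<rho> - \<sigma>) ^ d :: real) summable_on (- {\<sigma>})"
  proof (rule summable_on_compare_outside[OF s, where R = "2 * norm \<sigma>" and c = "2 ^ d"])
    fix \<rho> :: complex assume \<rho>: "norm \<rho> > 2 * norm \<sigma>"
    have \<rho>0: "norm \<rho> > 0" using \<rho> norm_ge_zero[of \<sigma>] by linarith
    have "norm \<rho> \<le> 2 * norm (\<rho> - \<sigma>)" using \<rho> norm_triangle_ineq2[of \<rho> \<sigma>] by linarith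
    then have "norm \<rho> ^ d \<le> (2 * norm (\<rho> - \<sigma>)) ^ d" by (intro power_mono) auto
    then have le: "norm \<rho> ^ d \<le> 2 ^ d * norm (\<rho> - \<sigma>) ^ d" by (simp add: power_mult_distrib)
    have pos: "norm \<rho> ^ d > 0" using \<rho>0 by (rule zero_less_power)
    with le have "0 < 2 ^ d * norm (\<rho> - \<sigma>) ^ d" by linarith
    then have "norm (\<rho> - \<sigma>) ^ d > 0" by (simp add: zero_less_mult_iff)
    with le pos have "1 / norm (\<rho> - \<sigma>) ^ d \<le> 2 ^ d * (1 / norm \<rho> ^ d)" by (simp add: field_simps)
    from mult_left_mono[OF this, of "\<bar>of_int (zorder f \<rho>)\<bar>"]
    have "\<bar>of_int (zorder f \<rho>)\<bar> / norm (\<rho> - \<sigma>) ^ d \<le> 2 ^ d * (\<bar>of_int (zorder f \<rho>)\<bar> / norm \<rho> ^ d :: real)"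
      by (simp add: mult_ac)
    then show "\<rho> \<in> - {0} \<and> \<bar>of_int (zorder f \<rho>)\<bar> / norm (\<rho> - \<sigma>) ^ d \<le> 2 ^ d * (\<bar>of_int (zorder f \<rho>)\<bar> / norm \<rho> ^ d :: real)"
      using \<rho>0 by auto
  next
    show "finite {\<rho> \<in> - {\<sigma>}. norm \<rho> \<le> 2 * norm \<sigma> \<and> \<bar>of_int (zorder f \<rho>)\<bar> / norm (\<rho> - \<sigma>) ^ d \<noteq> (0::real)}"
      by (rule finite_subset[OF _ finite_zorder_cball[OF f(1,2), of "2 * norm \<sigma>"]]) auto
  qed auto
  then show ?thesis by (simp add: d_def)
qed

section \<open>Canonical products\<close>

text \<open>One constant for two ranges: for \<open>norm z <= 1 / 2\<close> the factor is within
  \<open>3 * norm z ^ Suc m\<close> of 1, and otherwise the powers from 1 to \<open>Suc m\<close>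
  are at most \<open>(2 * norm z) ^ Suc m\<close>. The exponent \<open>Suc m\<close> is the one for
  which the sum over the zeros converges.\<close>

lemma weierstrass_factor_norm_le:
  "norm (weierstrass_factor m z) \<le> exp ((3 + real (Suc m) * 2 ^ Suc m) * norm z ^ Suc m)"
proof (cases "norm z \<le> 1 / 2")
  case True
  have "norm (weierstrass_factor m z) \<le> 1 + norm (weierstrass_factor m z - 1)"
    using norm_triangle_ineq[of 1 "weierstrass_factor m z - 1"] by simp
  also have "\<dots> \<le> 1 + 3 * norm z ^ Suc m" using weierstrass_factor_bound[OF True, of m] by simp
  also have "\<dots> \<le> exp (3 * norm z ^ Suc m)" by (rule exp_ge_add_one_self)
  also have "\<dots> \<le> exp ((3 + real (Suc m) * 2 ^ Suc m) * norm z ^ Suc m)"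
    by (intro exp_le_cancel_iff[THEN iffD2] mult_right_mono) auto
  finally show ?thesis .
next
  case False
  define X where "X = (2 * norm z) ^ Suc m"
  have pw: "norm z ^ k \<le> X" if "k \<le> Suc m" "k \<ge> 1" for k
  proof -
    have "norm z ^ k \<le> (2 * norm z) ^ k" by (intro power_mono) auto
    also have "\<dots> \<le> X" unfolding X_def using False that by (intro power_increasing) auto
    finally show ?thesis .
  qed
  have "norm (\<Sum>k=1..m. z ^ k / of_nat k) \<le> (\<Sum>k=1..m. X)"
  proof (rule sum_norm_le)
    fix k assume k: "k \<in> {1..m}"
    have "norm (z ^ k / of_nat k) = norm z ^ k / real k" by (simp add: norm_divide norm_power)
    also have "\<dots> \<le> norm z ^ k / 1" using k by (intro divide_left_mono) auto
    also have "\<dots> \<le> X" using pw[of k] k by simp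
    finally show "norm (z ^ k / of_nat k) \<le> X" .
  qed
  then have "Re (\<Sum>k=1..m. z ^ k / of_nat k) \<le> real m * X" using complex_Re_le_cmod order_trans by fastforce
  then have "norm (exp (\<Sum>k=1..m. z ^ k / of_nat k)) \<le> exp (real m * X)" by simp
  moreover have "norm (1 - z) \<le> exp X"
  proof -
    have "norm (1 - z) \<le> 1 + norm z" using norm_triangle_ineq4[of 1 z] by simp
    also have "\<dots> \<le> 1 + X" using pw[of 1] by simp
    also have "\<dots> \<le> exp X" by (rule exp_ge_add_one_self)
    finally show ?thesis .
  qed
  ultimately have "norm (weierstrass_factor m z) \<le> exp X * exp (real m * X)"
    unfolding weierstrass_factor_def norm_mult by (intro mult_mono) auto
  also have "\<dots> = exp (real (Suc m) * X)" by (simp add: exp_add[symmetric] algebra_simps)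
  also have "real (Suc m) * X = (real (Suc m) * 2 ^ Suc m) * norm z ^ Suc m"
    by (simp only: X_def power_mult_distrib mult.assoc)
  also have "exp \<dots> \<le> exp ((3 + real (Suc m) * 2 ^ Suc m) * norm z ^ Suc m)"
    by (intro exp_le_cancel_iff[THEN iffD2] mult_right_mono) auto
  finally show ?thesis .
qed

text \<open>The derivative of the exponent is a geometric sum, and \<open>1 - z\<close> times it is
  \<open>1 - z ^ m\<close>; with the \<open>- 1\<close> from the linear factor only
  \<open>- z ^ m\<close> survives.\<close>

lemma weierstrass_factor_deriv:
  "(weierstrass_factor m has_field_derivative (- (z ^ m) * exp (\<Sum>k=1..m. z ^ k / of_nat k))) (at z)"
proof -
  have eq: "(\<Sum>k=1..m. of_nat k * z ^ (k - 1) / of_nat k) = (\<Sum>k<m. z ^ k)"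
  proof -
    have "(\<Sum>k=1..m. of_nat k * z ^ (k - 1) / of_nat k) = (\<Sum>k=1..m. z ^ (k - 1))" by (intro sum.cong) auto
    also have "\<dots> = (\<Sum>k<m. z ^ k)"
      by (rule sum.reindex_bij_witness[of _ Suc "\<lambda>k. k - 1"]) auto
    finally show ?thesis .
  qed
  have d: "((\<lambda>z. \<Sum>k=1..m. z ^ k / of_nat k) has_field_derivative (\<Sum>k=1..m. of_nat k * z ^ (k - 1) / of_nat k)) (at z)"
    by (auto intro!: derivative_eq_intros sum.cong)
  have "((\<lambda>z. (1 - z) * exp (\<Sum>k=1..m. z ^ k / of_nat k)) has_field_derivative
     (-1) * exp (\<Sum>k=1..m. z ^ k / of_nat k) + (exp (\<Sum>k=1..m. z ^ k / of_nat k) * (\<Sum>k<m. z ^ k)) * (1 - z)) (at z)"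
    by (rule DERIV_mult[OF _ DERIV_fun_exp[OF d[unfolded eq]]]) (auto intro!: derivative_eq_intros)
  moreover have key: "(-1) * X + (X * S) * (1 - z) = - (z ^ m) * X" if "S * (1 - z) = 1 - z ^ m" for X S
    unfolding mult.assoc[of X] that by (simp add: algebra_simps)
  have SS: "(\<Sum>k<m. z ^ k) * (1 - z) = 1 - z ^ m" unfolding one_diff_power_eq by (rule mult.commute)
  ultimately show ?thesis unfolding weierstrass_factor_def[abs_def] key[OF SS] by blast
qed

text \<open>Multiplicities are natural numbers here; the zeros and the poles of a meromorphic
  function become two instances. Partial products are indexed by finite sets, as in
  \<open>hadamard_factorization\<close>.\<close>

locale canonical_product =
  fixes \<sigma> :: complex and m :: nat and k :: "complex \<Rightarrow> nat"
  assumes summ: "(\<lambda>\<rho>. real (k \<rho>) / norm (\<rho> - \<sigma>) ^ Suc m) summable_on (- {\<sigma>})"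
begin

abbreviation E :: "complex \<Rightarrow> complex \<Rightarrow> complex" where
  "E \<rho> s \<equiv> weierstrass_factor m ((s - \<sigma>) / (\<rho> - \<sigma>))"

abbreviation F :: "complex set filter" where "F \<equiv> finite_subsets_at_top (- {\<sigma>})"

definition P :: "complex \<Rightarrow> complex" where
  "P s = Lim F (\<lambda>A. \<Prod>\<rho>\<in>A. E \<rho> s ^ k \<rho>)"

lemma finite_near: "finite {\<rho>. \<rho> \<noteq> \<sigma> \<and> k \<rho> \<noteq> 0 \<and> norm (\<rho> - \<sigma>) \<le> R}" (is "finite ?S")
proof (rule ccontr)
  assume inf: "infinite ?S"
  define w where "w \<rho> = real (k \<rho>) / norm (\<rho> - \<sigma>) ^ Suc m" for \<rho>
  define c where "c = 1 / (1 + \<bar>R\<bar>) ^ Suc m"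
  have c: "c > 0" by (simp add: c_def zero_less_power add_pos_nonneg del: power_Suc)
  have wc: "w \<rho> \<ge> c" if "\<rho> \<in> ?S" for \<rho>
  proof -
    have "norm (\<rho> - \<sigma>) ^ Suc m \<le> (1 + \<bar>R\<bar>) ^ Suc m" using that by (intro power_mono) auto
    moreover have "norm (\<rho> - \<sigma>) ^ Suc m > 0" using that by (intro zero_less_power) auto
    moreover have "real (k \<rho>) \<ge> 1" using that by (auto simp: Suc_le_eq)
    ultimately show ?thesis unfolding w_def c_def by (intro frac_le) auto
  qed
  obtain N where N: "infsum w (- {\<sigma>}) / c < real N" using reals_Archimedean2 by blast
  obtain B where B: "B \<subseteq> ?S" "finite B" "card B = N" using infinite_arbitrarily_large[OF inf] by blast
  have "real N * c = (\<Sum>\<rho>\<in>B. c)" by (simp add: B)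
  also have "\<dots> \<le> sum w B" using B wc by (intro sum_mono) auto
  also have "\<dots> \<le> infsum w (- {\<sigma>})"
    using B summ by (intro finite_sum_le_infsum) (auto simp: w_def[abs_def])
  finally show False using N c by (simp add: field_simps)
qed

text \<open>The finitely many factors with \<open>\<rho>\<close> near \<open>\<sigma>\<close> may
  vanish in the disc and are kept as a product; all others are close to 1 and are summed as
  logarithms. A limit of the form finite product times exponential shows where it vanishes.\<close>

lemma uniform_limit_factored:
  assumes R: "R > 0"
  obtains S where "uniform_limit (cball \<sigma> R) (\<lambda>A s. \<Prod>\<rho>\<in>A. E \<rho> s ^ k \<rho>)
     (\<lambda>s. (\<Prod>\<rho>\<in>{\<rho>. \<rho> \<noteq> \<sigma> \<and> k \<rho> \<noteq> 0 \<and> norm (\<rho> - \<sigma>) \<le> 7 * R}. E \<rho> s ^ k \<rho>) * exp (S s)) F"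
proof -
  define F0 where "F0 = {\<rho>. \<rho> \<noteq> \<sigma> \<and> k \<rho> \<noteq> 0 \<and> norm (\<rho> - \<sigma>) \<le> 7 * R}"
  \<comment> \<open>Beyond \<open>7 * R\<close> the argument of a factor is at most 1/7, so the
    factor differs from 1 by at most 3/7 < 1/2 and its principal logarithm is at most twice that
    difference. The 6 in \<open>M\<close> is 2 times the 3 of the Weierstrass bound.\<close>
  define X where "X = {\<rho>. \<rho> \<noteq> \<sigma> \<and> norm (\<rho> - \<sigma>) > 7 * R}"
  have fin: "finite F0" unfolding F0_def by (rule finite_near)
  define l where "l \<rho> s = Ln (E \<rho> s)" for \<rho> s
  define M where "M \<rho> = (6 * R ^ Suc m) * (real (k \<rho>) / norm (\<rho> - \<sigma>) ^ Suc m)" for \<rho>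
  have E1: "norm (E \<rho> s - 1) < 1 / 2 \<and> norm (l \<rho> s) \<le> 6 * R ^ Suc m / norm (\<rho> - \<sigma>) ^ Suc m"
    if "\<rho> \<in> X" "s \<in> cball \<sigma> R" for \<rho> s
  proof -
    define z where "z = (s - \<sigma>) / (\<rho> - \<sigma>)"
    have s: "norm (s - \<sigma>) \<le> R" using that by (simp add: dist_norm norm_minus_commute)
    have \<rho>: "norm (\<rho> - \<sigma>) > 7 * R" using that by (simp add: X_def)
    have z1: "norm z \<le> R / norm (\<rho> - \<sigma>)" unfolding z_def norm_divide using s by (intro divide_right_mono) auto
    have "R / norm (\<rho> - \<sigma>) \<le> 1 / 7" using R \<rho> by (subst pos_divide_le_eq) auto
    with z1 have z2: "norm z \<le> 1 / 7" by linarith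
    then have b: "norm (weierstrass_factor m z - 1) \<le> 3 * norm z ^ Suc m" by (intro weierstrass_factor_bound) auto
    have "norm z ^ Suc m \<le> norm z ^ 1" using z2 by (intro power_decreasing) auto
    with b z2 have half: "norm (weierstrass_factor m z - 1) < 1 / 2" by simp
    from norm_Ln_le[OF this] have "norm (Ln (weierstrass_factor m z)) \<le> 2 * norm (weierstrass_factor m z - 1)" by simp
    also have "\<dots> \<le> 6 * norm z ^ Suc m" using b by simp
    also have "\<dots> \<le> 6 * (R / norm (\<rho> - \<sigma>)) ^ Suc m" using z1 by (intro mult_left_mono power_mono) auto
    finally show ?thesis using half by (simp only: l_def z_def power_divide times_divide_eq_right)
  qed
  define S where "S s = (\<Sum>\<^sub>\<infinity>\<rho>\<in>X. of_nat (k \<rho>) * l \<rho> s)" for s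
  have Msum: "M summable_on X" unfolding M_def
    by (intro summable_on_cmult_right summable_on_subset_banach[OF summ]) (auto simp: X_def)
  have Mle: "norm (of_nat (k \<rho>) * l \<rho> s) \<le> M \<rho>" if "\<rho> \<in> X" "s \<in> cball \<sigma> R" for \<rho> s
  proof -
    have "norm (of_nat (k \<rho>) * l \<rho> s) = real (k \<rho>) * norm (l \<rho> s)" by (simp add: norm_mult)
    also have "\<dots> \<le> real (k \<rho>) * (6 * R ^ Suc m / norm (\<rho> - \<sigma>) ^ Suc m)"
      using E1[OF that] by (intro mult_left_mono) auto
    finally show ?thesis by (simp add: M_def mult_ac)
  qed
  have U: "uniform_limit (cball \<sigma> R) (\<lambda>A s. \<Sum>\<rho>\<in>A. of_nat (k \<rho>) * l \<rho> s) S (finite_subsets_at_top X)"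
    unfolding S_def by (rule Weierstrass_m_test_general[OF Mle Msum])
  \<comment> \<open>All partial sums lie in one ball, on which \<open>exp\<close> is uniformly
    continuous; this carries the uniform limit through the exponential.\<close>
  define B where "B = infsum M X"
  have Mpos: "M \<rho> \<ge> 0" for \<rho> using R by (simp add: M_def)
  have bA: "norm (\<Sum>\<rho>\<in>A. of_nat (k \<rho>) * l \<rho> s) \<le> B" if "finite A" "A \<subseteq> X" "s \<in> cball \<sigma> R" for A s
  proof -
    have "norm (\<Sum>\<rho>\<in>A. of_nat (k \<rho>) * l \<rho> s) \<le> sum M A" using Mle that by (intro sum_norm_le) auto
    also have "\<dots> \<le> B" unfolding B_def using that Mpos by (intro finite_sum_le_infsum[OF Msum]) auto
    finally show ?thesis .
  qed
  have evX: "eventually (\<lambda>A. finite A \<and> A \<subseteq> X) (finite_subsets_at_top X)"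
    by (rule eventually_finite_subsets_at_top_weakI) auto
  have expU: "uniform_limit (cball \<sigma> R) (\<lambda>A s. exp (\<Sum>\<rho>\<in>A. of_nat (k \<rho>) * l \<rho> s)) (\<lambda>s. exp (S s)) (finite_subsets_at_top X)"
  proof (rule uniform_limit_compose_uniformly_continuous_on[OF U, of "cball 0 B"])
    show "uniformly_continuous_on (cball 0 B) (exp :: complex \<Rightarrow> complex)"
      by (intro compact_uniformly_continuous continuous_intros) auto
    show "\<forall>\<^sub>F A in finite_subsets_at_top X. \<forall>s\<in>cball \<sigma> R. (\<Sum>\<rho>\<in>A. of_nat (k \<rho>) * l \<rho> s) \<in> cball 0 B"
      using evX by eventually_elim (use bA in auto)
  qed auto
  \<comment> \<open>Intersecting with \<open>X\<close> turns limits over finite subsets of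
    \<open>X\<close> into limits over finite subsets of \<open>- {\<sigma>}\<close>.\<close>
  have fl: "filterlim (\<lambda>A. A \<inter> X) (finite_subsets_at_top X) F"
    unfolding filterlim_finite_subsets_at_top
  proof safe
    fix Y assume Y: "finite Y" "Y \<subseteq> X"
    show "\<forall>\<^sub>F A in F. finite (A \<inter> X) \<and> Y \<subseteq> A \<inter> X \<and> A \<inter> X \<subseteq> X"
      unfolding eventually_finite_subsets_at_top by (rule exI[of _ Y]) (use Y in \<open>auto simp: X_def\<close>)
  qed
  have V: "uniform_limit (cball \<sigma> R) (\<lambda>A s. exp (\<Sum>\<rho>\<in>A \<inter> X. of_nat (k \<rho>) * l \<rho> s)) (\<lambda>s. exp (S s)) F"
    by (rule filterlim_compose[OF expU fl])
  have bnd1: "bounded ((\<lambda>s. exp (S s)) ` cball \<sigma> R)"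
  proof (rule uniform_limit_bounded[OF expU])
    show "\<forall>\<^sub>F A in finite_subsets_at_top X. bounded ((\<lambda>s. exp (\<Sum>\<rho>\<in>A. of_nat (k \<rho>) * l \<rho> s)) ` cball \<sigma> R)"
      using evX
    proof eventually_elim
      case (elim A)
      have "norm (exp (\<Sum>\<rho>\<in>A. of_nat (k \<rho>) * l \<rho> s)) \<le> exp B" if "s \<in> cball \<sigma> R" for s
        using bA[of A s] elim that norm_exp[of "\<Sum>\<rho>\<in>A. of_nat (k \<rho>) * l \<rho> s"] by (meson exp_le_cancel_iff order_trans)
      then show ?case unfolding bounded_iff by (intro exI[of _ "exp B"]) auto
    qed
  qed simp
  have bnd2: "bounded ((\<lambda>s. \<Prod>\<rho>\<in>F0. E \<rho> s ^ k \<rho>) ` cball \<sigma> R)"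
    by (intro compact_imp_bounded compact_continuous_image continuous_intros) (auto simp: F0_def)
  have W: "uniform_limit (cball \<sigma> R) (\<lambda>A s. (\<Prod>\<rho>\<in>F0. E \<rho> s ^ k \<rho>) * exp (\<Sum>\<rho>\<in>A \<inter> X. of_nat (k \<rho>) * l \<rho> s))
     (\<lambda>s. (\<Prod>\<rho>\<in>F0. E \<rho> s ^ k \<rho>) * exp (S s)) F"
    by (rule uniform_lim_mult[OF uniform_limit_const V bnd2 bnd1])
  \<comment> \<open>Valid as soon as \<open>A\<close> contains \<open>F0\<close>: the remaining
    points of \<open>A - X\<close> have multiplicity 0 and contribute the factor 1.\<close>
  have eq: "(\<Prod>\<rho>\<in>F0. E \<rho> s ^ k \<rho>) * exp (\<Sum>\<rho>\<in>A \<inter> X. of_nat (k \<rho>) * l \<rho> s) = (\<Prod>\<rho>\<in>A. E \<rho> s ^ k \<rho>)"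
    if A: "finite A" "F0 \<subseteq> A" "A \<subseteq> - {\<sigma>}" and s: "s \<in> cball \<sigma> R" for A s
  proof -
    have e1: "exp (\<Sum>\<rho>\<in>A \<inter> X. of_nat (k \<rho>) * l \<rho> s) = (\<Prod>\<rho>\<in>A \<inter> X. exp (of_nat (k \<rho>) * l \<rho> s))" using A by (intro exp_sum) auto
    have e2: "\<dots> = (\<Prod>\<rho>\<in>A \<inter> X. E \<rho> s ^ k \<rho>)"
    proof (intro prod.cong refl)
      fix \<rho> assume "\<rho> \<in> A \<inter> X"
      then have "E \<rho> s \<noteq> 0" using E1[of \<rho> s] s by auto
      then show "exp (of_nat (k \<rho>) * l \<rho> s) = E \<rho> s ^ k \<rho>" by (simp add: exp_of_nat_mult l_def)
    qed
    have e3: "(\<Prod>\<rho>\<in>F0. E \<rho> s ^ k \<rho>) = (\<Prod>\<rho>\<in>A - X. E \<rho> s ^ k \<rho>)"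
      by (rule prod.mono_neutral_left) (use A in \<open>auto simp: F0_def X_def\<close>)
    have e4: "(\<Prod>\<rho>\<in>A - X. E \<rho> s ^ k \<rho>) * (\<Prod>\<rho>\<in>A \<inter> X. E \<rho> s ^ k \<rho>) = (\<Prod>\<rho>\<in>A. E \<rho> s ^ k \<rho>)"
      using prod.Int_Diff[OF A(1), of "\<lambda>\<rho>. E \<rho> s ^ k \<rho>" X] by (simp only: mult.commute)
    show ?thesis unfolding e1 e2 e3 by (rule e4)
  qed
  have "eventually (\<lambda>A. finite A \<and> F0 \<subseteq> A \<and> A \<subseteq> - {\<sigma>}) F"
    unfolding eventually_finite_subsets_at_top by (rule exI[of _ F0]) (use fin in \<open>auto simp: F0_def\<close>)
  then have "eventually (\<lambda>A. \<forall>s\<in>cball \<sigma> R. (\<Prod>\<rho>\<in>F0. E \<rho> s ^ k \<rho>) * exp (\<Sum>\<rho>\<in>A \<inter> X. of_nat (k \<rho>) * l \<rho> s) = (\<Prod>\<rho>\<in>A. E \<rho> s ^ k \<rho>)) F"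
    by eventually_elim (use eq in blast)
  from uniform_limit_cong[OF this refl] W
  have "uniform_limit (cball \<sigma> R) (\<lambda>A s. \<Prod>\<rho>\<in>A. E \<rho> s ^ k \<rho>) (\<lambda>s. (\<Prod>\<rho>\<in>F0. E \<rho> s ^ k \<rho>) * exp (S s)) F" by simp
  then show ?thesis unfolding F0_def by (rule that)
qed

lemma P_factored:
  assumes "R > 0"
  obtains S where "\<And>s. s \<in> cball \<sigma> R \<Longrightarrow> P s = (\<Prod>\<rho>\<in>{\<rho>. \<rho> \<noteq> \<sigma> \<and> k \<rho> \<noteq> 0 \<and> norm (\<rho> - \<sigma>) \<le> 7 * R}. E \<rho> s ^ k \<rho>) * exp (S s)"
    "uniform_limit (cball \<sigma> R) (\<lambda>A s. \<Prod>\<rho>\<in>A. E \<rho> s ^ k \<rho>) P F"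
proof -
  obtain S where S: "uniform_limit (cball \<sigma> R) (\<lambda>A s. \<Prod>\<rho>\<in>A. E \<rho> s ^ k \<rho>)
     (\<lambda>s. (\<Prod>\<rho>\<in>{\<rho>. \<rho> \<noteq> \<sigma> \<and> k \<rho> \<noteq> 0 \<and> norm (\<rho> - \<sigma>) \<le> 7 * R}. E \<rho> s ^ k \<rho>) * exp (S s)) F"
    by (rule uniform_limit_factored[OF assms])
  have eq: "P s = (\<Prod>\<rho>\<in>{\<rho>. \<rho> \<noteq> \<sigma> \<and> k \<rho> \<noteq> 0 \<and> norm (\<rho> - \<sigma>) \<le> 7 * R}. E \<rho> s ^ k \<rho>) * exp (S s)"
    if s: "s \<in> cball \<sigma> R" for s
    unfolding P_def by (rule tendsto_Lim[OF finite_subsets_at_top_neq_bot tendsto_uniform_limitI[OF S s]])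
  moreover have "uniform_limit (cball \<sigma> R) (\<lambda>A s. \<Prod>\<rho>\<in>A. E \<rho> s ^ k \<rho>) P F"
    by (rule uniform_limit_cong'[THEN iffD1, OF refl _ S]) (use eq in simp)
  ultimately show ?thesis by (rule that)
qed

lemma uniform: "R > 0 \<Longrightarrow> uniform_limit (cball \<sigma> R) (\<lambda>A s. \<Prod>\<rho>\<in>A. E \<rho> s ^ k \<rho>) P F"
  by (rule P_factored) auto

lemma tendsto_P: "((\<lambda>A. \<Prod>\<rho>\<in>A. E \<rho> s ^ k \<rho>) \<longlongrightarrow> P s) F"
  by (rule tendsto_uniform_limitI[OF uniform[of "1 + norm (s - \<sigma>)"]])
   (auto simp: dist_norm norm_minus_commute add_pos_nonneg)

text \<open>The exponential in the factored form has no zeros, so the finite product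
  decides.\<close>

lemma P_eq_0_iff: "P s = 0 \<longleftrightarrow> s \<noteq> \<sigma> \<and> k s \<noteq> 0"
proof -
  define R where "R = 1 + norm (s - \<sigma>)"
  have R: "R > 0" by (simp add: R_def add_pos_nonneg)
  have s: "s \<in> cball \<sigma> R" by (simp add: R_def dist_norm norm_minus_commute)
  have "norm (s - \<sigma>) \<le> R" by (simp add: R_def)
  then have s7: "norm (s - \<sigma>) \<le> 7 * R" using R by linarith
  let ?F0 = "{\<rho>. \<rho> \<noteq> \<sigma> \<and> k \<rho> \<noteq> 0 \<and> norm (\<rho> - \<sigma>) \<le> 7 * R}"
  obtain S where S: "P s = (\<Prod>\<rho>\<in>?F0. E \<rho> s ^ k \<rho>) * exp (S s)"
    by (rule P_factored[OF R]) (use s in blast)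
  have "P s = 0 \<longleftrightarrow> (\<exists>\<rho>\<in>?F0. E \<rho> s = 0 \<and> k \<rho> \<noteq> 0)" unfolding S using finite_near by (auto simp: prod_zero_iff)
  also have "\<dots> \<longleftrightarrow> s \<in> ?F0" by (auto simp: divide_eq_eq)
  also have "\<dots> \<longleftrightarrow> s \<noteq> \<sigma> \<and> k s \<noteq> 0" using s7 by auto
  finally show ?thesis .
qed

lemma holomorphic: "P holomorphic_on UNIV"
proof -
  have "P analytic_on {s}" for s
  proof -
    define R where "R = 1 + norm (s - \<sigma>)"
    have R: "R > 0" by (simp add: R_def add_pos_nonneg)
    have "P holomorphic_on ball \<sigma> R"
    proof (rule holomorphic_uniform_limit[OF _ uniform[OF R] finite_subsets_at_top_neq_bot])
      have hol: "(\<lambda>s. \<Prod>\<rho>\<in>A. E \<rho> s ^ k \<rho>) holomorphic_on B" if "A \<subseteq> - {\<sigma>}" for A B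
        using that by (intro holomorphic_intros) auto
      show "\<forall>\<^sub>F A in F. continuous_on (cball \<sigma> R) (\<lambda>s. \<Prod>\<rho>\<in>A. E \<rho> s ^ k \<rho>) \<and> (\<lambda>s. \<Prod>\<rho>\<in>A. E \<rho> s ^ k \<rho>) holomorphic_on ball \<sigma> R"
        by (rule eventually_finite_subsets_at_top_weakI) (use hol holomorphic_on_imp_continuous_on in blast)
    qed
    then show ?thesis by (rule holomorphic_on_imp_analytic_at) (auto simp: R_def dist_norm norm_minus_commute)
  qed
  then have "P analytic_on UNIV" by (subst analytic_on_analytic_at) auto
  then show ?thesis by (rule analytic_imp_holomorphic)
qed

lemma growth: "finite_order_growth P"
proof -
  define C where "C = 3 + real (Suc m) * 2 ^ Suc m"
  define T where "T = (\<Sum>\<^sub>\<infinity>\<rho>\<in>-{\<sigma>}. real (k \<rho>) / norm (\<rho> - \<sigma>) ^ Suc m)"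
  have C: "C \<ge> 0" by (simp add: C_def)
  have T: "T \<ge> 0" unfolding T_def by (intro infsum_nonneg) simp
  have le: "norm (P s) \<le> exp (C * T * norm (s - \<sigma>) ^ Suc m)" for s
  proof (rule tendsto_upperbound[OF tendsto_norm[OF tendsto_P] _ finite_subsets_at_top_neq_bot])
    have "norm (\<Prod>\<rho>\<in>A. E \<rho> s ^ k \<rho>) \<le> exp (C * T * norm (s - \<sigma>) ^ Suc m)" if A: "finite A" "A \<subseteq> - {\<sigma>}" for A
    proof -
      let ?w = "\<lambda>\<rho>. real (k \<rho>) / norm (\<rho> - \<sigma>) ^ Suc m"
      have "norm (\<Prod>\<rho>\<in>A. E \<rho> s ^ k \<rho>) = (\<Prod>\<rho>\<in>A. norm (E \<rho> s) ^ k \<rho>)" by (simp add: prod_norm[symmetric] norm_power)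
      also have "\<dots> \<le> (\<Prod>\<rho>\<in>A. exp (C * norm (s - \<sigma>) ^ Suc m * ?w \<rho>))"
      proof (intro prod_mono conjI)
        fix \<rho> assume "\<rho> \<in> A"
        have "norm (E \<rho> s) ^ k \<rho> \<le> exp (C * norm ((s - \<sigma>) / (\<rho> - \<sigma>)) ^ Suc m) ^ k \<rho>"
          unfolding C_def by (intro power_mono weierstrass_factor_norm_le) auto
        also have "\<dots> = exp (real (k \<rho>) * (C * norm ((s - \<sigma>) / (\<rho> - \<sigma>)) ^ Suc m))" by (rule exp_of_nat_mult[symmetric])
        also have "real (k \<rho>) * (C * norm ((s - \<sigma>) / (\<rho> - \<sigma>)) ^ Suc m) = C * norm (s - \<sigma>) ^ Suc m * ?w \<rho>"
          unfolding norm_divide power_divide by (simp add: mult_ac del: power_Suc)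
        finally show "norm (E \<rho> s) ^ k \<rho> \<le> exp (C * norm (s - \<sigma>) ^ Suc m * ?w \<rho>)" .
      qed auto
      also have "\<dots> = exp (\<Sum>\<rho>\<in>A. C * norm (s - \<sigma>) ^ Suc m * ?w \<rho>)" using A by (intro exp_sum[symmetric])
      also have "(\<Sum>\<rho>\<in>A. C * norm (s - \<sigma>) ^ Suc m * ?w \<rho>) = C * norm (s - \<sigma>) ^ Suc m * sum ?w A" by (rule sum_distrib_left[symmetric])
      also have "exp \<dots> \<le> exp (C * norm (s - \<sigma>) ^ Suc m * T)" unfolding T_def
        using A C by (intro exp_le_cancel_iff[THEN iffD2] mult_left_mono finite_sum_le_infsum[OF summ]) auto
      finally show ?thesis by (simp only: mult_ac)
    qed
    then show "\<forall>\<^sub>F A in F. norm (\<Prod>\<rho>\<in>A. E \<rho> s ^ k \<rho>) \<le> exp (C * T * norm (s - \<sigma>) ^ Suc m)"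
      by (intro eventually_finite_subsets_at_top_weakI)
  qed
  have "finite_order_growth (\<lambda>s. P (\<sigma> + s))"
    unfolding finite_order_growth_def
  proof (intro exI[of _ "C * T"] exI[of _ "Suc m"] conjI allI)
    fix z
    have "norm (P (\<sigma> + z)) \<le> exp (C * T * norm z ^ Suc m)" using le[of "\<sigma> + z"] by simp
    also have "\<dots> \<le> exp (C * T * (1 + norm z) ^ Suc m)"
      using C T by (intro exp_le_cancel_iff[THEN iffD2] mult_left_mono power_mono) auto
    finally show "norm (P (\<sigma> + z)) \<le> exp (C * T * (1 + norm z) ^ Suc m)" .
  qed (use C T in simp)
  from finite_order_growth_shift[OF this, of "- \<sigma>"] show ?thesis by simp
qed

text \<open>Locally uniform convergence passes to derivatives, so the logarithmic derivatives of the
  partial products, which are the partial sums of the series, converge to that of \<open>P\<close>.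
  A point of multiplicity 0 contributes the factor 1 and the summand 0, even at
  \<open>\<rho> = s\<close>.\<close>

lemma has_sum_log_deriv:
  assumes s: "P s \<noteq> 0"
  shows "((\<lambda>\<rho>. of_nat (k \<rho>) * (((s - \<sigma>) / (\<rho> - \<sigma>)) ^ m / (s - \<rho>))) has_sum (deriv P s / P s)) (- {\<sigma>})"
proof -
  define R where "R = 1 + norm (s - \<sigma>)"
  have R: "R > 0" by (simp add: R_def add_pos_nonneg)
  have sR: "s \<in> ball \<sigma> R" by (simp add: R_def dist_norm norm_minus_commute)
  define G where "G A s = (\<Prod>\<rho>\<in>A. E \<rho> s ^ k \<rho>)" for A s
  have holG: "G A holomorphic_on B" if "A \<subseteq> - {\<sigma>}" for A B
    unfolding G_def[abs_def] using that by (intro holomorphic_intros) auto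
  have dG: "(G A has_field_derivative deriv (G A) w) (at w)" if "A \<subseteq> - {\<sigma>}" for A w
    by (rule holomorphic_derivI[OF holG[OF that, of UNIV]]) auto
  obtain g' where g': "\<And>w. w \<in> ball \<sigma> R \<Longrightarrow> (P has_field_derivative (g' w)) (at w) \<and> ((\<lambda>A. deriv (G A) w) \<longlongrightarrow> g' w) F"
  proof (rule has_complex_derivative_uniform_limit[of \<sigma> R G "\<lambda>A. deriv (G A)" F P])
    show "\<forall>\<^sub>F A in F. continuous_on (cball \<sigma> R) (G A) \<and> (\<forall>w\<in>ball \<sigma> R. (G A has_field_derivative deriv (G A) w) (at w))"
      by (rule eventually_finite_subsets_at_top_weakI) (use holG holomorphic_on_imp_continuous_on dG in blast)
    show "uniform_limit (cball \<sigma> R) G P F" using uniform[OF R] by (simp add: G_def[abs_def])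
  qed (use R in auto)
  have dP: "g' s = deriv P s" using g'[OF sR] by (metis DERIV_imp_deriv)
  have "((\<lambda>A. deriv (G A) s / G A s) \<longlongrightarrow> g' s / P s) F"
    using g'[OF sR] tendsto_P[of s] s by (intro tendsto_divide) (auto simp: G_def)
  moreover have "eventually (\<lambda>A. deriv (G A) s / G A s = (\<Sum>\<rho>\<in>A. of_nat (k \<rho>) * (((s - \<sigma>) / (\<rho> - \<sigma>)) ^ m / (s - \<rho>)))) F"
  proof (rule eventually_finite_subsets_at_top_weakI)
    fix A assume A: "finite A" "A \<subseteq> - {\<sigma>}"
    have nz: "\<rho> \<noteq> s" if "\<rho> \<in> A" "k \<rho> \<noteq> 0" for \<rho> using P_eq_0_iff[of s] that A s by auto
    have Enz: "E \<rho> s ^ k \<rho> \<noteq> 0" if "\<rho> \<in> A" for \<rho>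
    proof (cases "k \<rho> = 0")
      case False
      have "\<rho> \<noteq> s" "\<rho> - \<sigma> \<noteq> 0" using nz[OF that False] that A by auto
      then show ?thesis by (simp add: divide_eq_eq)
    qed simp
    have "deriv (G A) s / G A s = (\<Sum>\<rho>\<in>A. deriv (\<lambda>s. E \<rho> s ^ k \<rho>) s / E \<rho> s ^ k \<rho>)"
    proof -
      have "(\<lambda>s. E \<rho> s ^ k \<rho>) field_differentiable (at s)" if "\<rho> \<in> A" for \<rho>
        using that A by (intro holomorphic_on_imp_differentiable_at[of _ UNIV] holomorphic_intros) auto
      then have "(G A has_field_derivative (\<Sum>\<rho>\<in>A. deriv (\<lambda>s. E \<rho> s ^ k \<rho>) s * (\<Prod>\<rho>'\<in>A - {\<rho>}. E \<rho>' s ^ k \<rho>'))) (at s)"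
        unfolding G_def[abs_def] by (intro has_field_derivative_prod) (auto simp: field_differentiable_derivI)
      then have d1: "deriv (G A) s = (\<Sum>\<rho>\<in>A. deriv (\<lambda>s. E \<rho> s ^ k \<rho>) s * (\<Prod>\<rho>'\<in>A - {\<rho>}. E \<rho>' s ^ k \<rho>'))" by (rule DERIV_imp_deriv)
      show ?thesis
        unfolding d1 sum_divide_distrib
      proof (rule sum.cong[OF refl])
        fix \<rho> assume \<rho>: "\<rho> \<in> A"
        have "G A s = E \<rho> s ^ k \<rho> * (\<Prod>\<rho>'\<in>A - {\<rho>}. E \<rho>' s ^ k \<rho>')" unfolding G_def by (rule prod.remove[OF A(1) \<rho>])
        moreover have "(\<Prod>\<rho>'\<in>A - {\<rho>}. E \<rho>' s ^ k \<rho>') \<noteq> 0" using Enz A by (subst prod_zero_iff) auto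
        ultimately show "deriv (\<lambda>s. E \<rho> s ^ k \<rho>) s * (\<Prod>\<rho>'\<in>A - {\<rho>}. E \<rho>' s ^ k \<rho>') / G A s = deriv (\<lambda>s. E \<rho> s ^ k \<rho>) s / E \<rho> s ^ k \<rho>"
          by simp
      qed
    qed
    also have "\<dots> = (\<Sum>\<rho>\<in>A. of_nat (k \<rho>) * (((s - \<sigma>) / (\<rho> - \<sigma>)) ^ m / (s - \<rho>)))"
    proof (rule sum.cong[OF refl])
      fix \<rho> assume \<rho>: "\<rho> \<in> A"
      show "deriv (\<lambda>s. E \<rho> s ^ k \<rho>) s / E \<rho> s ^ k \<rho> = of_nat (k \<rho>) * (((s - \<sigma>) / (\<rho> - \<sigma>)) ^ m / (s - \<rho>))"
      proof (cases "k \<rho> = 0")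
        case False
        have ne: "\<rho> \<noteq> s" "\<rho> - \<sigma> \<noteq> 0" using nz[OF \<rho> False] A \<rho> by auto
        define z where "z = (s - \<sigma>) / (\<rho> - \<sigma>)"
        define e where "e = exp (\<Sum>k=1..m. z ^ k / of_nat k)"
        have Ez: "E \<rho> s = (1 - z) * e" by (simp add: weierstrass_factor_def z_def e_def)
        have "(E \<rho> has_field_derivative (- (z ^ m) * e) * (1 / (\<rho> - \<sigma>))) (at s)"
          unfolding z_def e_def
          by (rule DERIV_chain2[OF weierstrass_factor_deriv]) (use ne in \<open>auto intro!: derivative_eq_intros\<close>)
        then have "((\<lambda>s. E \<rho> s ^ k \<rho>) has_field_derivative of_nat (k \<rho>) * ((- (z ^ m) * e) * (1 / (\<rho> - \<sigma>)) * E \<rho> s ^ (k \<rho> - 1))) (at s)"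
          using DERIV_power[of "E \<rho>" "(- (z ^ m) * e) * (1 / (\<rho> - \<sigma>))" s UNIV "k \<rho>"] by simp
        then have d: "deriv (\<lambda>s. E \<rho> s ^ k \<rho>) s = of_nat (k \<rho>) * ((- (z ^ m) * e) * (1 / (\<rho> - \<sigma>)) * E \<rho> s ^ (k \<rho> - 1))"
          by (rule DERIV_imp_deriv)
        have Enz': "E \<rho> s \<noteq> 0" using ne by (simp add: divide_eq_eq)
        have "E \<rho> s ^ k \<rho> = E \<rho> s * E \<rho> s ^ (k \<rho> - 1)" using False by (cases "k \<rho>") auto
        then have "deriv (\<lambda>s. E \<rho> s ^ k \<rho>) s / E \<rho> s ^ k \<rho> = of_nat (k \<rho>) * ((- (z ^ m) * e) * (1 / (\<rho> - \<sigma>)) / E \<rho> s)"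
          using Enz' unfolding d by simp
        \<comment> \<open>\<open>(1 - z) (\<rho> - \<sigma>) = \<rho> - s\<close> takes up the inner
          derivative, and the exponential cancels.\<close>
        also have "(- (z ^ m) * e) * (1 / (\<rho> - \<sigma>)) / E \<rho> s = z ^ m / (s - \<rho>)"
        proof -
          have "e \<noteq> 0" by (simp add: e_def)
          moreover have "(1 - z) * (\<rho> - \<sigma>) = \<rho> - s" using ne by (simp add: z_def field_simps)
          moreover have "1 - z \<noteq> 0" using ne by (simp add: z_def divide_eq_eq)
          moreover have "(- a * e) * (1 / b) / (c * e) = - a / (c * b)" if "e \<noteq> 0" "b \<noteq> 0" "c \<noteq> 0" for a b c :: complex
            using that by (simp add: field_simps)
          ultimately have "(- (z ^ m) * e) * (1 / (\<rho> - \<sigma>)) / E \<rho> s = - (z ^ m) / (\<rho> - s)"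
            unfolding Ez using ne(2) by (simp only: not_False_eq_True)
          also have "\<dots> = z ^ m / (s - \<rho>)" using minus_divide_divide[of "z ^ m" "s - \<rho>"] by simp
          finally show ?thesis .
        qed
        finally show ?thesis by (simp add: z_def)
      qed simp
    qed
    finally show "deriv (G A) s / G A s = (\<Sum>\<rho>\<in>A. of_nat (k \<rho>) * (((s - \<sigma>) / (\<rho> - \<sigma>)) ^ m / (s - \<rho>)))" .
  qed
  ultimately have "((\<lambda>A. \<Sum>\<rho>\<in>A. of_nat (k \<rho>) * (((s - \<sigma>) / (\<rho> - \<sigma>)) ^ m / (s - \<rho>))) \<longlongrightarrow> g' s / P s) F"
    by (rule Lim_transform_eventually)
  then show ?thesis unfolding has_sum_def dP .
qed

end

text \<open>Resetting the multiplicity at \<open>\<rho>\<close> to 0 gives a canonical product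
  \<open>K.P\<close> that does not vanish at \<open>\<rho>\<close> and differs from \<open>P\<close>
  by the factor \<open>E \<rho> s ^ k \<rho>\<close>, whose order is visible.\<close>

lemma (in canonical_product) zorder_P:
  "zorder P \<rho> = (if \<rho> = \<sigma> then 0 else int (k \<rho>))"
proof (cases "\<rho> = \<sigma> \<or> k \<rho> = 0")
  case True
  then have "P \<rho> \<noteq> 0" by (simp add: P_eq_0_iff)
  then have "zorder P \<rho> = 0" by (intro zorder_eq_0I entire_analytic_at holomorphic)
  with True show ?thesis by auto
next
  case False
  define k' where "k' = k(\<rho> := 0)"
  interpret K: canonical_product \<sigma> m k'
  proof
    show "(\<lambda>\<rho>. real (k' \<rho>) / norm (\<rho> - \<sigma>) ^ Suc m) summable_on - {\<sigma>}"
      by (rule summable_on_comparison_real[OF summ]) (auto simp: k'_def simp del: power_Suc intro!: divide_right_mono)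
  qed
  have eq: "P s = E \<rho> s ^ k \<rho> * K.P s" for s
  proof (rule tendsto_unique[OF finite_subsets_at_top_neq_bot tendsto_P])
    have "((\<lambda>A. E \<rho> s ^ k \<rho> * (\<Prod>\<rho>\<in>A. E \<rho> s ^ k' \<rho>)) \<longlongrightarrow> E \<rho> s ^ k \<rho> * K.P s) F"
      by (intro tendsto_mult tendsto_const K.tendsto_P)
    moreover have "eventually (\<lambda>A. E \<rho> s ^ k \<rho> * (\<Prod>\<rho>\<in>A. E \<rho> s ^ k' \<rho>) = (\<Prod>\<rho>\<in>A. E \<rho> s ^ k \<rho>)) F"
      unfolding eventually_finite_subsets_at_top
    proof (intro exI[of _ "{\<rho>}"] conjI allI impI)
      fix A assume A: "finite A \<and> {\<rho>} \<subseteq> A \<and> A \<subseteq> - {\<sigma>}"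
      have "(\<Prod>\<rho>\<in>A. E \<rho> s ^ k' \<rho>) = E \<rho> s ^ k' \<rho> * (\<Prod>\<rho>\<in>A - {\<rho>}. E \<rho> s ^ k' \<rho>)" using A by (intro prod.remove) auto
      also have "(\<Prod>\<rho>\<in>A - {\<rho>}. E \<rho> s ^ k' \<rho>) = (\<Prod>\<rho>\<in>A - {\<rho>}. E \<rho> s ^ k \<rho>)" by (intro prod.cong) (auto simp: k'_def)
      finally have "(\<Prod>\<rho>\<in>A. E \<rho> s ^ k' \<rho>) = (\<Prod>\<rho>\<in>A - {\<rho>}. E \<rho> s ^ k \<rho>)" by (simp add: k'_def)
      moreover have "(\<Prod>\<rho>\<in>A. E \<rho> s ^ k \<rho>) = E \<rho> s ^ k \<rho> * (\<Prod>\<rho>\<in>A - {\<rho>}. E \<rho> s ^ k \<rho>)" using A by (intro prod.remove) auto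
      ultimately show "E \<rho> s ^ k \<rho> * (\<Prod>\<rho>\<in>A. E \<rho> s ^ k' \<rho>) = (\<Prod>\<rho>\<in>A. E \<rho> s ^ k \<rho>)" by simp
    qed (use False in auto)
    ultimately show "((\<lambda>A. \<Prod>\<rho>\<in>A. E \<rho> s ^ k \<rho>) \<longlongrightarrow> E \<rho> s ^ k \<rho> * K.P s) F" by (rule Lim_transform_eventually)
  qed
  define g where "g s = (exp (\<Sum>i=1..m. ((s - \<sigma>) / (\<rho> - \<sigma>)) ^ i / of_nat i) / (\<sigma> - \<rho>)) ^ k \<rho> * K.P s" for s
  have E: "E \<rho> s = exp (\<Sum>i=1..m. ((s - \<sigma>) / (\<rho> - \<sigma>)) ^ i / of_nat i) / (\<sigma> - \<rho>) * (s - \<rho>)" for s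
  proof -
    have "1 - (s - \<sigma>) / (\<rho> - \<sigma>) = (\<rho> - s) / (\<rho> - \<sigma>)" using False by (simp add: field_simps)
    also have "\<dots> = (s - \<rho>) / (\<sigma> - \<rho>)" using minus_divide_divide[of "s - \<rho>" "\<sigma> - \<rho>"] by simp
    finally have "1 - (s - \<sigma>) / (\<rho> - \<sigma>) = (s - \<rho>) / (\<sigma> - \<rho>)" .
    then show ?thesis by (simp add: weierstrass_factor_def)
  qed
  have "zorder P \<rho> = int (k \<rho>)"
  proof (rule zorder_eqI[of UNIV _ g])
    show "g holomorphic_on UNIV" unfolding g_def using False by (intro holomorphic_intros K.holomorphic) auto
    have "k' \<rho> = 0" by (simp add: k'_def)
    then have "K.P \<rho> \<noteq> 0" using K.P_eq_0_iff[of \<rho>] by simp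
    moreover have "\<sigma> \<noteq> \<rho>" using False by blast
    ultimately show "g \<rho> \<noteq> 0" by (simp add: g_def)
    show "P w = g w * (w - \<rho>) powi int (k \<rho>)" for w by (simp only: eq g_def E power_mult_distrib power_int_of_nat) (simp only: mult_ac)
  qed auto
  then show ?thesis using False by simp
qed

section \<open>Hadamard factorization\<close>

lemma has_sum_difference:
  fixes f g :: "'a \<Rightarrow> complex"
  assumes "(f has_sum a) A" "(g has_sum b) A" shows "((\<lambda>x. f x - g x) has_sum (a - b)) A"
  using has_sum_add[OF assms(1) has_sum_cmult_right[OF assms(2), of "-1"]] by simp

lemma finite_order_growth_linear_power: "finite_order_growth (\<lambda>z. (z - a) ^ j)"
  unfolding finite_order_growth_def
proof (intro exI[of _ "real j * (1 + norm a)"] exI[of _ 1] conjI allI)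
  fix z
  have "norm (z - a) \<le> norm z + norm a" by (rule norm_triangle_ineq4)
  also have "\<dots> \<le> (1 + norm a) * (1 + norm z)" by (simp add: algebra_simps)
  also have "\<dots> \<le> exp ((1 + norm a) * (1 + norm z))"
    using exp_ge_add_one_self[of "(1 + norm a) * (1 + norm z)"] by linarith
  finally have "norm (z - a) ^ j \<le> exp ((1 + norm a) * (1 + norm z)) ^ j" by (intro power_mono) auto
  also have "\<dots> = exp (real j * ((1 + norm a) * (1 + norm z)))" by (rule exp_of_nat_mult[symmetric])
  finally show "norm ((z - a) ^ j) \<le> exp (real j * (1 + norm a) * (1 + norm z) ^ 1)"
    by (simp add: norm_power mult.assoc)
qed (auto intro!: mult_nonneg_nonneg)

lemma nicely_meromorphic_zorder_0:
  assumes "f nicely_meromorphic_on UNIV" "zorder f s = 0"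
  shows "f analytic_on {s}"
proof (rule nicely_meromorphic_on_imp_analytic_at[OF assms(1) UNIV_I])
  have "isolated_singularity_at f s"
    using assms(1) by (auto simp: nicely_meromorphic_on_def intro: meromorphic_on_isolated_singularity meromorphic_on_subset)
  then show "\<not> is_pole f s" using isolated_pole_imp_neg_zorder[of f s] assms(2) by auto
qed

lemma nicely_meromorphic_zorder_nonzero:
  assumes "f nicely_meromorphic_on UNIV" "\<exists>z. f z \<noteq> 0" "zorder f s \<noteq> 0"
  shows "f s = 0"
proof -
  have m: "f meromorphic_on {s}" using assms(1) by (auto simp: nicely_meromorphic_on_def intro: meromorphic_on_subset)
  note nz = nicely_meromorphic_eventually_nonzero[OF assms(1,2), of s]
  consider "zorder f s > 0" | "zorder f s < 0" using assms(3) by linarith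
  then show ?thesis
  proof cases
    case 1
    then show ?thesis using zorder_pos_imp_isolated_zero[OF m nz] zero_isolated_zero_nicely_meromorphic
      nicely_meromorphic_on_subset[OF assms(1) subset_UNIV] by blast
  next
    case 2
    then show ?thesis using zorder_neg_imp_is_pole[OF m nz] is_pole_zero_at_nicely_mero[OF assms(1)] by blast
  qed
qed

locale finite_order_meromorphic =
  fixes f :: "complex \<Rightarrow> complex" and \<sigma> :: complex
  assumes nice: "f nicely_meromorphic_on UNIV" and nonzero: "\<exists>z. f z \<noteq> 0" and order: "meromorphic_finite_order f"
    and exponent: "convergence_exponent f \<ge> 1"
begin

definition m :: nat where "m = convergence_exponent f - 1"

lemma Suc_m: "Suc m = convergence_exponent f"
  using exponent by (simp add: m_def)

lemma summable_zorder: "(\<lambda>\<rho>. \<bar>of_int (zorder f \<rho>)\<bar> / norm (\<rho> - \<sigma>) ^ Suc m :: real) summable_on (- {\<sigma>})"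
  using zorder_summable_shifted[OF nice nonzero order, of \<sigma>] by (simp only: Suc_m)

text \<open>\<open>nat\<close> truncates the other sign to 0, so \<open>pos\<close> collects the
  zeros and \<open>neg\<close> the poles, with the same \<open>m\<close>.\<close>

sublocale pos: canonical_product \<sigma> m "\<lambda>\<rho>. nat (zorder f \<rho>)"
  by standard (rule summable_on_comparison_real[OF summable_zorder], auto intro!: divide_right_mono simp del: power_Suc)

sublocale neg: canonical_product \<sigma> m "\<lambda>\<rho>. nat (- zorder f \<rho>)"
  by standard (rule summable_on_comparison_real[OF summable_zorder], auto intro!: divide_right_mono simp del: power_Suc)

text \<open>Where \<open>neg.P\<close> vanishes, \<open>s\<close> is a pole: the partial products
  containing \<open>s\<close> and the quotient \<open>pos.P s / neg.P s\<close> are then both 0, by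
  the conventions for \<open>powi\<close> and for division.\<close>

lemma canonical_product_tendsto:
  "((\<lambda>A. \<Prod>\<rho>\<in>A. weierstrass_factor m ((s - \<sigma>) / (\<rho> - \<sigma>)) powi zorder f \<rho>) \<longlongrightarrow> pos.P s / neg.P s)
     (finite_subsets_at_top (- {\<sigma>}))"
proof -
  define E where "E \<rho> = weierstrass_factor m ((s - \<sigma>) / (\<rho> - \<sigma>))" for \<rho>
  have pw: "x powi n = x ^ nat n / x ^ nat (- n)" for x :: complex and n
    by (cases "n \<ge> 0") (auto simp: power_int_def field_simps)
  have eq: "(\<Prod>\<rho>\<in>A. E \<rho> powi zorder f \<rho>) = (\<Prod>\<rho>\<in>A. E \<rho> ^ nat (zorder f \<rho>)) / (\<Prod>\<rho>\<in>A. E \<rho> ^ nat (- zorder f \<rho>))" for A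
    unfolding pw by (rule prod_dividef)
  have "((\<lambda>A. \<Prod>\<rho>\<in>A. E \<rho> powi zorder f \<rho>) \<longlongrightarrow> pos.P s / neg.P s) (finite_subsets_at_top (- {\<sigma>}))"
  proof (cases "neg.P s = 0")
    case False
    then show ?thesis unfolding eq unfolding E_def by (intro tendsto_divide pos.tendsto_P neg.tendsto_P)
  next
    case True
    then have s: "s \<noteq> \<sigma>" "zorder f s < 0" using neg.P_eq_0_iff[of s] by auto
    have "eventually (\<lambda>A. (\<Prod>\<rho>\<in>A. E \<rho> powi zorder f \<rho>) = 0) (finite_subsets_at_top (- {\<sigma>}))"
      unfolding eventually_finite_subsets_at_top
    proof (intro exI[of _ "{s}"] conjI allI impI)
      fix A assume A: "finite A \<and> {s} \<subseteq> A \<and> A \<subseteq> - {\<sigma>}"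
      have "E s powi zorder f s = 0" using s by (simp add: E_def power_int_0_left_if)
      then show "(\<Prod>\<rho>\<in>A. E \<rho> powi zorder f \<rho>) = 0" using A by (intro prod_zero) auto
    qed (use s in auto)
    then show ?thesis unfolding True by (simp add: tendsto_eventually)
  qed
  then show ?thesis by (simp add: E_def)
qed

lemma hadamard_factorization_iff:
  "hadamard_factorization f \<sigma> Q \<longleftrightarrow>
    (\<forall>s. f s = (s - \<sigma>) powi zorder f \<sigma> * exp (poly Q s) * (pos.P s / neg.P s))"
  unfolding hadamard_factorization_def m_def[symmetric]
  using canonical_product_tendsto tendsto_unique[OF finite_subsets_at_top_neq_bot _ canonical_product_tendsto] by blast

lemma hadamard_exists: "\<exists>Q. hadamard_factorization f \<sigma> Q"
proof -
  obtain g h where g: "g holomorphic_on UNIV" "finite_order_growth g" "\<exists>z. g z \<noteq> 0"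
     and h: "h holomorphic_on UNIV" "finite_order_growth h" "\<exists>z. h z \<noteq> 0"
     and gh: "\<And>z. h z \<noteq> 0 \<Longrightarrow> f z = g z / h z"
    by (rule meromorphic_finite_orderE[OF nice nonzero order]) blast
  define n where "n = zorder f \<sigma>"
  define D where "D s = (s - \<sigma>) powi n * pos.P s" for s
  define G where "G s = f s * neg.P s / D s" for s
  have P\<sigma>: "pos.P \<sigma> \<noteq> 0" "neg.P \<sigma> \<noteq> 0" by (simp_all add: pos.P_eq_0_iff neg.P_eq_0_iff)
  have evp: "eventually (\<lambda>w. pos.P w \<noteq> 0) (at z)" "eventually (\<lambda>w. neg.P w \<noteq> 0) (at z)" for z
    using P\<sigma> entire_eventually_nonzero[OF pos.holomorphic, of z] entire_eventually_nonzero[OF neg.holomorphic, of z] by blast+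
  have evs: "eventually (\<lambda>w. w - \<sigma> \<noteq> 0) (at z)" for z
    by (rule entire_eventually_nonzero) (auto intro!: holomorphic_intros exI[of _ "\<sigma> + 1"])
  have evf: "eventually (\<lambda>w. f w \<noteq> 0) (at z)" for z by (rule nicely_meromorphic_eventually_nonzero[OF nice nonzero])
  have evpow: "eventually (\<lambda>w. (w - \<sigma>) powi n \<noteq> 0) (at z)" for z
    using evs[of z] by eventually_elim simp
  have evD: "eventually (\<lambda>w. D w \<noteq> 0) (at z)" for z
    using evpow[of z] evp(1)[of z] by eventually_elim (simp add: D_def)
  have evG: "eventually (\<lambda>w. G w \<noteq> 0) (at z)" for z
    using evD[of z] evf[of z] evp(2)[of z] by eventually_elim (simp add: G_def)
  have mf: "f meromorphic_on A" for A using nice by (auto simp: nicely_meromorphic_on_def intro: meromorphic_on_subset)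
  have mpow: "(\<lambda>w. (w - \<sigma>) powi n) meromorphic_on A" for A by (intro meromorphic_intros entire_meromorphic holomorphic_intros)
  note mP = entire_meromorphic[OF pos.holomorphic] entire_meromorphic[OF neg.holomorphic]
  have zpow: "zorder (\<lambda>w. (w - \<sigma>) powi n) z = (if z = \<sigma> then n else 0)" for z
  proof -
    have "zorder (\<lambda>w. (w - \<sigma>) powi n) z = n * zorder (\<lambda>w. w - \<sigma>) z"
      using evs[of z] by (intro zorder_power_int entire_meromorphic holomorphic_intros eventually_frequently) auto
    then show ?thesis using zorder_linear_power[of \<sigma> 1 z] by simp
  qed
  have zD: "zorder D z = (if z = \<sigma> then n else 0) + zorder pos.P z" for z
    unfolding D_def[abs_def] zpow[symmetric]
    by (rule zorder_mult[OF mpow eventually_frequently[OF at_neq_bot evpow] mP(1) eventually_frequently[OF at_neq_bot evp(1)]])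
  have mD: "D meromorphic_on A" for A unfolding D_def[abs_def] by (rule meromorphic_on_mult[OF mpow mP(1)])
  have zG: "zorder G z = 0" for z
  proof -
    have ev: "eventually (\<lambda>w. f w * neg.P w \<noteq> 0) (at z)"
      using evf[of z] evp(2)[of z] by eventually_elim simp
    have "zorder G z = zorder (\<lambda>w. f w * neg.P w) z - zorder D z"
      unfolding G_def[abs_def]
      by (rule zorder_divide[OF meromorphic_on_mult[OF mf mP(2)] eventually_frequently[OF at_neq_bot ev] mD eventually_frequently[OF at_neq_bot evD]])
    also have "zorder (\<lambda>w. f w * neg.P w) z = zorder f z + zorder neg.P z"
      by (rule zorder_mult[OF mf eventually_frequently[OF at_neq_bot evf] mP(2) eventually_frequently[OF at_neq_bot evp(2)]])
    finally show ?thesis by (simp add: zD pos.zorder_P neg.zorder_P n_def)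
  qed
  have mG: "G meromorphic_on UNIV" unfolding G_def[abs_def] by (rule meromorphic_on_divide[OF meromorphic_on_mult[OF mf mP(2)] mD])
  have zG': "zorder G z \<ge> 0" for z by (simp add: zG)
  obtain u where u: "u holomorphic_on UNIV" "\<And>z. eventually (\<lambda>w. u w = G w) (at z)" "\<And>z. u z \<noteq> 0"
    by (rule meromorphic_entire_extension[OF mG evG zG']) (simp add: zG)
  \<comment> \<open>\<open>u = A / B\<close> with denominators cleared: \<open>h\<close> and
    \<open>pos.P\<close> go to \<open>B\<close>, and the power of \<open>s - \<sigma>\<close> to the
    side where its exponent is nonnegative.\<close>
  define A where "A s = g s * (neg.P s * (s - \<sigma>) ^ nat (- n))" for s
  define B where "B s = h s * (pos.P s * (s - \<sigma>) ^ nat n)" for s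
  have holAB: "A holomorphic_on UNIV" "B holomorphic_on UNIV"
    unfolding A_def B_def by (intro holomorphic_intros g h pos.holomorphic neg.holomorphic)+
  have AB: "A z = u z * B z" for z
  proof (rule eventually_eq_at_imp_eq[of A "\<lambda>z. u z * B z"])
    show "continuous_on UNIV A" "continuous_on UNIV (\<lambda>z. u z * B z)"
      by (intro holomorphic_on_imp_continuous_on holomorphic_intros holAB u)+
    show "eventually (\<lambda>w. A w = u w * B w) (at z)"
      using u(2)[of z] evs[of z] evp[of z] entire_eventually_nonzero[OF h(1,3), of z]
    proof eventually_elim
      case (elim w)
      define x where "x = w - \<sigma>"
      have x: "x \<noteq> 0" using elim by (simp add: x_def)
      have px: "x ^ nat n = x powi n * x ^ nat (- n)" using x by (cases "n \<ge> 0") (auto simp: power_int_def field_simps)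
      have "u w * B w = (f w * h w) * (neg.P w / (x powi n * pos.P w) * (pos.P w * x ^ nat n))"
        unfolding elim(1) G_def D_def B_def x_def by simp
      also have "f w * h w = g w" using gh[OF elim(5)] elim(5) by simp
      also have "neg.P w / (x powi n * pos.P w) * (pos.P w * x ^ nat n) = neg.P w * x ^ nat (- n)"
        unfolding px using x elim(3) by simp
      finally show ?case by (simp add: A_def x_def)
    qed
  qed
  have exA: "\<exists>z. A z \<noteq> 0"
  proof -
    have "eventually (\<lambda>w. A w \<noteq> 0) (at 0)"
      using evs[of 0] evp(2)[of 0] entire_eventually_nonzero[OF g(1,3), of 0] by eventually_elim (simp add: A_def)
    then show ?thesis using eventually_happens by fastforce
  qed
  have gA: "finite_order_growth A" unfolding A_def[abs_def]
    by (intro finite_order_growth_mult g neg.growth finite_order_growth_linear_power)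
  have gB: "finite_order_growth B" unfolding B_def[abs_def]
    by (intro finite_order_growth_mult h pos.growth finite_order_growth_linear_power)
  obtain Q where Q: "\<And>z. u z = exp (poly Q z)"
    by (rule zero_free_quotient_exp_poly[OF holAB(1) gA exA holAB(2) gB u(1,3) AB]) blast
  \<comment> \<open>Where \<open>f\<close> has order 0 both sides are continuous and agree nearby.
    Elsewhere both are 0: the left one because \<open>f\<close> is nicely meromorphic, the right one
    by the conventions at zeros and poles.\<close>
  have "f s = (s - \<sigma>) powi n * exp (poly Q s) * (pos.P s / neg.P s)" for s
  proof (cases "zorder f s = 0")
    case True
    have Ps: "pos.P s \<noteq> 0" "neg.P s \<noteq> 0" by (simp_all add: pos.P_eq_0_iff neg.P_eq_0_iff True)
    have c1: "f \<midarrow>s\<rightarrow> f s" using nicely_meromorphic_zorder_0[OF nice True] analytic_at_imp_isCont isContD by blast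
    have c2: "(\<lambda>s. (s - \<sigma>) powi n * exp (poly Q s) * (pos.P s / neg.P s)) \<midarrow>s\<rightarrow> (s - \<sigma>) powi n * exp (poly Q s) * (pos.P s / neg.P s)"
    proof -
      have c: "pos.P \<midarrow>s\<rightarrow> pos.P s" "neg.P \<midarrow>s\<rightarrow> neg.P s"
        using analytic_at_imp_isCont[OF entire_analytic_at[OF pos.holomorphic]] analytic_at_imp_isCont[OF entire_analytic_at[OF neg.holomorphic]]
        by (auto simp: isCont_def)
      have p: "(\<lambda>s. (s - \<sigma>) powi n) \<midarrow>s\<rightarrow> (s - \<sigma>) powi n"
      proof (cases "s = \<sigma>")
        case True
        then have "n = 0" using \<open>zorder f s = 0\<close> by (simp add: n_def)
        then show ?thesis by simp
      qed (auto intro!: tendsto_intros)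
      show ?thesis by (intro tendsto_mult p tendsto_divide c tendsto_exp) (use Ps in \<open>auto intro!: isContD\<close>)
    qed
    have ev: "eventually (\<lambda>s. f s = (s - \<sigma>) powi n * exp (poly Q s) * (pos.P s / neg.P s)) (at s)"
      using u(2)[of s] evD[of s] evp[of s]
    proof eventually_elim
      case (elim w)
      have "exp (poly Q w) * D w = f w * neg.P w" using elim Q[of w] by (simp add: G_def)
      then show ?case using elim(4) by (simp add: D_def field_simps)
    qed
    show ?thesis by (rule LIM_unique[OF Lim_transform_eventually[OF c1 ev] c2])
  next
    case False
    have "f s = 0" by (rule nicely_meromorphic_zorder_nonzero[OF nice nonzero False])
    moreover have "(s - \<sigma>) powi n * exp (poly Q s) * (pos.P s / neg.P s) = 0"
    proof (cases "s = \<sigma>")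
      case True
      then show ?thesis using False by (simp add: n_def power_int_0_left_if)
    next
      case s: False
      have "pos.P s = 0 \<or> neg.P s = 0" using s False by (auto simp: pos.P_eq_0_iff neg.P_eq_0_iff)
      then show ?thesis by auto
    qed
    ultimately show ?thesis by simp
  qed
  then show ?thesis unfolding hadamard_factorization_iff n_def by blast
qed

text \<open>The base point is not in the index set, so its share \<open>n / (s - \<sigma>)\<close>
  and that of \<open>exp Q\<close> are moved to the other side. The sums for zeros and poles
  subtract termwise, since \<open>nat n - nat (- n) = n\<close>.\<close>

lemma log_deriv_has_sum:
  assumes Q: "hadamard_factorization f \<sigma> Q" and s: "zorder f s = 0" "s \<noteq> \<sigma>"
  shows "((\<lambda>\<rho>. of_int (zorder f \<rho>) * (((s - \<sigma>) / (\<rho> - \<sigma>)) ^ m / (s - \<rho>))) has_sum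
     (deriv f s / f s - of_int (zorder f \<sigma>) / (s - \<sigma>) - poly (pderiv Q) s)) (- {\<sigma>})"
proof -
  define n where "n = zorder f \<sigma>"
  have Ps: "pos.P s \<noteq> 0" "neg.P s \<noteq> 0" by (simp_all add: pos.P_eq_0_iff neg.P_eq_0_iff s)
  have feq: "f w = (w - \<sigma>) powi n * exp (poly Q w) * (pos.P w / neg.P w)" for w
    using Q unfolding hadamard_factorization_iff n_def by blast
  define a where "a = s - \<sigma>"
  have a: "a \<noteq> 0" using s by (simp add: a_def)
  have dP: "(pos.P has_field_derivative deriv pos.P s) (at s)" "(neg.P has_field_derivative deriv neg.P s) (at s)"
    by (auto intro!: holomorphic_derivI[OF pos.holomorphic] holomorphic_derivI[OF neg.holomorphic])
  have 1: "((\<lambda>s. (s - \<sigma>) powi n) has_field_derivative (of_int n / a) * (a powi n)) (at s)"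
    using s by (auto intro!: derivative_eq_intros simp: a_def power_int_diff field_simps)
  have 2: "((\<lambda>s. exp (poly Q s)) has_field_derivative poly (pderiv Q) s * exp (poly Q s)) (at s)"
    by (auto intro!: derivative_eq_intros)
  have 3: "((\<lambda>s. pos.P s / neg.P s) has_field_derivative (deriv pos.P s / pos.P s - deriv neg.P s / neg.P s) * (pos.P s / neg.P s)) (at s)"
    using dP Ps by (auto intro!: derivative_eq_intros simp: field_simps)
  define D where "D = of_int n / a + poly (pderiv Q) s + (deriv pos.P s / pos.P s - deriv neg.P s / neg.P s)"
  \<comment> \<open>Each derivative above is written as logarithmic derivative times function, so
    that the product rule collapses to a sum of logarithmic derivatives.\<close>
  have alg: "(N * X * Y + (q * Y) * X) * Z + (R * Z) * (X * Y) = (N + q + R) * (X * Y * Z)" for N X Y Z q R :: complex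
    by (simp add: algebra_simps)
  have "((\<lambda>w. (w - \<sigma>) powi n * exp (poly Q w) * (pos.P w / neg.P w)) has_field_derivative D * f s) (at s)"
    by (rule DERIV_cong[OF DERIV_mult[OF DERIV_mult[OF 1 2] 3]]) (unfold feq[of s] D_def a_def, rule alg)
  then have "(f has_field_derivative D * f s) (at s)"
    by (rule has_field_derivative_transform_within_open[OF _ open_UNIV UNIV_I]) (rule feq[symmetric])
  then have "deriv f s = D * f s" by (rule DERIV_imp_deriv)
  moreover have "f s \<noteq> 0" using feq[of s] Ps a by (simp add: a_def)
  ultimately have D: "deriv f s / f s = D" by simp
  have "((\<lambda>\<rho>. of_nat (nat (zorder f \<rho>)) * (((s - \<sigma>) / (\<rho> - \<sigma>)) ^ m / (s - \<rho>)) -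
        of_nat (nat (- zorder f \<rho>)) * (((s - \<sigma>) / (\<rho> - \<sigma>)) ^ m / (s - \<rho>))) has_sum
     (deriv pos.P s / pos.P s - deriv neg.P s / neg.P s)) (- {\<sigma>})"
    by (intro has_sum_difference pos.has_sum_log_deriv neg.has_sum_log_deriv Ps)
  also have "(\<lambda>\<rho>. of_nat (nat (zorder f \<rho>)) * (((s - \<sigma>) / (\<rho> - \<sigma>)) ^ m / (s - \<rho>)) -
        of_nat (nat (- zorder f \<rho>)) * (((s - \<sigma>) / (\<rho> - \<sigma>)) ^ m / (s - \<rho>))) =
      (\<lambda>\<rho>. of_int (zorder f \<rho>) * (((s - \<sigma>) / (\<rho> - \<sigma>)) ^ m / (s - \<rho>)))"
  proof
    fix \<rho>
    have "of_nat (nat (zorder f \<rho>)) - of_nat (nat (- zorder f \<rho>)) = (of_int (zorder f \<rho>) :: complex)"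
      by (cases "zorder f \<rho> \<ge> 0") (auto simp: of_nat_nat)
    then show "of_nat (nat (zorder f \<rho>)) * (((s - \<sigma>) / (\<rho> - \<sigma>)) ^ m / (s - \<rho>)) -
        of_nat (nat (- zorder f \<rho>)) * (((s - \<sigma>) / (\<rho> - \<sigma>)) ^ m / (s - \<rho>)) =
        of_int (zorder f \<rho>) * (((s - \<sigma>) / (\<rho> - \<sigma>)) ^ m / (s - \<rho>))"
      by (simp only: left_diff_distrib[symmetric])
  qed
  also have "deriv pos.P s / pos.P s - deriv neg.P s / neg.P s =
     deriv f s / f s - of_int (zorder f \<sigma>) / (s - \<sigma>) - poly (pderiv Q) s"
    unfolding D by (simp add: D_def n_def a_def)
  finally show ?thesis .
qed

end

section \<open>Distributional derivatives of exponentially bounded functions\<close>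

lemma higher_dist_deriv: "(dist_deriv ^^ n) T \<phi> = (- 1) ^ n * T (vd n \<phi>)"
proof (induction n arbitrary: \<phi>)
  case (Suc n)
  then show ?case by (simp add: dist_deriv_def funpow_swap1)
qed simp

section \<open>Integrals over the half-line\<close>

lemma integrable_exp_half_line:
  fixes x :: real
  assumes "x > 0" shows "integrable lborel (\<lambda>t. indicator {0..} t * exp (- x * t))"
    and "(LINT t|lborel. indicator {0..} t * exp (- x * t)) = 1 / x"
proof -
  have "(\<integral>\<^sup>+t. ennreal (exp (- x * t)) * indicator {0..} t \<partial>lborel) = ennreal (0 - (- 1 / x * exp (- x * 0)))"
  proof (rule nn_integral_FTC_atLeast)
    show "((\<lambda>t. - 1 / x * exp (- x * t)) has_real_derivative exp (- x * t)) (at t)" for t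
      using assms by (auto intro!: derivative_eq_intros)
    have "filterlim (\<lambda>t. - x * t) at_bot at_top"
      using assms by (intro filterlim_tendsto_neg_mult_at_bot[OF tendsto_const _ filterlim_ident]) auto
    then have "((\<lambda>t. exp (- x * t)) \<longlongrightarrow> 0) at_top" by (rule filterlim_compose[OF exp_at_bot])
    from tendsto_mult[OF tendsto_const this, of "- 1 / x"]
    show "((\<lambda>t. - 1 / x * exp (- x * t)) \<longlongrightarrow> 0) at_top" by simp
  qed auto
  also have "(\<integral>\<^sup>+t. ennreal (exp (- x * t)) * indicator {0..} t \<partial>lborel) = (\<integral>\<^sup>+t. ennreal (indicator {0..} t * exp (- x * t)) \<partial>lborel)"
    by (intro nn_integral_cong) (auto simp: indicator_def)
  finally have "has_bochner_integral lborel (\<lambda>t. indicator {0..} t * exp (- x * t)) (1 / x)"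
    using assms by (intro has_bochner_integral_nn_integral) auto
  then show "integrable lborel (\<lambda>t. indicator {0..} t * exp (- x * t))"
    "(LINT t|lborel. indicator {0..} t * exp (- x * t)) = 1 / x"
    by (auto simp: has_bochner_integral_iff)
qed

lemma integral_half_line_FTC:
  fixes f F :: "real \<Rightarrow> complex"
  assumes F: "\<And>t. (F has_vector_derivative f t) (at t)" and cont: "continuous_on UNIV f"
    and int: "integrable lborel (\<lambda>t. indicator {0..} t *\<^sub>R f t)" and lim: "(F \<longlongrightarrow> 0) at_top"
  shows "(LINT t|lborel. indicator {0..} t *\<^sub>R f t) = - F 0"
proof -
  have 1: "((\<lambda>y. LINT t|lborel. indicator {..y} t *\<^sub>R (indicator {0..} t *\<^sub>R f t)) \<longlongrightarrow> (LINT t|lborel. indicator {0..} t *\<^sub>R f t)) at_top"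
    by (rule tendsto_integral_at_top[OF sets_lborel int])
  have "(LINT t|lborel. indicator {..y} t *\<^sub>R (indicator {0..} t *\<^sub>R f t)) = F y - F 0" if "y \<ge> 0" for y
  proof -
    have "(LINT t|lborel. indicator {..y} t *\<^sub>R (indicator {0..} t *\<^sub>R f t)) = (LINT t|lborel. indicator {0..y} t *\<^sub>R f t)"
      by (intro Bochner_Integration.integral_cong) (auto simp: indicator_def)
    also have "\<dots> = F y - F 0"
      using that by (intro integral_FTC_atLeastAtMost) (auto intro: has_vector_derivative_at_within F continuous_on_subset[OF cont])
    finally show ?thesis .
  qed
  then have "eventually (\<lambda>y. (LINT t|lborel. indicator {..y} t *\<^sub>R (indicator {0..} t *\<^sub>R f t)) = F y - F 0) at_top"
    using eventually_ge_at_top[of 0] by (rule eventually_mono[rotated])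
  from Lim_transform_eventually[OF 1 this]
  have 2: "((\<lambda>y. F y - F 0) \<longlongrightarrow> (LINT t|lborel. indicator {0..} t *\<^sub>R f t)) at_top" .
  have "((\<lambda>y. F y - F 0) \<longlongrightarrow> 0 - F 0) at_top" by (intro tendsto_diff lim tendsto_const)
  from tendsto_unique[OF _ 2 this] show ?thesis by simp
qed

text \<open>
  The formula for \<open>W\<close> makes sense on all smooth functions that decay like \<open>e\<^sup>-\<^sup>c\<^sup>t\<close> with
  \<open>c > B + Re \<sigma>\<close>, so it serves as its own extension from test functions to Schwartz functions.
\<close>

locale exponential_distribution =
  fixes k :: "real \<Rightarrow> complex" and C B :: real and \<sigma> :: complex and d g :: nat and \<epsilon> :: complex and a :: "nat \<Rightarrow> complex"
  assumes meas: "k \<in> borel_measurable borel" and k_neg: "\<And>t. t < 0 \<Longrightarrow> k t = 0"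
    and k_le: "\<And>t. t \<ge> 0 \<Longrightarrow> norm (k t) \<le> C * exp (B * t)"
begin

text \<open>\<open>\<epsilon>\<close> leaves room for the sign \<open>(- 1) ^ d\<close> from moving
  \<open>d\<close> derivatives to the test function, and \<open>a\<close> for point terms at 0, so
  that the Newton-Cramer distribution and the delta terms form a single instance.\<close>

definition W :: functional where
  "W \<phi> = \<epsilon> * (LINT t|lborel. k t * vd d (\<lambda>t. exp (\<sigma> * of_real t) * \<phi> t) t) + (\<Sum>j<g. a j * vd j \<phi> 0)"

definition N :: nat where "N = max d g"

text \<open>Only \<open>t >= 0\<close> matters, as \<open>k\<close> vanishes on the negative
  half-line and the point terms sit at 0; only orders up to \<open>N\<close> enter
  \<open>W\<close>.\<close>

definition decays :: "real \<Rightarrow> real \<Rightarrow> (real \<Rightarrow> complex) \<Rightarrow> bool" where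
  "decays c A \<phi> \<longleftrightarrow> smooth \<phi> \<and> (\<forall>i\<le>N. \<forall>t\<ge>0. norm (vd i \<phi> t) \<le> A * exp (- c * t))"

lemma C_nonneg: "C \<ge> 0"
  using order_trans[OF norm_ge_zero k_le[of 0]] by simp

lemma integrand_bound:
  assumes c: "c > B + Re \<sigma>" and \<phi>: "decays c A \<phi>"
  shows "norm (k t * vd d (\<lambda>t. exp (\<sigma> * of_real t) * \<phi> t) t)
     \<le> (C * 2 ^ d * (1 + norm \<sigma>) ^ d * A) * (indicator {0..} t * exp (- (c - B - Re \<sigma>) * t))"
proof (cases "t \<ge> 0")
  case True
  have "norm (vd d (\<lambda>t. exp (\<sigma> * of_real t) * \<phi> t) t) \<le> 2 ^ d * (((1 + norm \<sigma>) ^ d * exp (Re \<sigma> * t)) * (A * exp (- c * t)))"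
  proof (rule norm_vd_mult_le)
    show "smooth (\<lambda>t. exp (\<sigma> * of_real t))" by (rule smooth_exp)
    show "smooth \<phi>" using \<phi> by (simp add: decays_def)
    fix i assume i: "i \<le> d"
    have "norm \<sigma> ^ i \<le> (1 + norm \<sigma>) ^ i" by (intro power_mono) auto
    also have "\<dots> \<le> (1 + norm \<sigma>) ^ d" using i by (intro power_increasing) auto
    finally have "norm \<sigma> ^ i * exp (Re \<sigma> * t) \<le> (1 + norm \<sigma>) ^ d * exp (Re \<sigma> * t)" by (intro mult_right_mono) auto
    then show "norm (vd i (\<lambda>t. exp (\<sigma> * of_real t)) t) \<le> (1 + norm \<sigma>) ^ d * exp (Re \<sigma> * t)"
      unfolding smooth_exp(2) by (simp add: norm_mult norm_power)
    show "norm (vd i \<phi> t) \<le> A * exp (- c * t)" using \<phi> i True by (auto simp: decays_def N_def)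
  qed
  then have "norm (k t * vd d (\<lambda>t. exp (\<sigma> * of_real t) * \<phi> t) t) \<le>
     (C * exp (B * t)) * (2 ^ d * (((1 + norm \<sigma>) ^ d * exp (Re \<sigma> * t)) * (A * exp (- c * t))))"
    unfolding norm_mult using k_le[OF True] C_nonneg by (intro mult_mono) auto
  also have "\<dots> = (C * 2 ^ d * (1 + norm \<sigma>) ^ d * A) * (exp (B * t) * exp (Re \<sigma> * t) * exp (- c * t))" by (simp only: mult_ac)
  also have "exp (B * t) * exp (Re \<sigma> * t) * exp (- c * t) = exp (- (c - B - Re \<sigma>) * t)"
    unfolding exp_add[symmetric] by (simp add: algebra_simps)
  finally show ?thesis using True by simp
qed (simp add: k_neg)

lemma integrable_integrand:
  assumes c: "c > B + Re \<sigma>" and \<phi>: "decays c A \<phi>"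
  shows "integrable lborel (\<lambda>t. k t * vd d (\<lambda>t. exp (\<sigma> * of_real t) * \<phi> t) t)"
proof (rule Bochner_Integration.integrable_bound)
  show "integrable lborel (\<lambda>t. (C * 2 ^ d * (1 + norm \<sigma>) ^ d * A) * (indicator {0..} t * exp (- (c - B - Re \<sigma>) * t)))"
    using c by (intro integrable_mult_right integrable_exp_half_line) auto
  have "smooth (\<lambda>t. exp (\<sigma> * of_real t) * \<phi> t)" using \<phi> by (intro smooth_mult smooth_exp) (simp add: decays_def)
  then have "vd d (\<lambda>t. exp (\<sigma> * of_real t) * \<phi> t) \<in> borel_measurable borel"
    by (intro borel_measurable_continuous_onI smooth_continuous_on_vd)
  then show "(\<lambda>t. k t * vd d (\<lambda>t. exp (\<sigma> * of_real t) * \<phi> t) t) \<in> borel_measurable lborel"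
    using meas by simp
  show "AE t in lborel. norm (k t * vd d (\<lambda>t. exp (\<sigma> * of_real t) * \<phi> t) t)
     \<le> norm ((C * 2 ^ d * (1 + norm \<sigma>) ^ d * A) * (indicator {0..} t * exp (- (c - B - Re \<sigma>) * t)))"
    using order_trans[OF integrand_bound[OF assms] abs_ge_self] by (intro AE_I2) simp
qed

text \<open>Linear in the decay constant \<open>A\<close>: this one estimate yields the continuity
  of \<open>W\<close> on test functions and that of its extension to Schwartz functions.\<close>

lemma W_bound:
  assumes c: "c > B + Re \<sigma>"
  obtains K where "K \<ge> 0" "\<And>A \<phi>. decays c A \<phi> \<Longrightarrow> norm (W \<phi>) \<le> K * A"
proof -
  define x where "x = c - B - Re \<sigma>"
  have x: "x > 0" using c by (simp add: x_def)
  define K1 where "K1 = C * 2 ^ d * (1 + norm \<sigma>) ^ d"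
  have K1: "K1 \<ge> 0" using C_nonneg by (simp add: K1_def)
  define K where "K = norm \<epsilon> * (K1 / x) + (\<Sum>j<g. norm (a j))"
  have "norm (W \<phi>) \<le> K * A" if \<phi>: "decays c A \<phi>" for A \<phi>
  proof -
    have "norm (LINT t|lborel. k t * vd d (\<lambda>t. exp (\<sigma> * of_real t) * \<phi> t) t)
       \<le> (LINT t|lborel. (K1 * A) * (indicator {0..} t * exp (- x * t)))"
      using integrand_bound[OF c \<phi>] c
      by (intro Bochner_Integration.integral_norm_bound_integral integrable_integrand[OF c \<phi>] integrable_mult_right integrable_exp_half_line(1))
        (auto simp: x_def K1_def)
    also have "\<dots> = (K1 * A) * (1 / x)" by (simp only: integral_mult_right_zero integrable_exp_half_line(2)[OF x])
    finally have 1: "norm (LINT t|lborel. k t * vd d (\<lambda>t. exp (\<sigma> * of_real t) * \<phi> t) t) \<le> K1 / x * A" by simp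
    have 2: "norm (\<Sum>j<g. a j * vd j \<phi> 0) \<le> (\<Sum>j<g. norm (a j) * A)"
    proof (rule sum_norm_le)
      fix j assume "j \<in> {..<g}"
      then have "j \<le> N" by (simp add: N_def)
      then have "norm (vd j \<phi> 0) \<le> A * exp (- c * 0)" using \<phi> unfolding decays_def by blast
      then show "norm (a j * vd j \<phi> 0) \<le> norm (a j) * A" by (simp add: norm_mult mult_left_mono)
    qed
    have "norm (W \<phi>) \<le> norm \<epsilon> * (K1 / x * A) + (\<Sum>j<g. norm (a j) * A)"
      unfolding W_def by (rule norm_triangle_le, unfold norm_mult) (intro add_mono mult_left_mono 1 2 norm_ge_zero)
    then show ?thesis by (simp add: K_def sum_distrib_right distrib_right mult.assoc)
  qed
  moreover have "K \<ge> 0" using K1 x by (auto simp: K_def intro!: add_nonneg_nonneg sum_nonneg)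
  ultimately show ?thesis by (rule that[rotated])
qed

lemma W_add:
  assumes c: "c > B + Re \<sigma>" and \<phi>: "decays c A \<phi>" and \<psi>: "decays c A' \<psi>"
  shows "W (\<lambda>t. \<phi> t + \<psi> t) = W \<phi> + W \<psi>"
proof -
  have sm: "smooth \<phi>" "smooth \<psi>" using \<phi> \<psi> by (auto simp: decays_def)
  have "vd d (\<lambda>t. exp (\<sigma> * of_real t) * (\<phi> t + \<psi> t)) =
      (\<lambda>t. vd d (\<lambda>t. exp (\<sigma> * of_real t) * \<phi> t) t + vd d (\<lambda>t. exp (\<sigma> * of_real t) * \<psi> t) t)"
    using smooth_add(2)[OF smooth_mult[OF smooth_exp(1)[of \<sigma>] sm(1)] smooth_mult[OF smooth_exp(1)[of \<sigma>] sm(2)], of d]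
    by (simp only: distrib_left)
  then have "(LINT t|lborel. k t * vd d (\<lambda>t. exp (\<sigma> * of_real t) * (\<phi> t + \<psi> t)) t) =
     (LINT t|lborel. k t * vd d (\<lambda>t. exp (\<sigma> * of_real t) * \<phi> t) t) + (LINT t|lborel. k t * vd d (\<lambda>t. exp (\<sigma> * of_real t) * \<psi> t) t)"
    using Bochner_Integration.integral_add[OF integrable_integrand[OF c \<phi>] integrable_integrand[OF c \<psi>]]
    by (simp only: distrib_left)
  then show ?thesis
    unfolding W_def smooth_add(2)[OF sm] by (simp add: distrib_left sum.distrib)
qed

lemma W_cmult:
  assumes "smooth \<phi>"
  shows "W (\<lambda>t. x * \<phi> t) = x * W \<phi>"
proof -
  have "vd d (\<lambda>t. exp (\<sigma> * of_real t) * (x * \<phi> t)) = (\<lambda>t. x * vd d (\<lambda>t. exp (\<sigma> * of_real t) * \<phi> t) t)"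
    using smooth_cmult(2)[OF smooth_mult[OF smooth_exp(1)[of \<sigma>] assms], of d x] by (simp only: mult.left_commute)
  then have "(LINT t|lborel. k t * vd d (\<lambda>t. exp (\<sigma> * of_real t) * (x * \<phi> t)) t) =
     x * (LINT t|lborel. k t * vd d (\<lambda>t. exp (\<sigma> * of_real t) * \<phi> t) t)"
    by (simp only: mult.left_commute[of _ x] integral_mult_right_zero)
  then show ?thesis
    unfolding W_def smooth_cmult(2)[OF assms] by (simp add: distrib_left sum_distrib_left mult.left_commute)
qed

text \<open>On the support the factor \<open>exp (\<bar>c\<bar> * r)\<close> makes up for
  \<open>exp (- c t)\<close>, so the decay constant depends on \<open>r\<close>, \<open>c\<close>
  and the suprema only, as the continuity of a distribution demands.\<close>

lemma test_functions_decays: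
  assumes "\<phi> \<in> test_functions" "fun_support \<phi> \<subseteq> {-r..r}" "\<And>i t. i \<le> N \<Longrightarrow> norm (vd i \<phi> t) \<le> A"
  shows "decays c (exp (\<bar>c\<bar> * r) * A) \<phi>"
  unfolding decays_def
proof (intro conjI allI impI)
  show "smooth \<phi>" using assms(1) by (rule test_functions_smooth)
  fix i and t :: real assume i: "i \<le> N" and t: "t \<ge> 0"
  have A: "A \<ge> 0" using assms(3)[of 0 0] norm_ge_zero order_trans by blast
  show "norm (vd i \<phi> t) \<le> exp (\<bar>c\<bar> * r) * A * exp (- c * t)"
  proof (cases "t \<le> r")
    case True
    have "c * t \<le> \<bar>c\<bar> * r" using True t by (intro mult_mono) auto
    then have "1 \<le> exp (\<bar>c\<bar> * r) * exp (- c * t)" unfolding exp_add[symmetric] by simp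
    from mult_right_mono[OF this A] have "A \<le> exp (\<bar>c\<bar> * r) * A * exp (- c * t)" by (simp add: mult_ac)
    then show ?thesis using assms(3)[OF i, of t] by linarith
  next
    case False
    then have "t \<notin> fun_support \<phi>" using assms(2) by auto
    then show ?thesis using A by (simp add: vd_zero_outside_support)
  qed
qed

lemma test_functions_decaysE:
  assumes "\<phi> \<in> test_functions" obtains A where "decays c A \<phi>"
proof -
  obtain r where r: "r > 0" "fun_support \<phi> \<subseteq> {-r..r}" using test_functionsE[OF assms] .
  have bd: "\<exists>A. \<forall>t\<in>UNIV. norm (vd i \<phi> t) \<le> A" for i
    by (rule test_functions_bounded[OF assms, of i]) blast
  obtain A where A: "\<And>i t. i \<le> N \<Longrightarrow> t \<in> UNIV \<Longrightarrow> norm (vd i \<phi> t) \<le> A"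
    by (rule uniform_bound_atMost[of UNIV "\<lambda>i t. norm (vd i \<phi> t)" N, OF bd]) blast
  show ?thesis by (rule that[OF test_functions_decays[OF assms r(2) A[OF _ UNIV_I]]])
qed

lemma distribution_W: "distribution W"
  unfolding distribution_def
proof (intro conjI allI impI)
  define c where "c = B + Re \<sigma> + 1"
  have c: "c > B + Re \<sigma>" by (simp add: c_def)
  show "linear_functional_on test_functions W"
    unfolding linear_functional_on_def
  proof (intro conjI ballI allI)
    fix \<phi> \<psi> assume "\<phi> \<in> test_functions" "\<psi> \<in> test_functions"
    then show "W (\<lambda>t. \<phi> t + \<psi> t) = W \<phi> + W \<psi>"
      using test_functions_decaysE[of \<phi> c] test_functions_decaysE[of \<psi> c] W_add[OF c] by metis
  qed (auto intro: W_cmult test_functions_smooth)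
  fix K :: "real set" assume "compact K"
  then have "bounded K" by (rule compact_imp_bounded)
  then obtain r where r: "r > 0" "\<And>t. t \<in> K \<Longrightarrow> norm t \<le> r" unfolding bounded_pos by blast
  then have Kr: "K \<subseteq> {-r..r}" by (force simp: abs_le_iff)
  obtain M where M: "M \<ge> 0" "\<And>A \<phi>. decays c A \<phi> \<Longrightarrow> norm (W \<phi>) \<le> M * A"
    by (rule W_bound[OF c]) blast
  have "norm (W \<phi>) \<le> (M * exp (\<bar>c\<bar> * r)) * (\<Sum>k\<le>N. SUP t. norm (vd k \<phi> t))"
    if \<phi>: "\<phi> \<in> test_functions" "fun_support \<phi> \<subseteq> K" for \<phi>
  proof -
    have bdd: "bdd_above (range (\<lambda>t. norm (vd i \<phi> t)))" for i
      by (rule test_functions_bounded[OF \<phi>(1), of i]) (auto intro!: bdd_aboveI)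
    have sup: "norm (vd i \<phi> t) \<le> (SUP t. norm (vd i \<phi> t))" for i t
      by (rule cSUP_upper[OF UNIV_I bdd])
    have sup0: "0 \<le> (SUP t. norm (vd i \<phi> t))" for i using sup[of i 0] norm_ge_zero order_trans by blast
    have "decays c (exp (\<bar>c\<bar> * r) * (\<Sum>k\<le>N. SUP t. norm (vd k \<phi> t))) \<phi>"
    proof (rule test_functions_decays[OF \<phi>(1) order_trans[OF \<phi>(2) Kr]])
      fix i t assume "i \<le> N"
      then have "(SUP t. norm (vd i \<phi> t)) \<le> (\<Sum>k\<le>N. SUP t. norm (vd k \<phi> t))"
        using sup0 by (intro member_le_sum) auto
      then show "norm (vd i \<phi> t) \<le> (\<Sum>k\<le>N. SUP t. norm (vd k \<phi> t))" using sup[of i t] by linarith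
    qed
    from M(2)[OF this] show ?thesis by (simp only: mult.assoc)
  qed
  then show "\<exists>C N. \<forall>\<phi>\<in>test_functions. fun_support \<phi> \<subseteq> K \<longrightarrow> norm (W \<phi>) \<le> C * (\<Sum>k\<le>N. SUP t. norm (vd k \<phi> t))"
    by blast
qed

lemma dist_support_W: "dist_support W \<subseteq> {-1<..}"
proof -
  have null: "W \<phi> = 0" if \<phi>: "\<phi> \<in> test_functions" "fun_support \<phi> \<subseteq> {..<0}" for \<phi>
  proof -
    have out: "t \<notin> fun_support \<phi>" if "t \<ge> 0" for t using \<phi>(2) that by auto
    have z: "k t * vd d (\<lambda>t. exp (\<sigma> * of_real t) * \<phi> t) t = 0" for t
    proof (cases "t < 0")
      case False
      then have "t \<notin> fun_support (\<lambda>t. exp (\<sigma> * of_real t) * \<phi> t)" using out[of t] fun_support_mult[of "\<lambda>t. exp (\<sigma> * of_real t)" \<phi>] by auto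
      then show ?thesis by (simp add: vd_zero_outside_support)
    qed (simp add: k_neg)
    show ?thesis unfolding W_def z using vd_zero_outside_support[OF out[of 0]] by simp
  qed
  have "{..<0} \<subseteq> \<Union>{U. open U \<and> (\<forall>\<phi>\<in>test_functions. fun_support \<phi> \<subseteq> U \<longrightarrow> W \<phi> = 0)}"
    by (intro Union_upper CollectI conjI ballI impI open_lessThan null)
  then have "dist_support W \<subseteq> - {..<0}" unfolding dist_support_def by (rule Compl_anti_mono)
  \<comment> \<open>The support lies in the closed half-line from 0, but an open one is asked for,
    hence -1.\<close>
  also have "\<dots> \<subseteq> {-1<..}" by auto
  finally show ?thesis .
qed

lemma tempered_extension_W:
  assumes c: "c > B + Re \<sigma>"
  shows "tempered_extension (dist_mult (\<lambda>t. of_real (exp (- c * t))) W) (dist_mult (\<lambda>t. of_real (exp (- c * t))) W)"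
proof -
  define e where "e t = complex_of_real (exp (- c * t))" for t
  have e: "e = (\<lambda>t. exp (of_real (- c) * of_real t))" by (auto simp: e_def exp_of_real[symmetric])
  have sme: "smooth e" unfolding e by (rule smooth_exp)
  define M where "M = 2 ^ N * (1 + \<bar>c\<bar>) ^ N"
  define A where "A \<phi> = (\<Sum>j\<le>N. \<Sum>k\<le>N. schwartz_seminorm j k \<phi>)" for \<phi>
  have A: "norm (vd i \<phi> t) \<le> A \<phi>" if \<phi>: "\<phi> \<in> schwartz_functions" and i: "i \<le> N" for \<phi> i t
  proof -
    have nn: "0 \<le> schwartz_seminorm j k \<phi>" for j k
      using schwartz_seminorm_ge[OF \<phi>, of 0 j k] by (rule order_trans[rotated]) simp
    have "norm (vd i \<phi> t) \<le> schwartz_seminorm 0 i \<phi>" using schwartz_seminorm_ge[OF \<phi>, of t 0 i] by simp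
    also have "\<dots> \<le> (\<Sum>k\<le>N. schwartz_seminorm 0 k \<phi>)" using i nn by (intro member_le_sum) auto
    also have "\<dots> \<le> A \<phi>" unfolding A_def using nn by (intro member_le_sum sum_nonneg) auto
    finally show ?thesis .
  qed
  have dec: "decays c (M * A \<phi>) (\<lambda>t. e t * \<phi> t)" if \<phi>: "\<phi> \<in> schwartz_functions" for \<phi>
    unfolding decays_def
  proof (intro conjI allI impI)
    have sm: "smooth \<phi>" using \<phi> by (rule schwartz_functions_smooth)
    show "smooth (\<lambda>t. e t * \<phi> t)" by (intro smooth_mult sme sm)
    fix i and t :: real assume i: "i \<le> N"
    have A0: "A \<phi> \<ge> 0" using A[OF \<phi>, of 0 0] norm_ge_zero order_trans by blast
    have "norm (vd i (\<lambda>t. e t * \<phi> t) t) \<le> 2 ^ i * (((1 + \<bar>c\<bar>) ^ N * exp (- c * t)) * A \<phi>)"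
    proof (rule norm_vd_mult_le[OF sme sm])
      fix j assume j: "j \<le> i"
      have "\<bar>c\<bar> ^ j \<le> (1 + \<bar>c\<bar>) ^ j" by (intro power_mono) auto
      also have "\<dots> \<le> (1 + \<bar>c\<bar>) ^ N" using i j by (intro power_increasing) auto
      finally have "\<bar>c\<bar> ^ j * exp (- c * t) \<le> (1 + \<bar>c\<bar>) ^ N * exp (- c * t)" by (intro mult_right_mono) auto
      then show "norm (vd j e t) \<le> (1 + \<bar>c\<bar>) ^ N * exp (- c * t)"
        unfolding e smooth_exp(2) by (simp add: norm_mult norm_power)
      show "norm (vd j \<phi> t) \<le> A \<phi>" using i j by (intro A[OF \<phi>]) simp
    qed
    also have "\<dots> \<le> 2 ^ N * (((1 + \<bar>c\<bar>) ^ N * exp (- c * t)) * A \<phi>)"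
      using i A0 by (intro mult_right_mono power_increasing) auto
    finally show "norm (vd i (\<lambda>t. e t * \<phi> t) t) \<le> M * A \<phi> * exp (- c * t)" by (simp only: M_def mult_ac)
  qed
  obtain K where K: "K \<ge> 0" "\<And>A \<phi>. decays c A \<phi> \<Longrightarrow> norm (W \<phi>) \<le> K * A"
    by (rule W_bound[OF c]) blast
  have eq: "dist_mult (\<lambda>t. of_real (exp (- c * t))) W = (\<lambda>\<phi>. W (\<lambda>t. e t * \<phi> t))"
    by (auto simp: dist_mult_def e_def)
  show ?thesis
    unfolding tempered_extension_def tempered_functional_def eq
  proof (intro conjI ballI refl)
    show "linear_functional_on schwartz_functions (\<lambda>\<phi>. W (\<lambda>t. e t * \<phi> t))"
      unfolding linear_functional_on_def
    proof (intro conjI ballI allI)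
      fix \<phi> \<psi> assume "\<phi> \<in> schwartz_functions" "\<psi> \<in> schwartz_functions"
      from W_add[OF c dec[OF this(1)] dec[OF this(2)]]
      show "W (\<lambda>t. e t * (\<phi> t + \<psi> t)) = W (\<lambda>t. e t * \<phi> t) + W (\<lambda>t. e t * \<psi> t)" by (simp only: distrib_left)
    next
      fix x \<phi> assume "\<phi> \<in> schwartz_functions"
      then have "smooth (\<lambda>t. e t * \<phi> t)" by (intro smooth_mult sme schwartz_functions_smooth)
      from W_cmult[OF this, of x] show "W (\<lambda>t. e t * (x * \<phi> t)) = x * W (\<lambda>t. e t * \<phi> t)" by (simp only: mult.left_commute)
    qed
    have "norm (W (\<lambda>t. e t * \<phi> t)) \<le> (K * M) * (\<Sum>j\<le>N. \<Sum>k\<le>N. schwartz_seminorm j k \<phi>)"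
      if "\<phi> \<in> schwartz_functions" for \<phi>
      using K(2)[OF dec[OF that]] by (simp only: A_def mult.assoc)
    then show "\<exists>C N. \<forall>\<phi>\<in>schwartz_functions. norm (W (\<lambda>t. e t * \<phi> t)) \<le> C * (\<Sum>j\<le>N. \<Sum>k\<le>N. schwartz_seminorm j k \<phi>)"
      by blast
  qed
qed

lemma laplace_transformable_W: "laplace_transformable W"
  unfolding laplace_transformable_def
proof (intro conjI distribution_W exI)
  show "dist_support W \<subseteq> {- 1<..}" by (rule dist_support_W)
  show "tempered_extension (dist_mult (\<lambda>t. of_real (exp (- (B + Re \<sigma> + 1) * t))) W)
     (dist_mult (\<lambda>t. of_real (exp (- (B + Re \<sigma> + 1) * t))) W)"
    by (rule tempered_extension_W) simp
qed

text \<open>The cutoff is 1 on \<open>[-1, infinity[\<close>, a neighbourhood of all points that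
  enter \<open>W\<close>, so \<open>W\<close> sees the plain exponential: the integral brings
  \<open>(\<sigma> - s) ^ d\<close> and the point terms bring \<open>(- s) ^ j\<close>.\<close>

lemma laplace_transform_W:
  assumes s: "Re s > B + Re \<sigma>"
  shows "laplace_transform W s =
    \<epsilon> * (\<sigma> - s) ^ d * (LINT t|lborel. k t * exp ((\<sigma> - s) * of_real t)) + (\<Sum>j<g. a j * (- s) ^ j)"
proof -
  \<comment> \<open>The midpoint, since \<open>c\<close> must exceed the abscissa of
    \<open>W\<close> and stay below \<open>Re s\<close>.\<close>
  define c where "c = (Re s + (B + Re \<sigma>)) / 2"
  have c: "c > B + Re \<sigma>" "c < Re s" using s by (auto simp: c_def)
  define \<theta> where "\<theta> t = smooth_step (2 + 1 * t)" for t
  have \<theta>: "smooth \<theta>" "\<And>t. t \<ge> -1 \<Longrightarrow> \<theta> t = 1" "\<And>t. t \<le> -2 \<Longrightarrow> \<theta> t = 0"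
    unfolding \<theta>_def using smooth_affine(1)[OF smooth_step, of 2 1] smooth_step_0 smooth_step_1 by auto
  define \<psi> where "\<psi> t = \<theta> t * exp (- s * of_real t)" for t
  have "laplace_transform W s = dist_mult (\<lambda>t. of_real (exp (- c * t))) W (\<lambda>t. \<theta> t * exp (- (s - of_real c) * of_real t))"
    by (rule laplace_transform_eqI[OF distribution_W tempered_extension_W[OF c(1)] c(2) dist_support_W \<theta>])
  also have "\<dots> = W \<psi>"
  proof -
    have "(\<lambda>t. of_real (exp (- c * t)) * (\<theta> t * exp (- (s - of_real c) * of_real t))) = \<psi>"
    proof
      fix t
      have "of_real (exp (- c * t)) * exp (- (s - of_real c) * of_real t) = exp (- s * of_real t)"
        unfolding exp_of_real[symmetric] exp_add[symmetric] by (simp add: algebra_simps)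
      then show "of_real (exp (- c * t)) * (\<theta> t * exp (- (s - of_real c) * of_real t)) = \<psi> t"
        unfolding \<psi>_def by (metis mult.left_commute)
    qed
    then show ?thesis by (simp only: dist_mult_def)
  qed
  also have "W \<psi> = \<epsilon> * (LINT t|lborel. (\<sigma> - s) ^ d * (k t * exp ((\<sigma> - s) * of_real t))) + (\<Sum>j<g. a j * (- s) ^ j)"
  proof -
    have "k t * vd d (\<lambda>t. exp (\<sigma> * of_real t) * \<psi> t) t = (\<sigma> - s) ^ d * (k t * exp ((\<sigma> - s) * of_real t))" for t
    proof (cases "t < 0")
      case False
      have "vd d (\<lambda>t. exp (\<sigma> * of_real t) * \<psi> t) t = vd d (\<lambda>t. exp ((\<sigma> - s) * of_real t)) t"
      proof (rule vd_cong_open[of "{-1<..}"])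
        fix t :: real assume "t \<in> {-1<..}"
        then show "exp (\<sigma> * of_real t) * \<psi> t = exp ((\<sigma> - s) * of_real t)"
          using \<theta>(2)[of t] by (simp add: \<psi>_def exp_add[symmetric] algebra_simps)
      qed (use False in auto)
      then show ?thesis unfolding smooth_exp(2) by (simp only: mult.left_commute)
    qed (simp add: k_neg)
    moreover have "vd j \<psi> 0 = (- s) ^ j" for j
    proof -
      have "vd j \<psi> 0 = vd j (\<lambda>t. exp (- s * of_real t)) 0"
      proof (rule vd_cong_open[of "{-1<..}"])
        fix t :: real assume "t \<in> {-1<..}"
        then show "\<psi> t = exp (- s * of_real t)" using \<theta>(2)[of t] by (simp add: \<psi>_def)
      qed auto
      then show ?thesis unfolding smooth_exp(2) by simp
    qed
    ultimately show ?thesis unfolding W_def by (simp only:)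
  qed
  finally show ?thesis by (simp only: integral_mult_right_zero mult.assoc)
qed

end

text \<open>Exhibiting \<open>W\<close> gives the SOME a witness, so the chosen functional also has
  the transform \<open>F\<close> on some right half-plane; injectivity identifies the two on test
  functions.\<close>

lemma inverse_laplace_eqI:
  assumes "laplace_transformable W" "\<And>s. Re s > a \<Longrightarrow> laplace_transform W s = F s" "\<phi> \<in> test_functions"
  shows "inverse_laplace F \<phi> = W \<phi>"
proof -
  have ex: "\<exists>W. laplace_transformable W \<and> (\<exists>a. \<forall>s. Re s > a \<longrightarrow> laplace_transform W s = F s)"
    using assms(1,2) by blast
  obtain b where W': "laplace_transformable (inverse_laplace F)" "\<And>s. Re s > b \<Longrightarrow> laplace_transform (inverse_laplace F) s = F s"
    using someI_ex[OF ex] unfolding inverse_laplace_def by blast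
  show ?thesis
    by (rule laplace_transform_inj[OF W'(1) assms(1) _ assms(3), of "max a b"]) (use W'(2) assms(2) in simp)
qed

section \<open>The Newton--Cramer kernel\<close>

lemma has_bochner_integral_half_line:
  fixes f :: "real \<Rightarrow> complex"
  assumes meas: "(\<lambda>t. indicator {0..} t *\<^sub>R f t) \<in> borel_measurable borel" and x: "x > 0"
    and le: "\<And>t. t \<ge> 0 \<Longrightarrow> norm (f t) \<le> C * exp (- x * t)"
  shows "integrable lborel (\<lambda>t. indicator {0..} t *\<^sub>R f t)"
    and "norm (LINT t|lborel. indicator {0..} t *\<^sub>R f t) \<le> C / x"
proof -
  have le': "norm (indicator {0..} t *\<^sub>R f t) \<le> C * (indicator {0..} t * exp (- x * t))" for t
    using le[of t] by (auto simp: indicator_def)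
  have int: "integrable lborel (\<lambda>t. C * (indicator {0..} t * exp (- x * t)))"
    by (intro integrable_mult_right integrable_exp_half_line x)
  show i: "integrable lborel (\<lambda>t. indicator {0..} t *\<^sub>R f t)"
  proof (rule Bochner_Integration.integrable_bound[OF int])
    show "AE t in lborel. norm (indicator {0..} t *\<^sub>R f t) \<le> norm (C * (indicator {0..} t * exp (- x * t)))"
      by (intro AE_I2 order_trans[OF le']) simp
  qed (use meas in simp)
  have "norm (LINT t|lborel. indicator {0..} t *\<^sub>R f t) \<le> (LINT t|lborel. C * (indicator {0..} t * exp (- x * t)))"
    by (rule Bochner_Integration.integral_norm_bound_integral[OF i int le'])
  also have "\<dots> = C * (1 / x)" by (simp only: integral_mult_right_zero integrable_exp_half_line(2)[OF x])
  finally show "norm (LINT t|lborel. indicator {0..} t *\<^sub>R f t) \<le> C / x" by simp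
qed

lemma measurable_half_line:
  fixes f :: "real \<Rightarrow> complex"
  assumes "continuous_on {0..} f" shows "(\<lambda>t. indicator {0..} t *\<^sub>R f t) \<in> borel_measurable borel"
  using assms by (intro borel_measurable_continuous_on_indicator) auto

lemma power_exp_le:
  assumes "Re w > 0"
  obtains K where "K \<ge> 0" "\<And>t. t \<ge> 0 \<Longrightarrow> norm (of_real (t ^ d / fact d) * exp (- w * of_real t)) \<le> K * exp (- (Re w / 2) * t)"
proof -
  obtain K where K: "K \<ge> 0" "\<And>j t. j \<le> d \<Longrightarrow> t \<ge> 0 \<Longrightarrow> \<bar>t\<bar> ^ j * exp (- (Re w / 2) * t) \<le> K"
    by (rule abs_power_exp_bound[of "Re w / 2" d 0]) (use assms in auto)
  have "norm (of_real (t ^ d / fact d) * exp (- w * of_real t)) \<le> K * exp (- (Re w / 2) * t)" if t: "t \<ge> 0" for t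
  proof -
    have "norm (of_real (t ^ d / fact d) * exp (- w * of_real t)) = t ^ d / fact d * exp (- Re w * t)"
      using t by (simp add: norm_mult norm_divide norm_power)
    also have "\<dots> \<le> t ^ d / 1 * exp (- Re w * t)"
      using t by (intro mult_right_mono divide_left_mono) auto
    also have "\<dots> = (\<bar>t\<bar> ^ d * exp (- (Re w / 2) * t)) * exp (- (Re w / 2) * t)"
      using t by (simp add: mult.assoc exp_add[symmetric])
    also have "\<dots> \<le> K * exp (- (Re w / 2) * t)" using K(2)[OF order_refl t] by (intro mult_right_mono) auto
    finally show ?thesis .
  qed
  then show ?thesis using K(1) that by blast
qed

text \<open>Integration by parts lowers the power. The antiderivative is the one that vanishes at
  infinity, so that minus its value at 0 is the Laplace integral.\<close>

lemma power_exp_antiderivative: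
  assumes w: "Re w > 0"
  shows "\<exists>F. (\<forall>t. (F has_vector_derivative of_real (t ^ d / fact d) * exp (- w * of_real t)) (at t)) \<and> (F \<longlongrightarrow> 0) at_top \<and> F 0 = - (1 / w ^ Suc d)"
proof -
  have w0: "w \<noteq> 0" using w by auto
  have E: "((\<lambda>t. exp (- w * of_real t)) has_vector_derivative - w * exp (- w * of_real t)) (at t)" for t
    using smooth_has_vderiv[OF smooth_exp(1)[of "- w"]] smooth_exp(2)[of 1 "- w"] by simp
  have lim: "((\<lambda>t. of_real (t ^ d / fact d) * exp (- w * of_real t)) \<longlongrightarrow> 0) at_top" for d
  proof -
    obtain K where K: "K \<ge> 0" "\<And>t. t \<ge> 0 \<Longrightarrow> norm (of_real (t ^ d / fact d) * exp (- w * of_real t)) \<le> K * exp (- (Re w / 2) * t)"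
      by (rule power_exp_le[OF w]) blast
    have "filterlim (\<lambda>t. - (Re w / 2) * t) at_bot at_top"
      using w by (intro filterlim_tendsto_neg_mult_at_bot[OF tendsto_const _ filterlim_ident]) auto
    then have "((\<lambda>t. exp (- (Re w / 2) * t)) \<longlongrightarrow> 0) at_top" by (rule filterlim_compose[OF exp_at_bot])
    from tendsto_mult[OF tendsto_const this, of K] have l: "((\<lambda>t. K * exp (- (Re w / 2) * t)) \<longlongrightarrow> 0) at_top" by simp
    show ?thesis
      by (rule Lim_null_comparison[OF _ l]) (use eventually_ge_at_top[of 0] K(2) in \<open>rule eventually_mono\<close>)
  qed
  show ?thesis
  proof (induction d)
    case 0
    have "((\<lambda>t. - (1 / w) * exp (- w * of_real t)) has_vector_derivative - (1 / w) * (- w * exp (- w * of_real t))) (at t)" for t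
      by (rule has_vector_derivative_mult_right[OF E])
    then have "((\<lambda>t. - (1 / w) * exp (- w * of_real t)) has_vector_derivative of_real (t ^ 0 / fact 0) * exp (- w * of_real t)) (at t)" for t
      using w0 by simp
    moreover have "((\<lambda>t. - (1 / w) * exp (- w * of_real t)) \<longlongrightarrow> 0) at_top"
      using tendsto_mult[OF tendsto_const lim[of 0], of "- (1 / w)"] by simp
    ultimately show ?case by (intro exI[of _ "\<lambda>t. - (1 / w) * exp (- w * of_real t)"]) auto
  next
    case (Suc d)
    then obtain F where F: "\<And>t. (F has_vector_derivative of_real (t ^ d / fact d) * exp (- w * of_real t)) (at t)"
      "(F \<longlongrightarrow> 0) at_top" "F 0 = - (1 / w ^ Suc d)" by blast
    define G where "G t = - (1 / w) * (of_real (t ^ Suc d / fact (Suc d)) * exp (- w * of_real t)) + (1 / w) * F t" for t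
    have P: "((\<lambda>t. complex_of_real (t ^ Suc d / fact (Suc d))) has_vector_derivative of_real (t ^ d / fact d)) (at t)" for t
    proof (rule has_vector_derivative_of_real)
      have "((\<lambda>t. t ^ Suc d / fact (Suc d)) has_real_derivative (real (Suc d) * t ^ d) / fact (Suc d)) (at t)"
        by (rule DERIV_cdivide) (use DERIV_pow[of "Suc d" t] in simp)
      also have "(real (Suc d) * t ^ d) / fact (Suc d) = t ^ d / fact d"
        unfolding fact_Suc by (simp del: of_nat_Suc)
      finally show "((\<lambda>t. t ^ Suc d / fact (Suc d)) has_real_derivative t ^ d / fact d) (at t)" .
    qed
    have dG: "(G has_vector_derivative of_real (t ^ Suc d / fact (Suc d)) * exp (- w * of_real t)) (at t)" for t
    proof -
      define p where "p = complex_of_real (t ^ Suc d / fact (Suc d))"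
      define q where "q = complex_of_real (t ^ d / fact d)"
      define e where "e = exp (- w * of_real t)"
      have "(G has_vector_derivative - (1 / w) * (p * (- w * e) + q * e) + (1 / w) * (q * e)) (at t)"
        unfolding G_def[abs_def] p_def q_def e_def
        by (intro has_vector_derivative_add has_vector_derivative_mult_right has_vector_derivative_mult P E F(1))
      also have "- (1 / w) * (p * (- w * e) + q * e) + (1 / w) * (q * e) = p * e"
        using w0 by (simp add: field_simps)
      finally show ?thesis by (simp only: p_def e_def)
    qed
    have "(G \<longlongrightarrow> - (1 / w) * 0 + (1 / w) * 0) at_top"
      unfolding G_def[abs_def] by (intro tendsto_add tendsto_mult tendsto_const lim F(2))
    moreover have "G 0 = - (1 / w ^ Suc (Suc d))" by (simp add: G_def F(3))
    ultimately show ?case using dG by (intro exI[of _ G]) auto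
  qed
qed

lemma has_bochner_integral_power_exp:
  assumes w: "Re w > 0"
  shows "has_bochner_integral lborel (\<lambda>t. indicator {0..} t *\<^sub>R (of_real (t ^ d / fact d) * exp (- w * of_real t))) (1 / w ^ Suc d)"
proof -
  obtain F where F: "\<And>t. (F has_vector_derivative of_real (t ^ d / fact d) * exp (- w * of_real t)) (at t)"
      "(F \<longlongrightarrow> 0) at_top" "F 0 = - (1 / w ^ Suc d)" using power_exp_antiderivative[OF w] by blast
  obtain K where K: "K \<ge> 0" "\<And>t. t \<ge> 0 \<Longrightarrow> norm (of_real (t ^ d / fact d) * exp (- w * of_real t)) \<le> K * exp (- (Re w / 2) * t)"
    by (rule power_exp_le[OF w]) blast
  have cont: "continuous_on A (\<lambda>t. of_real (t ^ d / fact d) * exp (- w * of_real t))" for A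
    by (intro continuous_intros) auto
  have int: "integrable lborel (\<lambda>t. indicator {0..} t *\<^sub>R (of_real (t ^ d / fact d) * exp (- w * of_real t)))"
    using w by (intro has_bochner_integral_half_line(1)[OF measurable_half_line[OF cont] _ K(2)]) auto
  show ?thesis
    unfolding has_bochner_integral_iff
  proof
    show "(LINT t|lborel. indicator {0..} t *\<^sub>R (of_real (t ^ d / fact d) * exp (- w * of_real t))) = 1 / w ^ Suc d"
      using integral_half_line_FTC[OF F(1) cont int F(2)] by (simp only: F(3) minus_minus)
  qed (rule int)
qed

locale meromorphic_left_half_plane = finite_order_meromorphic +
  fixes \<sigma>\<^sub>1 :: real
  assumes left: "zorder f \<rho> \<noteq> 0 \<Longrightarrow> Re \<rho> \<le> \<sigma>\<^sub>1"
begin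

definition c :: "complex \<Rightarrow> complex" where "c \<rho> = of_int (zorder f \<rho>) / (\<rho> - \<sigma>) ^ Suc m"

text \<open>The exponents in the sum have real part at most
  \<open>\<sigma>\<^sub>1 - Re \<sigma>\<close>; the maximum with 0 makes \<open>exp (b t)\<close>
  dominate constants as well.\<close>

definition b :: real where "b = max 0 (\<sigma>\<^sub>1 - Re \<sigma>)"

text \<open>The subtracted 1 is the share of this term in
  \<open>newton_cramer_kernel f \<sigma> 0\<close>.\<close>

definition kernel_term :: "complex \<Rightarrow> real \<Rightarrow> complex" where "kernel_term \<rho> t = c \<rho> * (exp ((\<rho> - \<sigma>) * of_real t) - 1)"

definition G :: "real \<Rightarrow> complex" where "G t = (\<Sum>\<^sub>\<infinity>\<rho>\<in>-{\<sigma>}. kernel_term \<rho> t)"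

definition K0 :: "real \<Rightarrow> complex" where
  "K0 t = of_int (zorder f \<sigma>) * of_real (t ^ Suc m / fact (Suc m)) + G t"

definition k :: "real \<Rightarrow> complex" where "k t = indicator {0..} t *\<^sub>R K0 t"

section \<open>Convergence and growth of the kernel series\<close>

lemma b_nonneg: "b \<ge> 0"
  by (simp add: b_def)

lemma summable_c: "(\<lambda>\<rho>. norm (c \<rho>)) summable_on (- {\<sigma>})"
  using summable_zorder by (simp add: c_def norm_divide norm_power norm_of_int del: power_Suc)

lemma norm_c_exp_le: "t \<ge> 0 \<Longrightarrow> norm (c \<rho> * exp ((\<rho> - \<sigma>) * of_real t)) \<le> norm (c \<rho>) * exp (b * t)"
proof (cases "zorder f \<rho> = 0")
  case False
  assume t: "t \<ge> 0"
  have "Re \<rho> - Re \<sigma> \<le> b" using left[OF False] by (simp add: b_def)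
  then have "(Re \<rho> - Re \<sigma>) * t \<le> b * t" using t by (rule mult_right_mono)
  then show ?thesis by (simp add: norm_mult mult_left_mono)
qed (simp add: c_def)

lemma has_sum_c_exp:
  assumes "t \<ge> 0"
  shows "((\<lambda>\<rho>. c \<rho> * exp ((\<rho> - \<sigma>) * of_real t)) has_sum (\<Sum>\<^sub>\<infinity>\<rho>\<in>-{\<sigma>}. c \<rho> * exp ((\<rho> - \<sigma>) * of_real t))) (- {\<sigma>})"
proof (rule has_sum_infsum)
  have "(\<lambda>\<rho>. norm (c \<rho>) * exp (b * t)) summable_on (- {\<sigma>})" by (rule summable_on_cmult_left[OF summable_c])
  then have "(\<lambda>\<rho>. norm (c \<rho> * exp ((\<rho> - \<sigma>) * of_real t))) summable_on (- {\<sigma>})"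
    by (rule summable_on_comparison_real) (use norm_c_exp_le[OF assms] in auto)
  then show "(\<lambda>\<rho>. c \<rho> * exp ((\<rho> - \<sigma>) * of_real t)) summable_on (- {\<sigma>})" by (rule abs_summable_summable)
qed

lemma kernel_eq:
  "(newton_cramer_kernel f \<sigma> t - newton_cramer_kernel f \<sigma> 0) * indicator {0..} t = k t"
proof (cases "t \<ge> 0")
  case True
  have "((\<lambda>\<rho>. kernel_term \<rho> t) has_sum ((\<Sum>\<^sub>\<infinity>\<rho>\<in>-{\<sigma>}. c \<rho> * exp ((\<rho> - \<sigma>) * of_real t)) -
     (\<Sum>\<^sub>\<infinity>\<rho>\<in>-{\<sigma>}. c \<rho> * exp ((\<rho> - \<sigma>) * of_real 0)))) (- {\<sigma>})"
    using has_sum_difference[OF has_sum_c_exp[OF True] has_sum_c_exp[OF order_refl]]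
    by (simp add: kernel_term_def[abs_def] right_diff_distrib)
  then have "G t = (\<Sum>\<^sub>\<infinity>\<rho>\<in>-{\<sigma>}. c \<rho> * exp ((\<rho> - \<sigma>) * of_real t)) - (\<Sum>\<^sub>\<infinity>\<rho>\<in>-{\<sigma>}. c \<rho> * exp ((\<rho> - \<sigma>) * of_real 0))"
    unfolding G_def by (rule infsumI)
  \<comment> \<open>As the exponent \<open>Suc m\<close> is positive, the power of \<open>t\<close>
    contributes nothing to the value at 0.\<close>
  then show ?thesis using True
    by (simp add: newton_cramer_kernel_def Let_def k_def K0_def Suc_m[symmetric] c_def del: power_Suc fact_Suc)
qed (simp add: k_def)

text \<open>The weight \<open>exp (- b t)\<close> makes the bound independent of \<open>t\<close>,
  which gives uniform convergence on the whole half-line.\<close>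

lemma weighted_kernel_term_le:
  assumes "t \<in> {0..}" shows "norm (of_real (exp (- b * t)) * kernel_term \<rho> t) \<le> 2 * norm (c \<rho>)"
proof -
  have t: "t \<ge> 0" using assms by simp
  have "norm (kernel_term \<rho> t) \<le> norm (c \<rho> * exp ((\<rho> - \<sigma>) * of_real t)) + norm (c \<rho>)"
    unfolding kernel_term_def right_diff_distrib using norm_triangle_ineq4[of "c \<rho> * exp ((\<rho> - \<sigma>) * of_real t)" "c \<rho> * 1"] by simp
  also have "\<dots> \<le> norm (c \<rho>) * exp (b * t) + norm (c \<rho>) * exp (b * t)"
  proof (rule add_mono[OF norm_c_exp_le[OF t]])
    have "1 \<le> exp (b * t)" using b_nonneg t by simp
    from mult_left_mono[OF this norm_ge_zero[of "c \<rho>"]] show "norm (c \<rho>) \<le> norm (c \<rho>) * exp (b * t)" by simp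
  qed
  finally have "exp (- b * t) * norm (kernel_term \<rho> t) \<le> exp (- b * t) * (2 * norm (c \<rho>) * exp (b * t))"
    by (intro mult_left_mono) auto
  also have "\<dots> = 2 * norm (c \<rho>) * (exp (- b * t) * exp (b * t))" by (simp only: mult_ac)
  finally show ?thesis by (simp add: norm_mult exp_add[symmetric])
qed

lemma uniform_limit_G:
  "uniform_limit {0..} (\<lambda>A t. \<Sum>\<rho>\<in>A. of_real (exp (- b * t)) * kernel_term \<rho> t) (\<lambda>t. of_real (exp (- b * t)) * G t) (finite_subsets_at_top (- {\<sigma>}))"
proof -
  have "uniform_limit {0..} (\<lambda>A t. \<Sum>\<rho>\<in>A. of_real (exp (- b * t)) * kernel_term \<rho> t)
     (\<lambda>t. \<Sum>\<^sub>\<infinity>\<rho>\<in>-{\<sigma>}. of_real (exp (- b * t)) * kernel_term \<rho> t) (finite_subsets_at_top (- {\<sigma>}))"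
    by (rule Weierstrass_m_test_general[OF weighted_kernel_term_le summable_on_cmult_right[OF summable_c]])
  then show ?thesis unfolding infsum_cmult_right' G_def .
qed

lemma continuous_exp_G: "continuous_on {0..} (\<lambda>t. of_real (exp (- b * t)) * G t)"
proof (rule uniform_limit_theorem[OF _ uniform_limit_G finite_subsets_at_top_neq_bot])
  show "\<forall>\<^sub>F A in finite_subsets_at_top (- {\<sigma>}). continuous_on {0..} (\<lambda>t. \<Sum>\<rho>\<in>A. of_real (exp (- b * t)) * kernel_term \<rho> t)"
    unfolding kernel_term_def by (intro always_eventually allI continuous_intros)
qed

lemma continuous_K0: "continuous_on {0..} K0"
proof -
  have eqG: "G t = of_real (exp (b * t)) * (of_real (exp (- b * t)) * G t)" for t
    by (simp add: mult.assoc[symmetric] exp_add[symmetric] flip: of_real_mult)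
  have "continuous_on {0..} (\<lambda>t. of_real (exp (b * t)) * (of_real (exp (- b * t)) * G t))"
    by (intro continuous_on_mult[OF _ continuous_exp_G] continuous_intros)
  then have G: "continuous_on {0..} G" by (rule continuous_on_eq) (rule eqG[symmetric])
  show ?thesis unfolding K0_def[abs_def] by (intro continuous_on_add[OF _ G] continuous_intros) auto
qed

text \<open>After weighting, the series is within distance 1 of a finite partial sum with an
  explicit bound; the additional 1 in the exponent absorbs the power of \<open>t\<close>.\<close>

lemma K0_le: obtains C where "\<And>t. t \<ge> 0 \<Longrightarrow> norm (K0 t) \<le> C * exp ((b + 1) * t)"
proof -
  obtain M :: real where M: "M \<ge> 0" "\<And>j t. j \<le> Suc m \<Longrightarrow> t \<ge> 0 \<Longrightarrow> \<bar>t\<bar> ^ j * exp (- 1 * t) \<le> M"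
    by (rule abs_power_exp_bound[OF zero_less_one, of "Suc m" 0]) blast
  have "eventually (\<lambda>A. \<forall>t\<in>{0..}. dist (\<Sum>\<rho>\<in>A. of_real (exp (- b * t)) * kernel_term \<rho> t) (of_real (exp (- b * t)) * G t) < 1) (finite_subsets_at_top (- {\<sigma>}))"
    using uniform_limitD[OF uniform_limit_G, of 1] by simp
  then have "eventually (\<lambda>A. (\<forall>t\<in>{0..}. dist (\<Sum>\<rho>\<in>A. of_real (exp (- b * t)) * kernel_term \<rho> t) (of_real (exp (- b * t)) * G t) < 1) \<and> finite A \<and> A \<subseteq> - {\<sigma>}) (finite_subsets_at_top (- {\<sigma>}))"
    by (rule eventually_conj) (rule eventually_finite_subsets_at_top_weakI, simp)
  from eventually_happens'[OF finite_subsets_at_top_neq_bot this]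
  obtain A where A1: "\<forall>t\<in>{0..}. dist (\<Sum>\<rho>\<in>A. of_real (exp (- b * t)) * kernel_term \<rho> t) (of_real (exp (- b * t)) * G t) < 1" by (elim exE conjE)
  have A: "dist (\<Sum>\<rho>\<in>A. of_real (exp (- b * t)) * kernel_term \<rho> t) (of_real (exp (- b * t)) * G t) < 1" if "t \<ge> 0" for t
    by (rule bspec[OF A1]) (use that in simp)
  define L where "L = (\<Sum>\<rho>\<in>A. 2 * norm (c \<rho>))"
  have "norm (K0 t) \<le> (\<bar>of_int (zorder f \<sigma>)\<bar> * M + (L + 1)) * exp ((b + 1) * t)" if t: "t \<ge> 0" for t
  proof -
    have e: "exp (b * t) \<le> exp ((b + 1) * t)" "exp t \<le> exp ((b + 1) * t)"
      using t b_nonneg by (auto simp: algebra_simps)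
    have "norm (of_real (t ^ Suc m / fact (Suc m)) :: complex) \<le> M * exp t"
    proof -
      have "t ^ Suc m * exp (- 1 * t) * exp t \<le> M * exp t" using M(2)[OF order_refl t] t by (intro mult_right_mono) auto
      then have "t ^ Suc m \<le> M * exp t" by (simp add: mult.assoc exp_add[symmetric])
      moreover have "t ^ Suc m / fact (Suc m) \<le> t ^ Suc m / 1" using t by (intro divide_left_mono) (auto simp del: fact_Suc)
      moreover have "norm (of_real (t ^ Suc m / fact (Suc m)) :: complex) = t ^ Suc m / fact (Suc m)"
        unfolding norm_of_real using t by (intro abs_of_nonneg divide_nonneg_nonneg zero_le_power) auto
      ultimately show ?thesis by simp
    qed
    also have "M * exp t \<le> M * exp ((b + 1) * t)" using e M(1) by (intro mult_left_mono)
    finally have 1: "norm (of_int (zorder f \<sigma>) * of_real (t ^ Suc m / fact (Suc m)) :: complex) \<le> \<bar>of_int (zorder f \<sigma>)\<bar> * (M * exp ((b + 1) * t))"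
      unfolding norm_mult norm_of_int by (intro mult_left_mono) auto
    have "norm (of_real (exp (- b * t)) * G t) \<le> norm (\<Sum>\<rho>\<in>A. of_real (exp (- b * t)) * kernel_term \<rho> t) + 1"
      using A[OF t] norm_triangle_sub[of "of_real (exp (- b * t)) * G t" "\<Sum>\<rho>\<in>A. of_real (exp (- b * t)) * kernel_term \<rho> t"]
      by (simp add: dist_norm norm_minus_commute)
    also have "norm (\<Sum>\<rho>\<in>A. of_real (exp (- b * t)) * kernel_term \<rho> t) \<le> L" unfolding L_def
      by (intro sum_norm_le weighted_kernel_term_le) (use t in simp)
    finally have "exp (- b * t) * norm (G t) \<le> L + 1" by (simp add: norm_mult)
    then have "exp (- b * t) * norm (G t) * exp (b * t) \<le> (L + 1) * exp (b * t)" by (intro mult_right_mono) auto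
    also have "exp (- b * t) * norm (G t) * exp (b * t) = norm (G t)"
      by (simp add: mult.commute[of "exp (- (b * t))"] mult.assoc exp_add[symmetric])
    also have "(L + 1) * exp (b * t) \<le> (L + 1) * exp ((b + 1) * t)"
      using e by (intro mult_left_mono) (auto simp: L_def sum_nonneg)
    finally have 2: "norm (G t) \<le> (L + 1) * exp ((b + 1) * t)" .
    have "norm (K0 t) \<le> \<bar>of_int (zorder f \<sigma>)\<bar> * (M * exp ((b + 1) * t)) + (L + 1) * exp ((b + 1) * t)"
      unfolding K0_def by (rule norm_triangle_le[OF add_mono[OF 1 2]])
    then show ?thesis by (simp only: distrib_right mult.assoc)
  qed
  then show ?thesis by (rule that)
qed

text \<open>Termwise integration along the net of finite sets: a weighted uniform error
  \<open>\<epsilon>\<close> in the kernel costs at most \<open>\<epsilon>\<close> times the integral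
  of \<open>exp (- (Re w - b) t)\<close>, that is \<open>\<epsilon> / (Re w - b)\<close>. The power
  of \<open>t\<close> has the Laplace integral \<open>1 / w ^ Suc (Suc m)\<close>, which is
  subtracted.\<close>

lemma laplace_kernel_has_sum:
  assumes w: "Re w > b + 1"
  shows "((\<lambda>\<rho>. c \<rho> * (1 / (w - (\<rho> - \<sigma>)) - 1 / w)) has_sum
     ((LINT t|lborel. k t * exp (- w * of_real t)) - of_int (zorder f \<sigma>) / w ^ Suc (Suc m))) (- {\<sigma>})"
proof -
  define n where "n = complex_of_int (zorder f \<sigma>)"
  define I where "I = (LINT t|lborel. indicator {0..} t *\<^sub>R (K0 t * exp (- w * of_real t)))"
  have kI: "(LINT t|lborel. k t * exp (- w * of_real t)) = I" by (simp add: I_def k_def)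
  obtain C where C: "\<And>t. t \<ge> 0 \<Longrightarrow> norm (K0 t) \<le> C * exp ((b + 1) * t)" by (rule K0_le) blast
  have w0: "Re w > 0" using w b_nonneg by simp
  have nexp: "norm (exp (- w * complex_of_real t)) = exp (- Re w * t)" for t by simp
  have contK: "continuous_on {0..} (\<lambda>t. K0 t * exp (- w * of_real t))"
    by (intro continuous_on_mult continuous_K0 continuous_intros)
  have intK: "integrable lborel (\<lambda>t. indicator {0..} t *\<^sub>R (K0 t * exp (- w * of_real t)))"
  proof (rule has_bochner_integral_half_line(1)[OF measurable_half_line[OF contK], of "Re w - (b + 1)" C])
    fix t :: real assume t: "t \<ge> 0"
    have "norm (K0 t * exp (- w * of_real t)) \<le> C * exp ((b + 1) * t) * exp (- Re w * t)"
      unfolding norm_mult nexp using C[OF t] by (intro mult_right_mono) auto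
    also have "\<dots> = C * exp (- (Re w - (b + 1)) * t)" by (simp add: mult.assoc exp_add[symmetric] algebra_simps)
    finally show "norm (K0 t * exp (- w * of_real t)) \<le> C * exp (- (Re w - (b + 1)) * t)" .
  qed (use w in simp)
  have hE: "has_bochner_integral lborel (\<lambda>t. indicator {0..} t *\<^sub>R exp (- z * of_real t)) (1 / z)" if "Re z > 0" for z
    using has_bochner_integral_power_exp[OF that, of 0] by simp
  define j where "j \<rho> = c \<rho> * (1 / (w - (\<rho> - \<sigma>)) - 1 / w)" for \<rho>
  have hterm: "has_bochner_integral lborel (\<lambda>t. indicator {0..} t *\<^sub>R (kernel_term \<rho> t * exp (- w * of_real t))) (j \<rho>)" for \<rho>
  proof (cases "zorder f \<rho> = 0")
    case True
    then show ?thesis by (simp add: kernel_term_def j_def c_def has_bochner_integral_zero)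
  next
    case False
    have "Re \<rho> - Re \<sigma> \<le> b" using left[OF False] by (simp add: b_def)
    then have "Re (w - (\<rho> - \<sigma>)) > 0" using w by simp
    from has_bochner_integral_mult_right[OF has_bochner_integral_diff[OF hE[OF this] hE[OF w0]], of "c \<rho>"]
    have "has_bochner_integral lborel (\<lambda>t. c \<rho> * (indicator {0..} t *\<^sub>R exp (- (w - (\<rho> - \<sigma>)) * of_real t) - indicator {0..} t *\<^sub>R exp (- w * of_real t))) (j \<rho>)"
      by (simp only: j_def)
    moreover have "c \<rho> * (indicator {0..} t *\<^sub>R exp (- (w - (\<rho> - \<sigma>)) * of_real t) - indicator {0..} t *\<^sub>R exp (- w * of_real t))
       = indicator {0..} t *\<^sub>R (kernel_term \<rho> t * exp (- w * of_real t))" for t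
    proof -
      have "exp (- (w - (\<rho> - \<sigma>)) * of_real t) = exp ((\<rho> - \<sigma>) * of_real t) * exp (- w * of_real t)"
        unfolding exp_add[symmetric] by (simp add: algebra_simps)
      then show ?thesis by (simp add: kernel_term_def algebra_simps)
    qed
    ultimately show ?thesis by (simp only:)
  qed
  have hA: "has_bochner_integral lborel (\<lambda>t. indicator {0..} t *\<^sub>R ((n * of_real (t ^ Suc m / fact (Suc m)) + (\<Sum>\<rho>\<in>A. kernel_term \<rho> t)) * exp (- w * of_real t)))
     (n * (1 / w ^ Suc (Suc m)) + (\<Sum>\<rho>\<in>A. j \<rho>))" for A
  proof -
    have "has_bochner_integral lborel (\<lambda>t. n * (indicator {0..} t *\<^sub>R (of_real (t ^ Suc m / fact (Suc m)) * exp (- w * of_real t)))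
        + (\<Sum>\<rho>\<in>A. indicator {0..} t *\<^sub>R (kernel_term \<rho> t * exp (- w * of_real t)))) (n * (1 / w ^ Suc (Suc m)) + (\<Sum>\<rho>\<in>A. j \<rho>))"
      by (intro has_bochner_integral_add has_bochner_integral_mult_right has_bochner_integral_sum hterm has_bochner_integral_power_exp[OF w0])
    moreover have "n * (indicator {0..} t *\<^sub>R (of_real (t ^ Suc m / fact (Suc m)) * exp (- w * of_real t)))
        + (\<Sum>\<rho>\<in>A. indicator {0..} t *\<^sub>R (kernel_term \<rho> t * exp (- w * of_real t)))
       = indicator {0..} t *\<^sub>R ((n * of_real (t ^ Suc m / fact (Suc m)) + (\<Sum>\<rho>\<in>A. kernel_term \<rho> t)) * exp (- w * of_real t))" for t
      by (simp only: distrib_right sum_distrib_right scaleR_right_distrib scaleR_sum_right mult_scaleR_right mult.assoc)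
    ultimately show ?thesis by (simp only:)
  qed
  have close: "norm ((n * (1 / w ^ Suc (Suc m)) + (\<Sum>\<rho>\<in>A. j \<rho>)) - I) \<le> \<epsilon> / (Re w - b)"
    if A: "\<forall>t\<in>{0..}. dist (\<Sum>\<rho>\<in>A. of_real (exp (- b * t)) * kernel_term \<rho> t) (of_real (exp (- b * t)) * G t) < \<epsilon>" for A \<epsilon>
  proof -
    define D where "D t = ((\<Sum>\<rho>\<in>A. kernel_term \<rho> t) - G t) * exp (- w * of_real t)" for t
    have eq: "indicator {0..} t *\<^sub>R ((n * of_real (t ^ Suc m / fact (Suc m)) + (\<Sum>\<rho>\<in>A. kernel_term \<rho> t)) * exp (- w * of_real t))
       - indicator {0..} t *\<^sub>R (K0 t * exp (- w * of_real t)) = indicator {0..} t *\<^sub>R D t" for t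
      unfolding D_def K0_def n_def scaleR_diff_right[symmetric] left_diff_distrib[symmetric] by simp
    have hI: "has_bochner_integral lborel (\<lambda>t. indicator {0..} t *\<^sub>R (K0 t * exp (- w * of_real t))) I"
      using intK by (simp add: has_bochner_integral_iff I_def)
    have hD: "has_bochner_integral lborel (\<lambda>t. indicator {0..} t *\<^sub>R D t) ((n * (1 / w ^ Suc (Suc m)) + (\<Sum>\<rho>\<in>A. j \<rho>)) - I)"
      using has_bochner_integral_diff[OF hA[of A] hI] unfolding eq .
    have "norm (LINT t|lborel. indicator {0..} t *\<^sub>R D t) \<le> \<epsilon> / (Re w - b)"
    proof (rule has_bochner_integral_half_line(2))
      show "(\<lambda>t. indicator {0..} t *\<^sub>R D t) \<in> borel_measurable borel"
        using borel_measurable_has_bochner_integral[OF hD] by simp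
      fix t :: real assume t: "t \<ge> 0"
      have "norm (of_real (exp (- b * t)) * ((\<Sum>\<rho>\<in>A. kernel_term \<rho> t) - G t)) < \<epsilon>"
        using A t by (simp add: dist_norm right_diff_distrib sum_distrib_left)
      then have "exp (- b * t) * norm ((\<Sum>\<rho>\<in>A. kernel_term \<rho> t) - G t) \<le> \<epsilon>" by (simp add: norm_mult)
      then have "exp (- b * t) * norm ((\<Sum>\<rho>\<in>A. kernel_term \<rho> t) - G t) * exp (- (Re w - b) * t) \<le> \<epsilon> * exp (- (Re w - b) * t)"
        by (intro mult_right_mono) auto
      moreover have "norm (D t) = exp (- b * t) * norm ((\<Sum>\<rho>\<in>A. kernel_term \<rho> t) - G t) * exp (- (Re w - b) * t)"
      proof -
        have "exp (- Re w * t) = exp (- b * t) * exp (- (Re w - b) * t)" unfolding exp_add[symmetric] by (simp add: algebra_simps)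
        then show ?thesis unfolding D_def norm_mult nexp by (simp only: mult_ac)
      qed
      ultimately show "norm (D t) \<le> \<epsilon> * exp (- (Re w - b) * t)" by simp
    qed (use w in simp)
    then show ?thesis using hD by (simp only: has_bochner_integral_integral_eq)
  qed
  have "((\<lambda>A. n * (1 / w ^ Suc (Suc m)) + (\<Sum>\<rho>\<in>A. j \<rho>)) \<longlongrightarrow> I) (finite_subsets_at_top (- {\<sigma>}))"
  proof (rule tendstoI)
    fix e :: real assume e: "e > 0"
    \<comment> \<open>Half of what is allowed, so that the final inequality is strict.\<close>
    define \<epsilon> where "\<epsilon> = e * (Re w - b) / 2"
    have \<epsilon>: "\<epsilon> > 0" using e w by (simp add: \<epsilon>_def)
    have x: "Re w - b > 0" using w by simp
    have "\<epsilon> < e * (Re w - b)" using mult_pos_pos[OF e x] by (simp add: \<epsilon>_def)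
    then have "\<epsilon> / (Re w - b) < e" by (subst pos_divide_less_eq[OF x])
    then have lt: "\<epsilon> / (Re w - b) < e" .
    show "\<forall>\<^sub>F A in finite_subsets_at_top (- {\<sigma>}). dist (n * (1 / w ^ Suc (Suc m)) + (\<Sum>\<rho>\<in>A. j \<rho>)) I < e"
      using uniform_limitD[OF uniform_limit_G \<epsilon>]
    proof eventually_elim
      case (elim A)
      from le_less_trans[OF close[OF elim] lt] show ?case unfolding dist_norm .
    qed
  qed
  from tendsto_diff[OF this tendsto_const[of "n * (1 / w ^ Suc (Suc m))"]]
  have "(sum j \<longlongrightarrow> I - n / w ^ Suc (Suc m)) (finite_subsets_at_top (- {\<sigma>}))" by simp
  then show ?thesis unfolding has_sum_def kI n_def j_def .
qed

text \<open>With \<open>u = \<rho> - \<sigma>\<close>, the identity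
  \<open>1 / (w - u) - 1 / w = u / ((w - u) w)\<close> turns \<open>w ^ Suc m\<close> times a term
  into \<open>n (w / u) ^ m / (w - u)\<close>, the logarithmic derivative of a Weierstrass factor
  with its multiplicity; the subtraction of the value at 0 is what makes the exponents match. The
  multiplicity at \<open>\<sigma>\<close> gives \<open>n / w\<close> on both sides.\<close>

lemma laplace_kernel:
  assumes Q: "hadamard_factorization f \<sigma> Q" and s: "Re s > b + 1 + Re \<sigma>"
  shows "(s - \<sigma>) ^ Suc m * (LINT t|lborel. k t * exp ((\<sigma> - s) * of_real t)) = deriv f s / f s - poly (pderiv Q) s"
proof -
  define w where "w = s - \<sigma>"
  define n where "n = complex_of_int (zorder f \<sigma>)"
  define I where "I = (LINT t|lborel. k t * exp (- w * of_real t))"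
  have w: "Re w > b + 1" using s by (simp add: w_def)
  have w0: "w \<noteq> 0" using w b_nonneg by auto
  have s1: "Re s > \<sigma>\<^sub>1" using s by (auto simp: b_def max_def split: if_splits)
  have zs: "zorder f s = 0" using left[of s] s1 by force
  have "((\<lambda>\<rho>. w ^ Suc m * (c \<rho> * (1 / (w - (\<rho> - \<sigma>)) - 1 / w))) has_sum (w ^ Suc m * (I - n / w ^ Suc (Suc m)))) (- {\<sigma>})"
    unfolding I_def n_def by (rule has_sum_cmult_right[OF laplace_kernel_has_sum[OF w]])
  moreover have "w ^ Suc m * (c \<rho> * (1 / (w - (\<rho> - \<sigma>)) - 1 / w)) = of_int (zorder f \<rho>) * (((s - \<sigma>) / (\<rho> - \<sigma>)) ^ m / (s - \<rho>))"
    if "\<rho> \<in> - {\<sigma>}" for \<rho>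
  proof (cases "zorder f \<rho> = 0")
    case False
    define u where "u = \<rho> - \<sigma>"
    have u: "u \<noteq> 0" "w - u \<noteq> 0" using that False zs by (auto simp: u_def w_def)
    have "1 / (w - u) - 1 / w = u / ((w - u) * w)" using u w0 by (simp add: field_simps)
    then have "w ^ Suc m * (c \<rho> * (1 / (w - u) - 1 / w)) = of_int (zorder f \<rho>) * ((w ^ m * w) / (u ^ m * u) * (u / ((w - u) * w)))"
      by (simp add: c_def u_def mult_ac)
    also have "(w ^ m * w) / (u ^ m * u) * (u / ((w - u) * w)) = (w / u) ^ m / (w - u)"
      using u w0 by (simp add: power_divide)
    finally show ?thesis by (simp add: u_def w_def)
  qed (simp add: c_def)
  ultimately have "((\<lambda>\<rho>. of_int (zorder f \<rho>) * (((s - \<sigma>) / (\<rho> - \<sigma>)) ^ m / (s - \<rho>))) has_sum (w ^ Suc m * (I - n / w ^ Suc (Suc m)))) (- {\<sigma>})"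
    by (rule has_sum_cong[THEN iffD1, rotated])
  from has_sum_unique[OF this log_deriv_has_sum[OF Q zs]] w0
  have "w ^ Suc m * (I - n / w ^ Suc (Suc m)) = deriv f s / f s - n / w - poly (pderiv Q) s" by (simp add: w_def n_def)
  moreover have "w ^ Suc m * (I - n / w ^ Suc (Suc m)) = w ^ Suc m * I - n / w"
    using w0 by (simp add: field_simps)
  ultimately have "w ^ Suc m * I = deriv f s / f s - poly (pderiv Q) s" by (simp only:) (simp add: algebra_simps)
  then show ?thesis by (simp only: I_def w_def minus_diff_eq)
qed

end

theorem theorem3p1:
  fixes f :: "complex \<Rightarrow> complex" and \<sigma> :: complex and \<sigma>\<^sub>1 :: real
  assumes "f nicely_meromorphic_on UNIV" and "\<exists>z. f z \<noteq> 0"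
    and "meromorphic_finite_order f"
    and "convergence_exponent f \<ge> 1"
    and "\<And>\<rho>. zorder f \<rho> \<noteq> 0 \<Longrightarrow> Re \<rho> \<le> \<sigma>\<^sub>1"
  shows "\<forall>\<phi>\<in>test_functions.
    newton_cramer f \<sigma> \<phi> =
      (\<Sum>j<genus f \<sigma>. coeff (discrepancy_poly f \<sigma>) j * (dist_deriv ^^ j) dirac \<phi>)
      + inverse_laplace (\<lambda>s. deriv f s / f s) \<phi>"
proof
  interpret K: meromorphic_left_half_plane f \<sigma> \<sigma>\<^sub>1
    by unfold_locales (use assms in auto)
  define d where "d = convergence_exponent f"
  define g where "g = genus f \<sigma>"
  define P where "P = discrepancy_poly f \<sigma>"
  have dm: "d = Suc K.m" by (simp add: d_def K.Suc_m)
  obtain C where C: "\<And>t. t \<ge> 0 \<Longrightarrow> norm (K.K0 t) \<le> C * exp ((K.b + 1) * t)" by (rule K.K0_le) blast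
  \<comment> \<open>\<open>(dist_deriv ^^ j) dirac\<close> is \<open>(- 1) ^ j\<close> times the
    \<open>j\<close>-th derivative at 0; the outer sign subtracts the delta terms, so that
    \<open>D.W\<close> is the candidate for the inverse transform.\<close>
  define a where "a j = - (coeff P j * (- 1) ^ j)" for j
  interpret D: exponential_distribution K.k C "K.b + 1" \<sigma> d g "(- 1) ^ d" a
  proof
    show "K.k \<in> borel_measurable borel" unfolding K.k_def[abs_def] by (rule measurable_half_line[OF K.continuous_K0])
  qed (use C in \<open>auto simp: K.k_def\<close>)
  \<comment> \<open>\<open>hadamard_poly\<close> is an arbitrary choice; the existence of a
    factorization guarantees that the chosen polynomial factorizes \<open>f\<close>.\<close>
  have Q: "hadamard_factorization f \<sigma> (hadamard_poly f \<sigma>)"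
    unfolding hadamard_poly_def by (rule someI_ex[OF K.hadamard_exists])
  have P: "(\<Sum>j<g. coeff P j * s ^ j) = - poly (pderiv (hadamard_poly f \<sigma>)) s" for s
  proof -
    \<comment> \<open>The sum runs up to the genus, which may exceed the degree of \<open>P\<close>.
      As the genus bounds the degree of the Hadamard polynomial, its derivative has no coefficient
      from index \<open>g\<close> on.\<close>
    have zero: "coeff P j = 0" if "j \<ge> g" for j
    proof -
      have "degree (hadamard_poly f \<sigma>) \<le> j" using that by (simp add: g_def genus_def)
      then have "coeff (hadamard_poly f \<sigma>) (Suc j) = 0" by (intro coeff_eq_0) simp
      then show ?thesis by (simp add: P_def discrepancy_poly_def coeff_pderiv)
    qed
    have "poly P s = (\<Sum>j\<le>degree P. coeff P j * s ^ j)" by (rule poly_altdef)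
    also have "\<dots> = (\<Sum>j\<in>{..<g} \<union> {..degree P}. coeff P j * s ^ j)"
      by (rule sum.mono_neutral_left) (auto simp: coeff_eq_0)
    also have "\<dots> = (\<Sum>j<g. coeff P j * s ^ j)"
      by (rule sum.mono_neutral_right) (auto simp: zero)
    finally show ?thesis by (simp add: P_def discrepancy_poly_def)
  qed
  have W: "D.W \<phi> = newton_cramer f \<sigma> \<phi> - (\<Sum>j<g. coeff P j * (dist_deriv ^^ j) dirac \<phi>)" for \<phi>
  proof -
    have "newton_cramer f \<sigma> \<phi> = (- 1) ^ d * (LINT t|lborel. K.k t * vd d (\<lambda>t. exp (\<sigma> * of_real t) * \<phi> t) t)"
      unfolding newton_cramer_def dist_mult_def higher_dist_deriv K.kernel_eq dist_of_fun_def d_def ..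
    moreover have "(\<Sum>j<g. a j * vd j \<phi> 0) = - (\<Sum>j<g. coeff P j * (dist_deriv ^^ j) dirac \<phi>)"
      unfolding sum_negf[symmetric] by (intro sum.cong refl) (simp add: a_def higher_dist_deriv dirac_def)
    ultimately show ?thesis by (simp add: D.W_def)
  qed
  have LT: "laplace_transform D.W s = deriv f s / f s" if s: "Re s > K.b + 1 + Re \<sigma>" for s
  proof -
    have "laplace_transform D.W s = (- 1) ^ d * (\<sigma> - s) ^ d * (LINT t|lborel. K.k t * exp ((\<sigma> - s) * of_real t)) + (\<Sum>j<g. a j * (- s) ^ j)"
      by (rule D.laplace_transform_W[OF s])
    also have "(- 1) ^ d * (\<sigma> - s) ^ d = (s - \<sigma>) ^ Suc K.m"
      unfolding power_mult_distrib[symmetric] dm by simp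
    also have "(s - \<sigma>) ^ Suc K.m * (LINT t|lborel. K.k t * exp ((\<sigma> - s) * of_real t)) = deriv f s / f s - poly (pderiv (hadamard_poly f \<sigma>)) s"
      by (rule K.laplace_kernel[OF Q s])
    \<comment> \<open>The delta terms contribute \<open>- P(s) = Q'(s)\<close>, which cancels the
      \<open>- Q'(s)\<close> from the kernel.\<close>
    also have "(\<Sum>j<g. a j * (- s) ^ j) = - (\<Sum>j<g. coeff P j * s ^ j)"
    proof -
      have "a j * (- s) ^ j = - (coeff P j * s ^ j)" for j
      proof -
        have "(- 1) ^ j * (- s) ^ j = s ^ j" unfolding power_mult_distrib[symmetric] by simp
        then show ?thesis by (simp add: a_def mult.assoc)
      qed
      then show ?thesis by (simp add: sum_negf)
    qed
    finally show ?thesis by (simp add: P)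
  qed
  fix \<phi> assume \<phi>: "\<phi> \<in> test_functions"
  have "inverse_laplace (\<lambda>s. deriv f s / f s) \<phi> = newton_cramer f \<sigma> \<phi> - (\<Sum>j<g. coeff P j * (dist_deriv ^^ j) dirac \<phi>)"
    by (rule trans[OF inverse_laplace_eqI[OF D.laplace_transformable_W LT \<phi>] W])
  then show "newton_cramer f \<sigma> \<phi> =
      (\<Sum>j<genus f \<sigma>. coeff (discrepancy_poly f \<sigma>) j * (dist_deriv ^^ j) dirac \<phi>)
      + inverse_laplace (\<lambda>s. deriv f s / f s) \<phi>"
    by (simp add: g_def P_def)
qed

end
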